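(* In the setting of the context, let $\rho>0$, $\varkappa=3\ln(6K)$, and let $(\mathcal{S}[\rho])$ be the explicit system of convex constraints defined in the context. Call $\chi$ feasible for the problem of interest at level $s>0$ if it satisfies the constraints $(\ast_s)$ of the context. Then: (1) The $\chi$-component of every feasible solution of $(\mathcal{S}[\rho])$ is feasible for the problem of interest at level $\rho$. (2) If $K=1$, every $\chi$ feasible for the problem of interest at level $\rho$ is the $\chi$-component of a feasible solution of $(\mathcal{S}[\rho])$; in particular $(\mathcal{S}[\rho])$ is infeasible if and only if the problem of interest at level $\rho$ is infeasible. (3) If $K>1$ and $(\mathcal{S}[\rho])$ is infeasible, then the problem of interest at level $\varkappa\rho$ is infeasible. (4) Let $\gamma$ denote the collection of right-hand sides $\gamma_i$ ($i\in\mathcal{I}_1\cup\mathcal{I}_2\cup\mathcal{I}_3$) and $\Sigma_i$ ($i\in\mathcal{I}_4$), now treated as variables in addition to $\chi$. Let $f(\chi,\gamma)$ be a convex function and let a (possibly empty) system $(A)$ of convex constraints on $(\chi,\gamma)$ be given. Let $\mathcal{P}[s]$ be the problem of minimizing $f(\chi,\gamma)$ over $(\chi,\gamma)$ subject to $(\ast_s)$ and $(A)$, and let $\mathcal{P}^+[s]$ be the problem of minimizing $f(\chi,\gamma)$ over $\gamma$ and all variables of $(\mathcal{S}[s])$ subject to $(\mathcal{S}[s])$ and $(A)$. Then every feasible solution of $\mathcal{P}^+[\rho]$ induces (through its $(\chi,\gamma)$-component) a feasible solution of $\mathcal{P}[\rho]$ with the same objective value, and $$\mathrm{Opt}[\mathcal{P}[\rho]]\le\mathrm{Opt}[\mathcal{P}^+[\rho]]\le\mathrm{Opt}[\mathcal{P}[\varkappa\rho]]\qquad\forall\rho>0,$$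 where $\mathrm{Opt}[\cdot]$ denotes the optimal value of a minimization problem ($+\infty$ if infeasible).
   Context: Notation: $\mathbb{S}^m$ is the space of real symmetric $m\times m$ matrices, $\mathbb{S}^m_+$ the positive semidefinite cone, $A\succeq B$ means $A-B\in\mathbb{S}^m_+$; $\|\cdot\|_{\mathrm{Fro}}$ is the Frobenius norm; $[u_1;\dots;u_k]$ denotes vertical stacking. System. For $0\le t\le N-1$, $\mathbf{x}_0=\mathbf{z}+\mathbf{s}_0$, $\mathbf{x}_{t+1}=A_t\mathbf{x}_t+B_t\mathbf{u}_t+B^{(d)}_t\mathbf{d}_t+B^{(s)}_t\mathbf{e}_t$, $\mathbf{y}_t=C_t\mathbf{x}_t+D^{(d)}_t\mathbf{d}_t+D^{(s)}_t\mathbf{e}_t$, with known matrices, states $\mathbf{x}_t\in\mathbb{R}^{n_x}$, controls $\mathbf{u}_t\in\mathbb{R}^{n_u}$, outputs $\mathbf{y}_t\in\mathbb{R}^{n_y}$. The deterministic disturbance is $\zeta=[\mathbf{z};\mathbf{d}_0;\dots;\mathbf{d}_{N-1}]\in\mathbb{R}^{n_\zeta}$; the stochastic disturbance $\epsilon=[\mathbf{s}_0;\mathbf{e}_0;\dots;\mathbf{e}_{N-1}]\in\mathbb{R}^{n_\epsilon}$ is a random vector with zero mean and known covariance matrix $\Pi$. Control law. The purified outputs are $\mathbf{v}_t=\mathbf{y}_t-\hat{\mathbf{y}}_t$, where $\hat{\mathbf{x}}_0=0$, $\hat{\mathbf{x}}_{t+1}=A_t\hat{\mathbf{x}}_t+B_t\mathbf{u}_t$,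 $\hat{\mathbf{y}}_t=C_t\hat{\mathbf{x}}_t$; they do not depend on the controls. An affine purified-output-based (POB) control law is $\mathbf{u}_t=h_t+\sum_{i=0}^tH^t_i\mathbf{v}_i$, $0\le t\le N-1$, with parameters $\chi=\{h_t\in\mathbb{R}^{n_u},H^t_j\in\mathbb{R}^{n_u\times n_y}\}_{0\le j\le t\le N-1}$. The state-control trajectory is $\mathbf{w}=[\mathbf{x}_1;\dots;\mathbf{x}_N;\mathbf{u}_0;\dots;\mathbf{u}_{N-1}]\in\mathbb{R}^{n_w}$, $n_w=(n_x+n_u)N$. Under the law with parameters $\chi$ it has the form $\mathbf{w}=\mathbf{Z}[\chi][\zeta;1]+\mathbf{E}[\chi]\epsilon$ for all $\zeta,\epsilon$, where the (uniquely determined) matrices $\mathbf{Z}[\chi]$, $\mathbf{E}[\chi]$ are affine functions of $\chi$. Set $\mu_{\mathbf{w}}[\chi,\zeta]=\mathbb{E}_\epsilon[\mathbf{w}]$, and let $\Sigma_{\mathbf{w}}[\chi]=\mathbf{E}[\chi]\Pi\mathbf{E}[\chi]^{\mathrm T}$ be the covariance matrix of $\mathbf{w}$ with respect to $\epsilon$ (independent of $\zeta$). Uncertainty set (ellitope). For $s>0$, $\mathscr{D}[s]=\{\zeta\in\mathbb{R}^{n_\zeta}:\exists z\in\mathbb{R}^{\bar n},t\in\mathcal{T}:\zeta=Pz,\ z^{\mathrm T}S_kz\le s\,t_k,\ k\le K\}$, where $P\in\mathbb{R}^{n_\zeta\times\bar n}$, $S_k\in\mathbb{S}^{\bar n}_+$,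 $\sum_kS_k$ is positive definite, and $\mathcal{T}\subset\mathbb{R}^K_+$ is a nonempty convex compact set intersecting the interior of $\mathbb{R}^K_+$ and monotone ($0\le t\le t'\in\mathcal{T}$ implies $t\in\mathcal{T}$). $\phi_{\mathcal{T}}(\lambda)=\max_{t\in\mathcal{T}}\lambda^{\mathrm T}t$. Problem of interest. $\mathcal{I}_1,\dots,\mathcal{I}_4$ are disjoint finite index sets; $\mathcal{A}_i\in\mathbb{S}^{n_w}_+$, $\beta_i\in\mathbb{R}^{n_w}$, $\gamma_i\in\mathbb{R}$ for $i\in\mathcal{I}_1\cup\mathcal{I}_3$; $a_i\in\mathbb{R}^{n_w}$, $\gamma_i\in\mathbb{R}$ for $i\in\mathcal{I}_2$; $\mathcal{Q}_i\in\mathbb{R}^{m_i\times n_w}$, $\Sigma_i\in\mathbb{S}^{m_i}$ positive definite for $i\in\mathcal{I}_4$. The constraints $(\ast_s)$ on $\chi$ are: for all $\zeta\in\mathscr{D}[s]$, $\mathbb{E}_\epsilon[\langle\mathcal{A}_i(\mathbf{w}-\beta_i),\mathbf{w}-\beta_i\rangle]\le\gamma_i$, $i\in\mathcal{I}_1$; for all $\zeta\in\mathscr{D}[s]$, $\langle a_i,\mu_{\mathbf{w}}[\chi,\zeta]\rangle\le\gamma_i$, $i\in\mathcal{I}_2$; for all $\zeta\in\mathscr{D}[s]$, $\langle\mathcal{A}_i(\mu_{\mathbf{w}}[\chi,\zeta]-\beta_i),\mu_{\mathbf{w}}[\chi,\zeta]-\beta_i\rangle\le\gamma_i$, $i\in\mathcal{I}_3$;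 $\mathcal{Q}_i\Sigma_{\mathbf{w}}[\chi]\mathcal{Q}_i^{\mathrm T}\preceq\Sigma_i$, $i\in\mathcal{I}_4$. The system $(\mathcal{S}[s])$. Put $R=\Pi^{1/2}$, $r_i=\beta_i^{\mathrm T}\mathcal{A}_i\beta_i$ for $i\in\mathcal{I}_1\cup\mathcal{I}_3$, and let $p_i[\chi]\in\mathbb{R}^{n_\zeta}$, $q_i[\chi]\in\mathbb{R}$ (affine in $\chi$) be defined by the identities in $\zeta$: $-2\beta_i^{\mathrm T}\mathcal{A}_i\mathbf{Z}[\chi][\zeta;1]=2p_i[\chi]^{\mathrm T}\zeta+q_i[\chi]$ for $i\in\mathcal{I}_1\cup\mathcal{I}_3$, and $a_i^{\mathrm T}\mathbf{Z}[\chi][\zeta;1]=2p_i[\chi]^{\mathrm T}\zeta+q_i[\chi]$ for $i\in\mathcal{I}_2$. The variables of $(\mathcal{S}[s])$ are $\chi$ together with $X_i\in\mathbb{S}^{n_\zeta}$, $x_i\in\mathbb{R}^{n_\zeta}$, $\alpha_i,\delta_i\in\mathbb{R}$, $i\in\mathcal{I}_1\cup\mathcal{I}_3$; $\lambda^i\in\mathbb{R}^K$, $\alpha_i\in\mathbb{R}$, $i\in\mathcal{I}_2$; and the variables $\lambda^i$, $\tau_i$ below. Its constraints are the "simple" constraints $$\begin{bmatrix} X_i & x_i \\ x_i^{\mathrm T} & \alpha_i \end{bmatrix}\succeq\mathbf{Z}[\chi]^{\mathrm T}\mathcal{A}_i\mathbf{Z}[\chi],\ i\in\mathcal{I}_1\cup\mathcal{I}_3,$$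 $$\alpha_i+\delta_i+\|\mathcal{A}_i^{1/2}\mathbf{E}[\chi]R\|^2_{\mathrm{Fro}}+r_i\le\gamma_i,\ i\in\mathcal{I}_1;\qquad\alpha_i+\delta_i+r_i\le\gamma_i,\ i\in\mathcal{I}_3,$$ $$\lambda^i\ge0,\ \begin{bmatrix} \alpha_i & -p_i[\chi]^{\mathrm T}P \\ -P^{\mathrm T}p_i[\chi] & \sum_k\lambda^i_kS_k \end{bmatrix}\succeq0,\ \alpha_i+s\,\phi_{\mathcal{T}}(\lambda^i)+q_i[\chi]\le\gamma_i,\ i\in\mathcal{I}_2,$$ $$\begin{bmatrix} \Sigma_i & \mathcal{Q}_i\mathbf{E}[\chi]R \\ R^{\mathrm T}\mathbf{E}[\chi]^{\mathrm T}\mathcal{Q}_i^{\mathrm T} & I_{n_\epsilon} \end{bmatrix}\succeq0,\ i\in\mathcal{I}_4,$$ and, for every $i\in\mathcal{I}_1\cup\mathcal{I}_3$, with $\bar x_i=x_i+p_i[\chi]$ and $\xi_i=\delta_i-q_i[\chi]$: if $K>1$, with variables $\lambda^i\in\mathbb{R}^K$, $\tau_i\in\mathbb{R}$: $\ \lambda^i\ge0$, $\begin{bmatrix} \sum_k\lambda^i_kS_k-P^{\mathrm T}X_iP & -P^{\mathrm T}\bar x_i \\ -\bar x_i^{\mathrm T}P & \tau_i \end{bmatrix}\succeq0$, $s\,\phi_{\mathcal{T}}(\lambda^i)+\tau_i\le\xi_i$; if $K=1$, with variable $\lambda^i\in\mathbb{R}$ and $\bar Q=S_1/(s\max_{t\in\mathcal{T}}t_1)$: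 $\ \lambda^i\ge0$, $\begin{bmatrix} \lambda^i\bar Q-P^{\mathrm T}X_iP & P^{\mathrm T}\bar x_i \\ \bar x_i^{\mathrm T}P & \xi_i-\lambda^i \end{bmatrix}\succeq0$. *)

theory Defs
  imports "HOL-Probability.Probability" "Jordan_Normal_Form.Matrix"
begin

text \<open>
  Vectors and matrices whose dimensions are data of the problem (state, control, output and
  disturbance dimensions, horizon, the sizes \<open>m_i\<close>) are the carrier-based ones of
  \<open>Jordan_Normal_Form\<close>. Only the space \<open>\<real>^K\<close> containing the set \<open>\<T>\<close> of the ellitope is the
  type \<open>real ^ 'k\<close>, so that compactness, convexity and interior are the library notions.
\<close>

hide_type (open) Finite_Cartesian_Product.vec
hide_const (open) Finite_Cartesian_Product.vec
unbundle no vec_syntax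
unbundle no inner_syntax
notation Matrix.vec_index (infixl "$" 100)
notation Matrix.scalar_prod (infix "\<bullet>" 70)
notation Finite_Cartesian_Product.vec_nth (infixl "$h" 90)


section \<open>Matrices\<close>

definition sym_mats :: "nat \<Rightarrow> real mat set" where
  "sym_mats n = {A \<in> carrier_mat n n. transpose_mat A = A}"

definition psd :: "nat \<Rightarrow> real mat \<Rightarrow> bool" where
  "psd n A \<longleftrightarrow> A \<in> sym_mats n \<and> (\<forall>x \<in> carrier_vec n. 0 \<le> x \<bullet> (A *\<^sub>v x))"

definition posdef :: "nat \<Rightarrow> real mat \<Rightarrow> bool" where
  "posdef n A \<longleftrightarrow>
     A \<in> sym_mats n \<and> (\<forall>x \<in> carrier_vec n. x \<noteq> 0\<^sub>v n \<longrightarrow> 0 < x \<bullet> (A *\<^sub>v x))"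

definition loewner_le :: "nat \<Rightarrow> real mat \<Rightarrow> real mat \<Rightarrow> bool" where
  "loewner_le n A B \<longleftrightarrow> psd n (B - A)"

definition psd_sqrt :: "nat \<Rightarrow> real mat \<Rightarrow> real mat" where
  "psd_sqrt n A = (THE B. psd n B \<and> B * B = A)"

definition frob_norm :: "real mat \<Rightarrow> real" where
  "frob_norm A = sqrt (\<Sum>i<dim_row A. \<Sum>j<dim_col A. (A $$ (i, j))\<^sup>2)"

definition col_block :: "real vec \<Rightarrow> real mat" where
  "col_block x = mat_of_cols (dim_vec x) [x]"

definition row_block :: "real vec \<Rightarrow> real mat" where
  "row_block x = mat_of_rows (dim_vec x) [x]"

definition scalar_block :: "real \<Rightarrow> real mat" where
  "scalar_block a = mat 1 1 (\<lambda>_. a)"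

definition bordered_last :: "real mat \<Rightarrow> real vec \<Rightarrow> real \<Rightarrow> real mat" where
  "bordered_last X x a = four_block_mat X (col_block x) (row_block x) (scalar_block a)"

definition bordered_first :: "real \<Rightarrow> real vec \<Rightarrow> real mat \<Rightarrow> real mat" where
  "bordered_first a x X = four_block_mat (scalar_block a) (row_block x) (col_block x) X"

definition vec_slice :: "real vec \<Rightarrow> nat \<Rightarrow> nat \<Rightarrow> real vec" where
  "vec_slice v off len = vec len (\<lambda>i. v $ (off + i))"

primrec vstack :: "(nat \<Rightarrow> real vec) \<Rightarrow> nat \<Rightarrow> real vec" where
  "vstack f 0 = 0\<^sub>v 0"
| "vstack f (Suc n) = vstack f n @\<^sub>v f n"


section \<open>The controlled system\<close>

record plant =
  horizon :: nat
  x_dim :: nat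
  u_dim :: nat
  y_dim :: nat
  d_dim :: "nat \<Rightarrow> nat"
  e_dim :: "nat \<Rightarrow> nat"
  matA :: "nat \<Rightarrow> real mat"
  matB :: "nat \<Rightarrow> real mat"
  matBd :: "nat \<Rightarrow> real mat"
  matBs :: "nat \<Rightarrow> real mat"
  matC :: "nat \<Rightarrow> real mat"
  matDd :: "nat \<Rightarrow> real mat"
  matDs :: "nat \<Rightarrow> real mat"

definition plant_wf :: "plant \<Rightarrow> bool" where
  "plant_wf sys \<longleftrightarrow> (\<forall>t < horizon sys.
     matA sys t \<in> carrier_mat (x_dim sys) (x_dim sys) \<and>
     matB sys t \<in> carrier_mat (x_dim sys) (u_dim sys) \<and>
     matBd sys t \<in> carrier_mat (x_dim sys) (d_dim sys t) \<and>
     matBs sys t \<in> carrier_mat (x_dim sys) (e_dim sys t) \<and>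
     matC sys t \<in> carrier_mat (y_dim sys) (x_dim sys) \<and>
     matDd sys t \<in> carrier_mat (y_dim sys) (d_dim sys t) \<and>
     matDs sys t \<in> carrier_mat (y_dim sys) (e_dim sys t))"

definition n_zeta :: "plant \<Rightarrow> nat" where
  "n_zeta sys = x_dim sys + (\<Sum>t<horizon sys. d_dim sys t)"

definition n_eps :: "plant \<Rightarrow> nat" where
  "n_eps sys = x_dim sys + (\<Sum>t<horizon sys. e_dim sys t)"

definition n_w :: "plant \<Rightarrow> nat" where
  "n_w sys = (x_dim sys + u_dim sys) * horizon sys"

text \<open>The blocks of \<open>\<zeta> = [z; d_0; \<dots>; d_{N-1}]\<close> and \<open>\<epsilon> = [s_0; e_0; \<dots>; e_{N-1}]\<close>.\<close>

definition z_part :: "plant \<Rightarrow> real vec \<Rightarrow> real vec" where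
  "z_part sys \<zeta> = vec_slice \<zeta> 0 (x_dim sys)"

definition d_part :: "plant \<Rightarrow> real vec \<Rightarrow> nat \<Rightarrow> real vec" where
  "d_part sys \<zeta> t = vec_slice \<zeta> (x_dim sys + (\<Sum>\<tau><t. d_dim sys \<tau>)) (d_dim sys t)"

definition s_part :: "plant \<Rightarrow> real vec \<Rightarrow> real vec" where
  "s_part sys e = vec_slice e 0 (x_dim sys)"

definition e_part :: "plant \<Rightarrow> real vec \<Rightarrow> nat \<Rightarrow> real vec" where
  "e_part sys e t = vec_slice e (x_dim sys + (\<Sum>\<tau><t. e_dim sys \<tau>)) (e_dim sys t)"

text \<open>
  The parameters \<open>(h, H)\<close> of an affine purified-output-based law, with \<open>H t j\<close> standing for
  \<open>H^t_j\<close>. Extensionality makes \<open>pob_laws\<close> a copy of the finite-dimensional parameter space.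
\<close>

type_synonym pob_law = "(nat \<Rightarrow> real vec) \<times> (nat \<Rightarrow> nat \<Rightarrow> real mat)"

definition pob_laws :: "plant \<Rightarrow> pob_law set" where
  "pob_laws sys =
     (\<Pi>\<^sub>E t\<in>{..<horizon sys}. carrier_vec (u_dim sys)) \<times>
     (\<Pi>\<^sub>E t\<in>{..<horizon sys}. \<Pi>\<^sub>E j\<in>{..t}. carrier_mat (u_dim sys) (y_dim sys))"

text \<open>The closed loop; the arguments are the law, \<open>\<zeta>\<close>, a realization \<open>e\<close> of \<open>\<epsilon>\<close>, and the time.\<close>

function state :: "plant \<Rightarrow> pob_law \<Rightarrow> real vec \<Rightarrow> real vec \<Rightarrow> nat \<Rightarrow> real vec"
  and model_state :: "plant \<Rightarrow> pob_law \<Rightarrow> real vec \<Rightarrow> real vec \<Rightarrow> nat \<Rightarrow> real vec"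
  and purified :: "plant \<Rightarrow> pob_law \<Rightarrow> real vec \<Rightarrow> real vec \<Rightarrow> nat \<Rightarrow> real vec"
  and control :: "plant \<Rightarrow> pob_law \<Rightarrow> real vec \<Rightarrow> real vec \<Rightarrow> nat \<Rightarrow> real vec"
where
  "state sys c \<zeta> e 0 = z_part sys \<zeta> + s_part sys e"
| "state sys c \<zeta> e (Suc t) =
     matA sys t *\<^sub>v state sys c \<zeta> e t + matB sys t *\<^sub>v control sys c \<zeta> e t
     + matBd sys t *\<^sub>v d_part sys \<zeta> t + matBs sys t *\<^sub>v e_part sys e t"
| "model_state sys c \<zeta> e 0 = 0\<^sub>v (x_dim sys)"
| "model_state sys c \<zeta> e (Suc t) =
     matA sys t *\<^sub>v model_state sys c \<zeta> e t + matB sys t *\<^sub>v control sys c \<zeta> e t"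
| "purified sys c \<zeta> e t =
     (matC sys t *\<^sub>v state sys c \<zeta> e t
      + matDd sys t *\<^sub>v d_part sys \<zeta> t + matDs sys t *\<^sub>v e_part sys e t)
     - matC sys t *\<^sub>v model_state sys c \<zeta> e t"
| "control sys c \<zeta> e t =
     fst c t + vec (u_dim sys) (\<lambda>a. \<Sum>i\<le>t. (snd c t i *\<^sub>v purified sys c \<zeta> e i) $ a)"
  by pat_completeness auto
termination
  by (relation "Wellfounded.measure (\<lambda>p. case p of
        Inl (Inl (_, _, _, _, t)) \<Rightarrow> 3 * t
      | Inl (Inr (_, _, _, _, t)) \<Rightarrow> 3 * t
      | Inr (Inl (_, _, _, _, t)) \<Rightarrow> 3 * t + 1
      | Inr (Inr (_, _, _, _, t)) \<Rightarrow> 3 * t + 2)") auto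

definition traj :: "plant \<Rightarrow> pob_law \<Rightarrow> real vec \<Rightarrow> real vec \<Rightarrow> real vec" where
  "traj sys c \<zeta> e =
     vstack (\<lambda>t. state sys c \<zeta> e (Suc t)) (horizon sys) @\<^sub>v
     vstack (\<lambda>t. control sys c \<zeta> e t) (horizon sys)"

definition aug :: "real vec \<Rightarrow> real vec" where
  "aug \<zeta> = \<zeta> @\<^sub>v vec_of_list [1]"

definition traj_mats :: "plant \<Rightarrow> pob_law \<Rightarrow> real mat \<times> real mat" where
  "traj_mats sys c = (THE (Z, E).
     Z \<in> carrier_mat (n_w sys) (n_zeta sys + 1) \<and> E \<in> carrier_mat (n_w sys) (n_eps sys) \<and>
     (\<forall>\<zeta> \<in> carrier_vec (n_zeta sys). \<forall>e \<in> carrier_vec (n_eps sys).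
        traj sys c \<zeta> e = Z *\<^sub>v aug \<zeta> + E *\<^sub>v e))"

definition Zmat :: "plant \<Rightarrow> pob_law \<Rightarrow> real mat" where
  "Zmat sys c = fst (traj_mats sys c)"

definition Emat :: "plant \<Rightarrow> pob_law \<Rightarrow> real mat" where
  "Emat sys c = snd (traj_mats sys c)"


section \<open>Disturbances\<close>

definition zero_mean_with_cov ::
  "'w measure \<Rightarrow> ('w \<Rightarrow> real vec) \<Rightarrow> nat \<Rightarrow> real mat \<Rightarrow> bool" where
  "zero_mean_with_cov M eps n Cov \<longleftrightarrow>
     (\<forall>\<omega> \<in> space M. eps \<omega> \<in> carrier_vec n) \<and> Cov \<in> carrier_mat n n \<and>
     (\<forall>i<n. integrable M (\<lambda>\<omega>. eps \<omega> $ i) \<and> (\<integral>\<omega>. eps \<omega> $ i \<partial>M) = 0) \<and>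
     (\<forall>i<n. \<forall>j<n. integrable M (\<lambda>\<omega>. eps \<omega> $ i * eps \<omega> $ j) \<and>
        (\<integral>\<omega>. eps \<omega> $ i * eps \<omega> $ j \<partial>M) = Cov $$ (i, j))"

definition mean_traj ::
  "'w measure \<Rightarrow> ('w \<Rightarrow> real vec) \<Rightarrow> plant \<Rightarrow> pob_law \<Rightarrow> real vec \<Rightarrow> real vec" where
  "mean_traj M eps sys c \<zeta> = vec (n_w sys) (\<lambda>j. \<integral>\<omega>. traj sys c \<zeta> (eps \<omega>) $ j \<partial>M)"

definition cov_traj :: "real mat \<Rightarrow> plant \<Rightarrow> pob_law \<Rightarrow> real mat" where
  "cov_traj Cov sys c = Emat sys c * Cov * transpose_mat (Emat sys c)"

text \<open>The number \<open>K\<close> of the ellitope is \<open>CARD('k)\<close>.\<close>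

record ('k::finite) ellitope =
  ell_dim :: nat
  ell_P :: "real mat"
  ell_S :: "'k \<Rightarrow> real mat"
  ell_T :: "(real ^ 'k) set"

definition weighted_S :: "('k::finite) ellitope \<Rightarrow> real ^ 'k \<Rightarrow> real mat" where
  "weighted_S el l = mat (ell_dim el) (ell_dim el) (\<lambda>ij. \<Sum>k\<in>UNIV. l $h k * ell_S el k $$ ij)"

definition ellitope_wf :: "nat \<Rightarrow> ('k::finite) ellitope \<Rightarrow> bool" where
  "ellitope_wf n el \<longleftrightarrow>
     ell_P el \<in> carrier_mat n (ell_dim el) \<and>
     (\<forall>k. psd (ell_dim el) (ell_S el k)) \<and>
     posdef (ell_dim el) (weighted_S el (vec_lambda (\<lambda>_. 1))) \<and>
     convex (ell_T el) \<and> compact (ell_T el) \<and>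
     ell_T el \<subseteq> {t. \<forall>k. 0 \<le> t $h k} \<and>
     ell_T el \<inter> interior {t. \<forall>k. 0 \<le> t $h k} \<noteq> {} \<and>
     (\<forall>t' \<in> ell_T el. \<forall>t. (\<forall>k. 0 \<le> t $h k \<and> t $h k \<le> t' $h k) \<longrightarrow> t \<in> ell_T el)"

definition ell_set :: "('k::finite) ellitope \<Rightarrow> real \<Rightarrow> real vec set" where
  "ell_set el s = {\<zeta>. \<exists>z \<in> carrier_vec (ell_dim el). \<exists>t \<in> ell_T el.
     \<zeta> = ell_P el *\<^sub>v z \<and> (\<forall>k. z \<bullet> (ell_S el k *\<^sub>v z) \<le> s * t $h k)}"

text \<open>The suprema below are maxima, the set being compact and nonempty.\<close>

definition supp_T :: "('k::finite) ellitope \<Rightarrow> real ^ 'k \<Rightarrow> real" where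
  "supp_T el l = (SUP t\<in>ell_T el. inner l t)"

text \<open>\<open>Qbar el s k\<close> is only used when \<open>k\<close> is the unique index.\<close>

definition Qbar :: "('k::finite) ellitope \<Rightarrow> real \<Rightarrow> 'k \<Rightarrow> real mat" where
  "Qbar el s k = (1 / (s * (SUP t\<in>ell_T el. t $h k))) \<cdot>\<^sub>m ell_S el k"


section \<open>The problem of interest\<close>

record 'i specs =
  I1 :: "'i set"
  I2 :: "'i set"
  I3 :: "'i set"
  I4 :: "'i set"
  quadA :: "'i \<Rightarrow> real mat"
  center :: "'i \<Rightarrow> real vec"
  lin_a :: "'i \<Rightarrow> real vec"
  m_dim :: "'i \<Rightarrow> nat"
  covQ :: "'i \<Rightarrow> real mat"

definition specs_wf :: "nat \<Rightarrow> 'i specs \<Rightarrow> bool" where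
  "specs_wf n sp \<longleftrightarrow>
     finite (I1 sp) \<and> finite (I2 sp) \<and> finite (I3 sp) \<and> finite (I4 sp) \<and>
     I1 sp \<inter> I2 sp = {} \<and> I1 sp \<inter> I3 sp = {} \<and> I1 sp \<inter> I4 sp = {} \<and>
     I2 sp \<inter> I3 sp = {} \<and> I2 sp \<inter> I4 sp = {} \<and> I3 sp \<inter> I4 sp = {} \<and>
     (\<forall>i \<in> I1 sp \<union> I3 sp. psd n (quadA sp i) \<and> center sp i \<in> carrier_vec n) \<and>
     (\<forall>i \<in> I2 sp. lin_a sp i \<in> carrier_vec n) \<and>
     (\<forall>i \<in> I4 sp. covQ sp i \<in> carrier_mat (m_dim sp i) n)"

text \<open>The right-hand sides: the reals \<open>\<gamma>_i\<close> and the matrices \<open>\<Sigma>_i\<close>.\<close>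

type_synonym 'i rhs = "('i \<Rightarrow> real) \<times> ('i \<Rightarrow> real mat)"

definition rhs_space :: "'i specs \<Rightarrow> 'i rhs set" where
  "rhs_space sp = (\<Pi>\<^sub>E i\<in>I1 sp \<union> I2 sp \<union> I3 sp. UNIV) \<times> (\<Pi>\<^sub>E i\<in>I4 sp. sym_mats (m_dim sp i))"

definition poi_feasible ::
  "'w measure \<Rightarrow> ('w \<Rightarrow> real vec) \<Rightarrow> real mat \<Rightarrow> plant \<Rightarrow> ('k::finite) ellitope \<Rightarrow> 'i specs \<Rightarrow>
   'i rhs \<Rightarrow> real \<Rightarrow> pob_law \<Rightarrow> bool" where
  "poi_feasible M eps Cov sys el sp g s c \<longleftrightarrow>
     c \<in> pob_laws sys \<and>
     (\<forall>i \<in> I1 sp. \<forall>\<zeta> \<in> ell_set el s.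
        (\<integral>\<omega>. (quadA sp i *\<^sub>v (traj sys c \<zeta> (eps \<omega>) - center sp i))
              \<bullet> (traj sys c \<zeta> (eps \<omega>) - center sp i) \<partial>M) \<le> fst g i) \<and>
     (\<forall>i \<in> I2 sp. \<forall>\<zeta> \<in> ell_set el s. lin_a sp i \<bullet> mean_traj M eps sys c \<zeta> \<le> fst g i) \<and>
     (\<forall>i \<in> I3 sp. \<forall>\<zeta> \<in> ell_set el s.
        (quadA sp i *\<^sub>v (mean_traj M eps sys c \<zeta> - center sp i))
          \<bullet> (mean_traj M eps sys c \<zeta> - center sp i) \<le> fst g i) \<and>
     (\<forall>i \<in> I4 sp.
        loewner_le (m_dim sp i) (covQ sp i * cov_traj Cov sys c * transpose_mat (covQ sp i)) (snd g i))"


section \<open>The convex system\<close>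

definition r_const :: "'i specs \<Rightarrow> 'i \<Rightarrow> real" where
  "r_const sp i = center sp i \<bullet> (quadA sp i *\<^sub>v center sp i)"

definition pq_coeffs :: "plant \<Rightarrow> 'i specs \<Rightarrow> 'i \<Rightarrow> pob_law \<Rightarrow> real vec \<times> real" where
  "pq_coeffs sys sp i c = (THE (p, q). p \<in> carrier_vec (n_zeta sys) \<and>
     (\<forall>\<zeta> \<in> carrier_vec (n_zeta sys).
        (if i \<in> I2 sp then lin_a sp i \<bullet> (Zmat sys c *\<^sub>v aug \<zeta>)
         else - 2 * (center sp i \<bullet> (quadA sp i *\<^sub>v (Zmat sys c *\<^sub>v aug \<zeta>))))
        = 2 * (p \<bullet> \<zeta>) + q))"

definition p_coeff :: "plant \<Rightarrow> 'i specs \<Rightarrow> 'i \<Rightarrow> pob_law \<Rightarrow> real vec" where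
  "p_coeff sys sp i c = fst (pq_coeffs sys sp i c)"

definition q_coeff :: "plant \<Rightarrow> 'i specs \<Rightarrow> 'i \<Rightarrow> pob_law \<Rightarrow> real" where
  "q_coeff sys sp i c = snd (pq_coeffs sys sp i c)"

text \<open>
  The variables of the system. Components at indices where the system has no such variable are
  unconstrained. For \<open>K = 1\<close> the scalar variable \<open>\<lambda>^i\<close> is the only entry of \<open>sol_lam i\<close>, and
  \<open>sol_tau\<close> is not used.
\<close>

record ('k::finite, 'i) sol =
  sol_law :: pob_law
  sol_X :: "'i \<Rightarrow> real mat"
  sol_x :: "'i \<Rightarrow> real vec"
  sol_alpha :: "'i \<Rightarrow> real"
  sol_delta :: "'i \<Rightarrow> real"
  sol_lam :: "'i \<Rightarrow> real ^ 'k"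
  sol_tau :: "'i \<Rightarrow> real"

definition S_quad_constraint ::
  "plant \<Rightarrow> ('k::finite) ellitope \<Rightarrow> 'i specs \<Rightarrow> real \<Rightarrow> ('k, 'i) sol \<Rightarrow> 'i \<Rightarrow> bool" where
  "S_quad_constraint sys el sp s v i \<longleftrightarrow>
     (let c = sol_law v;
          P = ell_P el;
          PXP = transpose_mat P * sol_X v i * P;
          Px = transpose_mat P *\<^sub>v (sol_x v i + p_coeff sys sp i c);
          \<xi> = sol_delta v i - q_coeff sys sp i c;
          l = sol_lam v i
      in (\<forall>k. 0 \<le> l $h k) \<and>
         (if CARD('k) > 1 then
            psd (ell_dim el + 1) (bordered_last (weighted_S el l - PXP) (- Px) (sol_tau v i)) \<and>
            s * supp_T el l + sol_tau v i \<le> \<xi>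
          else
            (\<forall>k. psd (ell_dim el + 1)
                   (bordered_last (l $h k \<cdot>\<^sub>m Qbar el s k - PXP) Px (\<xi> - l $h k)))))"

definition S_feasible ::
  "real mat \<Rightarrow> plant \<Rightarrow> ('k::finite) ellitope \<Rightarrow> 'i specs \<Rightarrow> 'i rhs \<Rightarrow> real \<Rightarrow> ('k, 'i) sol \<Rightarrow> bool"
where
  "S_feasible Cov sys el sp g s v \<longleftrightarrow>
     (let c = sol_law v; Z = Zmat sys c; E = Emat sys c; R = psd_sqrt (n_eps sys) Cov;
          nz = n_zeta sys; ne = n_eps sys; \<gamma> = fst g; Sig = snd g
      in c \<in> pob_laws sys \<and>
         (\<forall>i \<in> I1 sp \<union> I3 sp.
            sol_X v i \<in> sym_mats nz \<and> sol_x v i \<in> carrier_vec nz \<and>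
            loewner_le (nz + 1) (transpose_mat Z * quadA sp i * Z)
              (bordered_last (sol_X v i) (sol_x v i) (sol_alpha v i)) \<and>
            S_quad_constraint sys el sp s v i) \<and>
         (\<forall>i \<in> I1 sp.
            sol_alpha v i + sol_delta v i
            + (frob_norm (psd_sqrt (n_w sys) (quadA sp i) * E * R))\<^sup>2 + r_const sp i \<le> \<gamma> i) \<and>
         (\<forall>i \<in> I3 sp. sol_alpha v i + sol_delta v i + r_const sp i \<le> \<gamma> i) \<and>
         (\<forall>i \<in> I2 sp.
            (\<forall>k. 0 \<le> sol_lam v i $h k) \<and>
            psd (ell_dim el + 1)
              (bordered_first (sol_alpha v i)
                 (- (transpose_mat (ell_P el) *\<^sub>v p_coeff sys sp i c))
                 (weighted_S el (sol_lam v i))) \<and>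
            sol_alpha v i + s * supp_T el (sol_lam v i) + q_coeff sys sp i c \<le> \<gamma> i) \<and>
         (\<forall>i \<in> I4 sp.
            psd (m_dim sp i + ne)
              (four_block_mat (Sig i) (covQ sp i * E * R)
                 (transpose_mat R * transpose_mat E * transpose_mat (covQ sp i)) (1\<^sub>m ne))))"


section \<open>Optimization over laws and right-hand sides\<close>

definition law_comb :: "plant \<Rightarrow> real \<Rightarrow> pob_law \<Rightarrow> pob_law \<Rightarrow> pob_law" where
  "law_comb sys \<theta> c c' =
     (\<lambda>t\<in>{..<horizon sys}. (1 - \<theta>) \<cdot>\<^sub>v fst c t + \<theta> \<cdot>\<^sub>v fst c' t,
      \<lambda>t\<in>{..<horizon sys}. \<lambda>j\<in>{..t}. (1 - \<theta>) \<cdot>\<^sub>m snd c t j + \<theta> \<cdot>\<^sub>m snd c' t j)"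

definition rhs_comb :: "'i specs \<Rightarrow> real \<Rightarrow> 'i rhs \<Rightarrow> 'i rhs \<Rightarrow> 'i rhs" where
  "rhs_comb sp \<theta> g g' =
     (\<lambda>i\<in>I1 sp \<union> I2 sp \<union> I3 sp. (1 - \<theta>) * fst g i + \<theta> * fst g' i,
      \<lambda>i\<in>I4 sp. (1 - \<theta>) \<cdot>\<^sub>m snd g i + \<theta> \<cdot>\<^sub>m snd g' i)"

definition pair_comb ::
  "plant \<Rightarrow> 'i specs \<Rightarrow> real \<Rightarrow> pob_law \<times> 'i rhs \<Rightarrow> pob_law \<times> 'i rhs \<Rightarrow> pob_law \<times> 'i rhs" where
  "pair_comb sys sp \<theta> a b = (law_comb sys \<theta> (fst a) (fst b), rhs_comb sp \<theta> (snd a) (snd b))"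

text \<open>Convex functions take values in \<open>\<real> \<union> {+\<infinity>}\<close>.\<close>

definition convex_objective :: "plant \<Rightarrow> 'i specs \<Rightarrow> (pob_law \<times> 'i rhs \<Rightarrow> ereal) \<Rightarrow> bool" where
  "convex_objective sys sp f \<longleftrightarrow>
     (\<forall>a \<in> pob_laws sys \<times> rhs_space sp. f a \<noteq> - \<infinity>) \<and>
     (\<forall>a \<in> pob_laws sys \<times> rhs_space sp. \<forall>b \<in> pob_laws sys \<times> rhs_space sp.
        \<forall>\<theta> \<in> {0<..<1}. f (pair_comb sys sp \<theta> a b) \<le> ereal (1 - \<theta>) * f a + ereal \<theta> * f b)"

text \<open>A convex constraint is identified with the convex set of points satisfying it.\<close>

definition convex_constraint :: "plant \<Rightarrow> 'i specs \<Rightarrow> (pob_law \<times> 'i rhs) set \<Rightarrow> bool" where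
  "convex_constraint sys sp G \<longleftrightarrow>
     G \<subseteq> pob_laws sys \<times> rhs_space sp \<and>
     (\<forall>a \<in> G. \<forall>b \<in> G. \<forall>\<theta> \<in> {0..1}. pair_comb sys sp \<theta> a b \<in> G)"

definition P_feas ::
  "'w measure \<Rightarrow> ('w \<Rightarrow> real vec) \<Rightarrow> real mat \<Rightarrow> plant \<Rightarrow> ('k::finite) ellitope \<Rightarrow> 'i specs \<Rightarrow>
   (pob_law \<times> 'i rhs) set set \<Rightarrow> real \<Rightarrow> (pob_law \<times> 'i rhs) set" where
  "P_feas M eps Cov sys el sp \<A> s = {(c, g).
     g \<in> rhs_space sp \<and> poi_feasible M eps Cov sys el sp g s c \<and> (\<forall>G \<in> \<A>. (c, g) \<in> G)}"

definition Pplus_feas ::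
  "real mat \<Rightarrow> plant \<Rightarrow> ('k::finite) ellitope \<Rightarrow> 'i specs \<Rightarrow>
   (pob_law \<times> 'i rhs) set set \<Rightarrow> real \<Rightarrow> (('k, 'i) sol \<times> 'i rhs) set" where
  "Pplus_feas Cov sys el sp \<A> s = {(v, g).
     g \<in> rhs_space sp \<and> S_feasible Cov sys el sp g s v \<and> (\<forall>G \<in> \<A>. (sol_law v, g) \<in> G)}"

definition Pplus_obj ::
  "(pob_law \<times> 'i rhs \<Rightarrow> ereal) \<Rightarrow> ('k::finite, 'i) sol \<times> 'i rhs \<Rightarrow> ereal" where
  "Pplus_obj f = (\<lambda>(v, g). f (sol_law v, g))"

definition Opt :: "('a \<Rightarrow> ereal) \<Rightarrow> 'a set \<Rightarrow> ereal" where
  "Opt obj F = (INF a\<in>F. obj a)"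

end

theory Submission
  imports Defs "Jordan_Normal_Form.Spectral_Radius"
begin

text \<open>
  For a fixed law the closed loop is affine: the trajectory is \<open>Z [\<zeta>; 1] + E \<epsilon>\<close>, whatever the
  law, so taking expectations turns every requirement indexed by \<open>I1\<close>, \<open>I2\<close> or \<open>I3\<close> into the
  statement that one quadratic function \<open>\<zeta>\<^sup>T X \<zeta> + 2 b\<^sup>T \<zeta>\<close> is bounded by a constant \<open>\<xi>\<close> on the
  ellitope. (The covariance requirements do not involve \<open>\<zeta>\<close> and are equivalent to their matrix
  inequalities, by a Schur complement.) In terms of \<open>y\<close> with \<open>\<zeta> = P y\<close>, and up to a rescaling for
  \<open>K = 1\<close>, the convex system asks for multipliers \<open>l \<ge> 0\<close> and \<open>\<tau>\<close> such that
  \<open>\<zeta>\<^sup>T X \<zeta> + 2 \<sigma> b\<^sup>T \<zeta> \<le> \<Sum>\<^sub>k l\<^sub>k y\<^sup>T S\<^sub>k y + \<tau> \<sigma>\<^sup>2\<close> for all \<open>(y, \<sigma>)\<close>, and \<open>s \<phi>(l) + \<tau> \<le> \<xi>\<close>. Putting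
  \<open>\<sigma> = 1\<close> and using \<open>y\<^sup>T S\<^sub>k y \<le> s t\<^sub>k\<close> gives the bound, so the system is safe: this is the first
  claim.

  For the converse, separating two convex sets in \<open>\<real>\<^sup>K \<times> \<real> \<times> \<real>\<close> shows
  (\<open>relaxation_duality\<close>) that multipliers exist unless some finite family of pairs
  \<open>(y\<^sub>j, \<tau>\<^sub>j)\<close> with \<open>\<Sum>\<^sub>j \<tau>\<^sub>j\<^sup>2 = 1\<close> satisfies the constraints in total,
  \<open>\<Sum>\<^sub>j y\<^sub>j\<^sup>T S\<^sub>k y\<^sub>j \<le> s t\<^sub>k\<close>, and yet has total value above \<open>\<xi>\<close>. It remains to replace a family by a
  single point of the ellitope that has at least the same value.

  If \<open>K = 1\<close>, two members of the family on opposite sides of the constraint can be rotated into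
  each other until one of them lies exactly on it; repeating this produces one pair that
  satisfies the constraint and still has value above \<open>\<xi>\<close> (\<open>rank_one_extraction\<close>). Nothing is lost,
  so the system is exact.

  If \<open>K > 1\<close> (\<open>ellitope_rounding\<close>), split off the mean \<open>w = \<Sum>\<^sub>j \<tau>\<^sub>j y\<^sub>j\<close> and rotate the remainders
  \<open>y\<^sub>j - \<tau>\<^sub>j w\<close>, by the spectral theorem, into vectors \<open>u\<^sub>j\<close> that are orthogonal for the quadratic
  form of the objective. For every choice of signs, the points \<open>w \<plusminus> \<Sum>\<^sub>j \<epsilon>\<^sub>j u\<^sub>j\<close> have the value of
  the family up to a term that changes its sign with the \<open>\<plusminus>\<close>, so one of the two points is good
  enough. For random signs, a constraint of size \<open>c\<close> has exponential moment
  \<open>\<bbbE> exp (y\<^sup>T S\<^sub>k y / (3 c)) \<le> exp (1/3) sqrt 3 < 3\<close>, so that some choice of signs makes all the \<open>2 K\<close>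
  exponentials add up to less than \<open>6 K\<close>, and then \<open>y\<^sup>T S\<^sub>k y \<le> 3 ln (6 K) c\<close> for both points and
  all \<open>k\<close>. This is where the factor \<open>3 ln (6 K)\<close> comes from. The claims about optimal values
  follow because all of this is for a fixed law and fixed right-hand sides, and because the
  requirements become stronger when the level grows, which covers \<open>K = 1\<close>.
\<close>

section \<open>Quadratic forms\<close>

text \<open>
  Vectors enter the quadratic forms as functions on \<open>nat\<close>, of which only the first \<open>n\<close> values
  matter. Linear combinations of whole families are then ordinary sums of functions, without
  side conditions on dimensions.
\<close>

definition bilin :: "nat \<Rightarrow> real mat \<Rightarrow> (nat \<Rightarrow> real) \<Rightarrow> (nat \<Rightarrow> real) \<Rightarrow> real" where
  "bilin n A f g = (\<Sum>i<n. \<Sum>j<n. A $$ (i, j) * f i * g j)"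

abbreviation qform :: "nat \<Rightarrow> real mat \<Rightarrow> (nat \<Rightarrow> real) \<Rightarrow> real" where
  "qform n A f \<equiv> bilin n A f f"

lemma bilin_add_left: "bilin n A (\<lambda>i. f i + g i) h = bilin n A f h + bilin n A g h"
  by (simp add: bilin_def algebra_simps sum.distrib)

lemma bilin_add_right: "bilin n A h (\<lambda>i. f i + g i) = bilin n A h f + bilin n A h g"
  by (simp add: bilin_def algebra_simps sum.distrib)

lemma bilin_scale_left: "bilin n A (\<lambda>i. c * f i) h = c * bilin n A f h"
  by (simp add: bilin_def sum_distrib_left mult_ac)

lemma bilin_scale_right: "bilin n A h (\<lambda>i. c * f i) = c * bilin n A h f"
  by (simp add: bilin_def sum_distrib_left mult_ac)

lemma bilin_sum_left:
  fixes m :: nat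
  shows "bilin n A (\<lambda>i. \<Sum>j<m. F j i) h = (\<Sum>j<m. bilin n A (F j) h)"
proof (induction m)
  case 0
  then show ?case by (simp add: bilin_def)
next
  case (Suc m)
  then show ?case using bilin_add_left[of n A "\<lambda>i. \<Sum>j<m. F j i" "F m" h] by simp
qed

lemma bilin_sum_right:
  fixes m :: nat
  shows "bilin n A h (\<lambda>i. \<Sum>j<m. F j i) = (\<Sum>j<m. bilin n A h (F j))"
proof (induction m)
  case 0
  then show ?case by (simp add: bilin_def)
next
  case (Suc m)
  then show ?case using bilin_add_right[of n A h "\<lambda>i. \<Sum>j<m. F j i" "F m"] by simp
qed

lemma bilin_commute:
  assumes "A \<in> sym_mats n"
  shows "bilin n A f g = bilin n A g f"
proof -
  have A: "A \<in> carrier_mat n n" "transpose_mat A = A" using assms by (auto simp: sym_mats_def)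
  have s: "A $$ (i, j) = A $$ (j, i)" if "i < n" "j < n" for i j
    using A that by (metis carrier_matD index_transpose_mat(1))
  have "bilin n A f g = (\<Sum>j<n. \<Sum>i<n. A $$ (i, j) * f i * g j)"
    unfolding bilin_def by (rule sum.swap)
  also have "\<dots> = bilin n A g f"
    unfolding bilin_def by (intro sum.cong refl) (auto simp: s mult_ac)
  finally show ?thesis .
qed

lemma bilin_eq_scalar_prod:
  assumes "A \<in> carrier_mat n n" "x \<in> carrier_vec n" "y \<in> carrier_vec n"
  shows "x \<bullet> (A *\<^sub>v y) = bilin n A (($) x) (($) y)"
  using assms
  by (auto simp: bilin_def scalar_prod_def sum_distrib_left atLeast0LessThan mult_ac intro!: sum.cong)

lemma bilin_cong:
  assumes "\<And>i. i < n \<Longrightarrow> f i = f' i" "\<And>i. i < n \<Longrightarrow> g i = g' i"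
  shows "bilin n A f g = bilin n A f' g'"
  unfolding bilin_def by (intro sum.cong refl) (simp add: assms)

lemma psd_iff_bilin: "psd n A \<longleftrightarrow> A \<in> sym_mats n \<and> (\<forall>f. 0 \<le> qform n A f)"
proof (intro iffI conjI allI)
  assume p: "psd n A"
  then show "A \<in> sym_mats n" by (simp add: psd_def)
  then have A: "A \<in> carrier_mat n n" by (simp add: sym_mats_def)
  fix f
  have "0 \<le> vec n f \<bullet> (A *\<^sub>v vec n f)" using p by (simp add: psd_def)
  also have "\<dots> = qform n A (($) (vec n f))"
    by (intro bilin_eq_scalar_prod[OF A]) auto
  also have "\<dots> = qform n A f" by (rule bilin_cong) auto
  finally show "0 \<le> qform n A f" .
next
  assume p: "A \<in> sym_mats n \<and> (\<forall>f. 0 \<le> qform n A f)"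
  then have "A \<in> carrier_mat n n" by (simp add: sym_mats_def)
  then show "psd n A" using p by (simp add: psd_def bilin_eq_scalar_prod)
qed

lemma bilin_square_add:
  assumes "A \<in> sym_mats n"
  shows "qform n A (\<lambda>i. f i + g i)
    = qform n A f + 2 * bilin n A f g + qform n A g"
  by (simp add: bilin_add_left bilin_add_right bilin_commute[OF assms, of g f])

lemma bilin_square_add_scaled:
  assumes "A \<in> sym_mats n"
  shows "qform n A (\<lambda>i. f i + c * g i)
    = qform n A f + 2 * c * bilin n A f g + c\<^sup>2 * qform n A g"
  by (simp add: bilin_square_add[OF assms] bilin_scale_left bilin_scale_right power2_eq_square)

text \<open>
  The polynomial \<open>t \<mapsto> \<langle>f + t g, f + t g\<rangle>\<close> is nonnegative. At its minimum this is the claim; without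
  a quadratic term it can only be constant.
\<close>

lemma bilin_Cauchy_Schwarz:
  assumes "psd n A"
  shows "(bilin n A f g)\<^sup>2 \<le> qform n A f * qform n A g"
proof -
  define a b c where "a = qform n A f" and "b = bilin n A f g" and "c = qform n A g"
  have q: "0 \<le> a + 2 * t * b + t\<^sup>2 * c" for t
    using assms bilin_square_add_scaled[of A n f t g] unfolding psd_iff_bilin a_def b_def c_def
    by metis
  have "0 \<le> c" using assms unfolding psd_iff_bilin c_def by blast
  have "b\<^sup>2 \<le> a * c"
  proof (cases "c = 0")
    case True
    have "b = 0"
    proof (rule ccontr)
      assume "b \<noteq> 0"
      then have "2 * (- (a + 1) / (2 * b)) * b = - (a + 1)" by (simp add: field_simps)
      then show False using q[of "- (a + 1) / (2 * b)"] True by simp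
    qed
    then show ?thesis using True by simp
  next
    case False
    then have "0 < c" using \<open>0 \<le> c\<close> by simp
    have "0 \<le> c * (a + 2 * (- b / c) * b + (- b / c)\<^sup>2 * c)"
      using q[of "- b / c"] \<open>0 < c\<close> by simp
    also have "\<dots> = a * c - b\<^sup>2"
      using \<open>0 < c\<close> by (simp add: field_simps power2_eq_square)
    finally show ?thesis by simp
  qed
  then show ?thesis by (simp add: a_def b_def c_def)
qed

section \<open>Choosing signs for several quadratic forms at once\<close>

lemma cosh_le_exp_half_square: "cosh (x::real) \<le> exp (x\<^sup>2 / 2)"
proof -
  have *: "cosh x \<le> exp (x\<^sup>2 / 2)" if x: "0 \<le> x" for x :: real
  proof -
    have s: "sinh y \<le> y * cosh y" if "0 \<le> y" for y :: real
    proof -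
      have "(\<lambda>t. t * cosh t - sinh t) 0 \<le> (\<lambda>t. t * cosh t - sinh t) y"
      proof (rule DERIV_nonneg_imp_nondecreasing[OF that])
        fix t :: real assume "0 \<le> t" "t \<le> y"
        then show "\<exists>d. ((\<lambda>t. t * cosh t - sinh t) has_real_derivative d) (at t) \<and> 0 \<le> d"
          by (intro exI[of _ "t * sinh t"]) (auto intro!: derivative_eq_intros simp: algebra_simps)
      qed
      then show ?thesis by simp
    qed
    have "(\<lambda>t. cosh t * exp (- (t\<^sup>2 / 2))) x \<le> (\<lambda>t. cosh t * exp (- (t\<^sup>2 / 2))) 0"
    proof (rule DERIV_nonpos_imp_nonincreasing[OF x])
      fix t :: real assume "0 \<le> t" "t \<le> x"
      then show "\<exists>d. ((\<lambda>t. cosh t * exp (- (t\<^sup>2 / 2))) has_real_derivative d) (at t) \<and> d \<le> 0"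
        using s[of t]
        by (intro exI[of _ "(sinh t - t * cosh t) * exp (- (t\<^sup>2 / 2))"])
           (auto intro!: derivative_eq_intros simp: algebra_simps)
    qed
    then show ?thesis by (simp add: exp_minus field_simps)
  qed
  show ?thesis using *[of x] *[of "- x"] by (cases "0 \<le> x") auto
qed

text \<open>
  In dimension one, with \<open>r = \<langle>u, u\<rangle>\<close>, this is the expectation of \<open>exp (a \<langle>x + g u, x + g u\<rangle>)\<close> for
  a standard Gaussian \<open>g\<close>. Like Gaussians it composes: bounding a bound with parameter \<open>r\<close> once more
  with parameter \<open>q\<close>, at the exponent \<open>a / (1 - 2 a r)\<close>, gives the bound with parameter \<open>r + q\<close>.
\<close>

definition moment_bound :: "nat \<Rightarrow> real mat \<Rightarrow> real \<Rightarrow> real \<Rightarrow> (nat \<Rightarrow> real) \<Rightarrow> real" where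
  "moment_bound n A a r x = exp (a * qform n A x / (1 - 2 * a * r)) / sqrt (1 - 2 * a * r)"

text \<open>
  Averaging over the sign of \<open>u\<close> produces a hyperbolic cosine, which is below
  \<open>exp (2 a\<^sup>2 \<langle>x, u\<rangle>\<^sup>2)\<close>; Cauchy--Schwarz then bounds everything by \<open>\<langle>x, x\<rangle>\<close> and \<open>\<langle>u, u\<rangle>\<close>.
\<close>

lemma rademacher_step:
  assumes A: "psd n A" and a: "0 \<le> a" and q: "2 * a * qform n A u < 1"
  shows "(exp (a * qform n A (\<lambda>i. x i + u i))
        + exp (a * qform n A (\<lambda>i. x i - u i))) / 2
    \<le> moment_bound n A a (qform n A u) x"
proof -
  define X b q where "X = qform n A x" and "b = bilin n A x u" and "q = qform n A u"
  have sym: "A \<in> sym_mats n" and X0: "0 \<le> X" and q0: "0 \<le> q"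
    using A by (auto simp: psd_iff_bilin X_def q_def)
  have p: "qform n A (\<lambda>i. x i + u i) = X + 2 * b + q"
    by (simp add: bilin_square_add[OF sym] X_def b_def q_def)
  have m: "qform n A (\<lambda>i. x i - u i) = X - 2 * b + q"
    using bilin_square_add_scaled[OF sym, of x "-1" u] by (simp add: X_def b_def q_def)
  have q1: "0 < 1 - 2 * a * q" using q by (simp add: q_def)
  have CS: "b\<^sup>2 \<le> X * q" using bilin_Cauchy_Schwarz[OF A, of x u] by (simp add: X_def b_def q_def)
  have "(exp (a * (X + 2 * b + q)) + exp (a * (X - 2 * b + q))) / 2 = exp (a * X + a * q) * cosh (2 * a * b)"
    by (simp add: cosh_def algebra_simps exp_add exp_diff exp_minus divide_simps)
  also have "\<dots> \<le> exp (a * X + a * q) * exp ((2 * a * b)\<^sup>2 / 2)"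
    by (intro mult_left_mono cosh_le_exp_half_square) simp
  also have "\<dots> = exp (a * q) * exp (a * X + 2 * a\<^sup>2 * b\<^sup>2)"
    by (simp add: exp_add power2_eq_square)
  also have "\<dots> \<le> (1 / sqrt (1 - 2 * a * q)) * exp (a * X / (1 - 2 * a * q))"
  proof (rule mult_mono)
    have "1 - 2 * a * q \<le> exp (- (2 * a * q))" using exp_ge_add_one_self[of "- (2 * a * q)"] by simp
    then have "sqrt (1 - 2 * a * q) \<le> sqrt (exp (- (2 * a * q)))" by simp
    also have "\<dots> = exp (- (a * q))"
      by (rule real_sqrt_unique) (simp_all add: power2_eq_square flip: exp_add)
    finally have "sqrt (1 - 2 * a * q) * exp (a * q) \<le> exp (- (a * q)) * exp (a * q)"
      by (intro mult_right_mono) auto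
    then show "exp (a * q) \<le> 1 / sqrt (1 - 2 * a * q)"
      using q1 by (simp add: field_simps flip: exp_add)
    have "2 * a\<^sup>2 * b\<^sup>2 \<le> 2 * a\<^sup>2 * (X * q)" using CS by (intro mult_left_mono) auto
    then have "a * X + 2 * a\<^sup>2 * b\<^sup>2 \<le> a * X * (1 + 2 * a * q)"
      by (simp add: algebra_simps power2_eq_square)
    also have "\<dots> \<le> a * X * (1 / (1 - 2 * a * q))"
    proof (rule mult_left_mono)
      have "(1 + 2 * a * q) * (1 - 2 * a * q) = 1 - (2 * a * q)\<^sup>2" by (simp add: algebra_simps power2_eq_square)
      then have "(1 + 2 * a * q) * (1 - 2 * a * q) \<le> 1" by simp
      then show "1 + 2 * a * q \<le> 1 / (1 - 2 * a * q)" using q1 by (simp add: field_simps)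
    qed (use a X0 in simp)
    finally show "exp (a * X + 2 * a\<^sup>2 * b\<^sup>2) \<le> exp (a * X / (1 - 2 * a * q))" by simp
  qed (use q1 in auto)
  finally show ?thesis by (simp add: p m moment_bound_def flip: X_def q_def)
qed

text \<open>
  The method of conditional expectations: the last sign is the one for which the bound of the
  remaining signs does not exceed its average over both values, and by \<open>rademacher_step\<close>
  this average is within the bound for all the vectors. The points \<open>x i\<close> may depend
  on the form, which allows the same form to be used with several points.
\<close>

lemma rademacher_signs:
  fixes u :: "nat \<Rightarrow> nat \<Rightarrow> real"
  assumes A: "\<And>i. i \<in> I \<Longrightarrow> psd n (A i)" and a: "\<And>i. i \<in> I \<Longrightarrow> 0 \<le> a i"
    and "\<And>i. i \<in> I \<Longrightarrow> 2 * a i * (\<Sum>j<m. qform n (A i) (u j)) < 1"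
  shows "\<exists>e. (\<forall>j. e j = 1 \<or> e j = - 1) \<and>
    (\<Sum>i\<in>I. exp (a i * qform n (A i) (\<lambda>k. x i k + (\<Sum>j<m. e j * u j k))))
    \<le> (\<Sum>i\<in>I. moment_bound n (A i) (a i) (\<Sum>j<m. qform n (A i) (u j)) (x i))"
  using assms(3)
proof (induction m arbitrary: x)
  case 0
  show ?case by (intro exI[of _ "\<lambda>_. 1"]) (simp add: moment_bound_def)
next
  case (Suc m)
  define r where "r i = (\<Sum>j<m. qform n (A i) (u j))" for i
  define q where "q i = qform n (A i) (u m)" for i
  have q0: "0 \<le> q i" if "i \<in> I" for i using A[OF that] by (simp add: psd_iff_bilin q_def)
  have rq: "2 * a i * (r i + q i) < 1" if "i \<in> I" for i using Suc.prems[OF that] by (simp add: r_def q_def)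
  have rlt: "2 * a i * r i < 1" if "i \<in> I" for i
    using rq[OF that] mult_nonneg_nonneg[OF a[OF that] q0[OF that]] by (simp add: algebra_simps)
  define b where "b y = (\<Sum>i\<in>I. moment_bound n (A i) (a i) (r i) (y i))" for y
  have IH: "\<exists>e. (\<forall>j. e j = 1 \<or> e j = - 1) \<and>
    (\<Sum>i\<in>I. exp (a i * qform n (A i) (\<lambda>k. y i k + (\<Sum>j<m. e j * u j k)))) \<le> b y" for y
    using Suc.IH[of y] rlt unfolding b_def r_def by blast
  define B where "B = (\<Sum>i\<in>I. moment_bound n (A i) (a i) (r i + q i) (x i))"
  have "(b (\<lambda>i k. x i k + u m k) + b (\<lambda>i k. x i k - u m k)) / 2
     = (\<Sum>i\<in>I. (moment_bound n (A i) (a i) (r i) (\<lambda>k. x i k + u m k)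
        + moment_bound n (A i) (a i) (r i) (\<lambda>k. x i k - u m k)) / 2)"
    unfolding b_def by (simp only: sum_divide_distrib[symmetric] sum.distrib)
  also have "\<dots> \<le> B"
    unfolding B_def
  proof (rule sum_mono)
    fix i assume i: "i \<in> I"
    define p where "p = 1 - 2 * a i * r i"
    have p: "0 < p" using rlt[OF i] by (simp add: p_def)
    \<comment> \<open>The bound for \<open>m\<close> vectors is again one exponential, with parameter \<open>a / p\<close>.\<close>
    have mb: "moment_bound n (A i) (a i) (r i) y = exp (a i / p * qform n (A i) y) / sqrt p" for y
      by (simp add: moment_bound_def p_def)
    have pq: "p * (1 - 2 * (a i / p) * q i) = 1 - 2 * a i * (r i + q i)"
      using p by (simp add: algebra_simps) (simp add: p_def algebra_simps)
    have "0 < p * (1 - 2 * (a i / p) * q i)" using rq[OF i] unfolding pq by simp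
    then have pos: "0 < 1 - 2 * (a i / p) * q i" using p by (simp add: zero_less_mult_iff)
    have "(exp (a i / p * qform n (A i) (\<lambda>k. x i k + u m k))
        + exp (a i / p * qform n (A i) (\<lambda>k. x i k - u m k))) / 2
      \<le> moment_bound n (A i) (a i / p) (q i) (x i)"
      unfolding q_def using p a[OF i] pos by (intro rademacher_step A[OF i]) (auto simp: q_def)
    then have "(exp (a i / p * qform n (A i) (\<lambda>k. x i k + u m k))
        + exp (a i / p * qform n (A i) (\<lambda>k. x i k - u m k))) / 2 / sqrt p
      \<le> moment_bound n (A i) (a i / p) (q i) (x i) / sqrt p"
      using p by (intro divide_right_mono) auto
    also have "\<dots> = moment_bound n (A i) (a i) (r i + q i) (x i)"
      unfolding moment_bound_def pq[symmetric] using p by (simp add: real_sqrt_mult mult_ac)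
    finally show "(moment_bound n (A i) (a i) (r i) (\<lambda>k. x i k + u m k)
        + moment_bound n (A i) (a i) (r i) (\<lambda>k. x i k - u m k)) / 2
      \<le> moment_bound n (A i) (a i) (r i + q i) (x i)"
      unfolding mb by (simp add: add_divide_distrib mult.commute)
  qed
  finally have avg: "(b (\<lambda>i k. x i k + u m k) + b (\<lambda>i k. x i k - u m k)) / 2 \<le> B" .
  obtain s :: real where s: "s = 1 \<or> s = - 1" and sb: "b (\<lambda>i k. x i k + s * u m k) \<le> B"
  proof (cases "b (\<lambda>i k. x i k + u m k) \<le> B")
    case True
    then show ?thesis using that[of 1] by simp
  next
    case False
    then have "b (\<lambda>i k. x i k - u m k) \<le> B" using avg by simp
    then show ?thesis using that[of "- 1"] by simp
  qed
  obtain e where e: "\<forall>j. e j = 1 \<or> e j = - 1"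
    "(\<Sum>i\<in>I. exp (a i * qform n (A i) (\<lambda>k. x i k + s * u m k + (\<Sum>j<m. e j * u j k))))
      \<le> b (\<lambda>i k. x i k + s * u m k)"
    using IH[of "\<lambda>i k. x i k + s * u m k"] by blast
  have eq: "x i k + (\<Sum>j<Suc m. (e(m := s)) j * u j k) = x i k + s * u m k + (\<Sum>j<m. e j * u j k)" for i k
    by simp
  have B: "B = (\<Sum>i\<in>I. moment_bound n (A i) (a i) (\<Sum>j<Suc m. qform n (A i) (u j)) (x i))"
    by (simp add: B_def r_def q_def)
  have "\<forall>j. (e(m := s)) j = 1 \<or> (e(m := s)) j = - 1" using e s by simp
  moreover have "(\<Sum>i\<in>I. exp (a i * qform n (A i) (\<lambda>k. x i k + (\<Sum>j<Suc m. (e(m := s)) j * u j k)))) \<le> B"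
    unfolding eq using e(2) sb by linarith
  ultimately show ?case unfolding B by blast
qed

section \<open>The spectral theorem for real symmetric matrices\<close>

lemma sym_mats_entry:
  assumes "A \<in> sym_mats n" "i < n" "j < n"
  shows "A $$ (i, j) = A $$ (j, i)"
  using assms unfolding sym_mats_def by (metis (mono_tags, lifting) carrier_matD index_transpose_mat(1) mem_Collect_eq)

lemma sym_mats_carrier: "A \<in> sym_mats n \<Longrightarrow> A \<in> carrier_mat n n"
  by (simp add: sym_mats_def)

text \<open>
  A complex eigenvector exists; its eigenvalue is real because \<open>v\<^sup>* A v\<close> is, and then the real and
  the imaginary part of the vector both satisfy the eigenvector equation. One of them is nonzero.
\<close>

lemma sym_mat_real_eigenvector:
  assumes A: "A \<in> sym_mats n" and n: "0 < n"
  obtains u \<mu> where "u \<in> carrier_vec n" "u \<bullet> u = 1" "A *\<^sub>v u = \<mu> \<cdot>\<^sub>v u"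
proof -
  have Ac: "A \<in> carrier_mat n n" using A by (rule sym_mats_carrier)
  define C where "C = map_mat complex_of_real A"
  have C: "C \<in> carrier_mat n n" using Ac by (simp add: C_def)
  obtain z v where v: "v \<in> carrier_vec n" "v \<noteq> 0\<^sub>v n" "C *\<^sub>v v = z \<cdot>\<^sub>v v"
    using spectrum_non_empty[OF C n] C by (auto simp: spectrum_def eigenvalue_def eigenvector_def)
  have ev: "(\<Sum>j<n. A $$ (i, j) * v $ j) = z * v $ i" if i: "i < n" for i
  proof -
    have "(C *\<^sub>v v) $ i = (z \<cdot>\<^sub>v v) $ i" by (simp add: v)
    then show ?thesis using i v(1) C Ac
      by (simp add: scalar_prod_def C_def atLeast0LessThan)
  qed
  define q where "q = (\<Sum>i<n. \<Sum>j<n. A $$ (i, j) * cnj (v $ i) * v $ j)"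
  have "q = (\<Sum>i<n. cnj (v $ i) * (\<Sum>j<n. A $$ (i, j) * v $ j))"
    unfolding q_def by (simp add: sum_distrib_left mult_ac)
  also have "\<dots> = (\<Sum>i<n. z * (v $ i * cnj (v $ i)))" by (intro sum.cong refl) (simp add: ev)
  also have "\<dots> = z * of_real (\<Sum>i<n. (cmod (v $ i))\<^sup>2)"
    unfolding sum_distrib_left[symmetric] complex_norm_square[symmetric] by simp
  finally have q1: "q = z * of_real (\<Sum>i<n. (cmod (v $ i))\<^sup>2)" .
  have "cnj q = (\<Sum>i<n. \<Sum>j<n. A $$ (i, j) * v $ i * cnj (v $ j))" unfolding q_def by simp
  also have "\<dots> = (\<Sum>j<n. \<Sum>i<n. A $$ (i, j) * v $ i * cnj (v $ j))" by (rule sum.swap)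
  also have "\<dots> = q" unfolding q_def
    by (intro sum.cong refl) (simp add: sym_mats_entry[OF A] mult_ac)
  finally have q2: "cnj q = q" .
  obtain i0 where i0: "i0 < n" "v $ i0 \<noteq> 0" using v(1,2) by (metis eq_vecI carrier_vecD index_zero_vec)
  have "0 < (\<Sum>i<n. (cmod (v $ i))\<^sup>2)" using i0 by (intro sum_pos2[of _ i0]) auto
  then have "cnj z = z" using q1 q2 by (metis complex_cnj_complex_of_real complex_cnj_mult less_numeral_extra(3) mult_right_cancel of_real_eq_0_iff)
  then have "Im z = 0" by (simp add: complex_eq_iff)
  have re: "(\<Sum>j<n. A $$ (i, j) * Re (v $ j)) = Re z * Re (v $ i)" if "i < n" for i
    using arg_cong[OF ev[OF that], of Re] \<open>Im z = 0\<close> by simp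
  have im: "(\<Sum>j<n. A $$ (i, j) * Im (v $ j)) = Re z * Im (v $ i)" if "i < n" for i
    using arg_cong[OF ev[OF that], of Im] \<open>Im z = 0\<close> by simp
  obtain f where f: "\<And>i. i < n \<Longrightarrow> (\<Sum>j<n. A $$ (i, j) * f j) = Re z * f i" "f i0 \<noteq> 0"
    using re im i0 by (metis complex_eqI zero_complex.sel)
  define s where "s = (\<Sum>i<n. (f i)\<^sup>2)"
  have s: "0 < s" unfolding s_def using i0 f(2) by (intro sum_pos2[of _ i0]) auto
  define u where "u = vec n (\<lambda>i. f i / sqrt s)"
  have "u \<bullet> u = (\<Sum>i<n. (f i)\<^sup>2 / s)"
    using s unfolding u_def by (simp add: scalar_prod_def atLeast0LessThan power2_eq_square)
  also have "\<dots> = 1" using s by (simp add: s_def flip: sum_divide_distrib)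
  finally have uu: "u \<bullet> u = 1" .
  have "A *\<^sub>v u = Re z \<cdot>\<^sub>v u"
    using Ac f(1) by (intro eq_vecI) (auto simp: u_def scalar_prod_def atLeast0LessThan simp flip: sum_divide_distrib)
  then show ?thesis using that[of u "Re z"] uu by (simp add: u_def)
qed

text \<open>
  Unless \<open>u\<close> is the first unit vector, \<open>H\<close> is the reflection that exchanges the two.
\<close>

lemma householder:
  assumes u: "u \<in> carrier_vec n" "u \<bullet> u = (1::real)" and n: "0 < n"
  obtains H where "H \<in> sym_mats n" "H * H = 1\<^sub>m n" "col H 0 = u"
proof (cases "u = unit_vec n 0")
  case True
  then show ?thesis using n by (intro that[of "1\<^sub>m n"]) (auto simp: sym_mats_def)
next
  case False
  define v where "v i = u $ i - (if i = 0 then 1 else 0)" for i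
  define s where "s = (\<Sum>i<n. (v i)\<^sup>2)"
  have uu: "(\<Sum>i<n. (u $ i)\<^sup>2) = 1"
    using u by (simp add: scalar_prod_def atLeast0LessThan power2_eq_square)
  have "s = (\<Sum>i<n. (u $ i)\<^sup>2 + (if i = 0 then 1 - 2 * u $ 0 else 0))"
    unfolding s_def by (intro sum.cong refl) (auto simp: v_def power2_eq_square algebra_simps)
  then have s: "s = 2 - 2 * u $ 0" using n by (simp add: sum.distrib uu)
  have "s \<noteq> 0"
  proof
    assume "s = 0"
    then have "v i = 0" if "i < n" for i
      using that unfolding s_def by (subst (asm) sum_nonneg_eq_0_iff) auto
    then have "u = unit_vec n 0" using u(1) by (intro eq_vecI) (auto simp: v_def unit_vec_def)
    then show False using False by simp
  qed
  define H where "H = mat n n (\<lambda>(i, j). (if i = j then 1 else 0) - 2 / s * (v i * v j))"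
  have H: "H \<in> sym_mats n" unfolding H_def sym_mats_def by (auto simp: mult_ac)
  have HH: "H * H = 1\<^sub>m n"
  proof (rule eq_matI)
    fix i j assume ij: "i < dim_row (1\<^sub>m n)" "j < dim_col (1\<^sub>m n :: real mat)"
    then have "(H * H) $$ (i, j) = (\<Sum>k<n. ((if i = k then 1 else 0) - 2 / s * (v i * v k)) * ((if k = j then 1 else 0) - 2 / s * (v k * v j)))"
      by (simp add: H_def scalar_prod_def atLeast0LessThan)
    also have "\<dots> = (\<Sum>k<n. (if i = k then (if i = j then 1 else 0) else 0)
        - (if k = j then 2 / s * (v i * v j) else 0) - (if i = k then 2 / s * (v i * v j) else 0) + 4 / s\<^sup>2 * v i * v j * (v k)\<^sup>2)"
      by (intro sum.cong refl) (auto simp: algebra_simps power2_eq_square)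
    also have "\<dots> = (if i = j then 1 else 0) - 4 / s * (v i * v j) + (\<Sum>k<n. 4 / s\<^sup>2 * v i * v j * (v k)\<^sup>2)"
      using ij by (simp add: sum.distrib sum_subtractf)
    also have "(\<Sum>k<n. 4 / s\<^sup>2 * v i * v j * (v k)\<^sup>2) = 4 / s\<^sup>2 * v i * v j * s"
      unfolding s_def sum_distrib_left[symmetric] ..
    also have "(if i = j then 1 else 0) - 4 / s * (v i * v j) + 4 / s\<^sup>2 * v i * v j * s = (1\<^sub>m n) $$ (i, j)" using ij \<open>s \<noteq> 0\<close> by (simp add: field_simps power2_eq_square)
    finally show "(H * H) $$ (i, j) = (1\<^sub>m n) $$ (i, j)" .
  qed (auto simp: H_def)
  have "col H 0 = u"
  proof (rule eq_vecI)
    fix i assume "i < dim_vec u"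
    then have i: "i < n" using u by simp
    have "2 / s * v 0 = - 1" using \<open>s \<noteq> 0\<close> unfolding v_def s by (simp add: field_simps)
    then have "2 / s * v 0 * v i = - 1 * v i" by (rule arg_cong)
    then have "2 / s * (v i * v 0) = - v i" by (simp only: mult_ac)
    then show "col H 0 $ i = u $ i" using i n by (simp add: H_def v_def)
  qed (use u in \<open>simp add: H_def\<close>)
  then show ?thesis using that H HH by blast
qed

text \<open>
  Conjugation with the reflection that maps the first unit vector to an eigenvector splits off a
  block of size one, and the rest is again symmetric.
\<close>

lemma sym_mat_diagonalizable:
  assumes "A \<in> sym_mats n"
  shows "\<exists>U \<in> carrier_mat n n. transpose_mat U * U = 1\<^sub>m n \<and> U * transpose_mat U = 1\<^sub>m n \<and>
    diagonal_mat (transpose_mat U * A * U)"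
  using assms
proof (induction n arbitrary: A)
  case 0
  then show ?case by (intro bexI[of _ "1\<^sub>m 0"]) (auto simp: diagonal_mat_def sym_mats_def)
next
  case (Suc n)
  have Ac: "A \<in> carrier_mat (Suc n) (Suc n)" and At: "transpose_mat A = A" using Suc.prems by (auto simp: sym_mats_def)
  obtain u \<mu> where u: "u \<in> carrier_vec (Suc n)" "u \<bullet> u = 1" "A *\<^sub>v u = \<mu> \<cdot>\<^sub>v u"
    using sym_mat_real_eigenvector[OF Suc.prems] by auto
  obtain H where H: "H \<in> sym_mats (Suc n)" "H * H = 1\<^sub>m (Suc n)" "col H 0 = u"
    using householder[OF u(1,2)] by auto
  have Hc: "H \<in> carrier_mat (Suc n) (Suc n)" and Ht: "transpose_mat H = H" using H(1) by (auto simp: sym_mats_def)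
  define B where "B = H * A * H"
  have Bc: "B \<in> carrier_mat (Suc n) (Suc n)" using Hc Ac by (simp add: B_def)
  have Bt: "transpose_mat B = B"
    using Hc Ac by (simp add: B_def transpose_mult[of _ "Suc n" "Suc n" _ "Suc n"] Ht At)
  have "col B 0 = H *\<^sub>v (A *\<^sub>v u)"
    unfolding B_def using Hc Ac H(3) by (subst assoc_mult_mat[OF Hc Ac Hc]) (simp add: col_mult2[of _ "Suc n" "Suc n" _ "Suc n"])
  also have "\<dots> = \<mu> \<cdot>\<^sub>v (H *\<^sub>v col H 0)" using u Hc H(3) by (simp add: mult_mat_vec)
  also have "H *\<^sub>v col H 0 = col (1\<^sub>m (Suc n)) 0"
    using Hc by (simp add: H(2)[symmetric] col_mult2[of _ "Suc n" "Suc n" _ "Suc n"])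
  finally have col0: "col B 0 = \<mu> \<cdot>\<^sub>v unit_vec (Suc n) 0" by simp
  have B_0: "B $$ (i, 0) = (if i = 0 then \<mu> else 0)" if "i < Suc n" for i
  proof -
    have "B $$ (i, 0) = col B 0 $ i" using that Bc by simp
    then show ?thesis using that by (simp add: col0)
  qed
  have B_sym: "B $$ (i, j) = B $$ (j, i)" if "i < Suc n" "j < Suc n" for i j
    using Bc Bt that by (metis carrier_matD index_transpose_mat(1))
  define A1 where "A1 = mat n n (\<lambda>(i, j). B $$ (Suc i, Suc j))"
  have A1: "A1 \<in> sym_mats n" unfolding A1_def sym_mats_def by (auto intro!: eq_matI B_sym)
  then have A1c: "A1 \<in> carrier_mat n n" by (simp add: sym_mats_def)
  have Bblock: "B = four_block_mat (mat 1 1 (\<lambda>_. \<mu>)) (0\<^sub>m 1 n) (0\<^sub>m n 1) A1"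
  proof (rule eq_matI)
    fix i j assume "i < dim_row (four_block_mat (mat 1 1 (\<lambda>_. \<mu>)) (0\<^sub>m 1 n) (0\<^sub>m n 1) A1)"
      "j < dim_col (four_block_mat (mat 1 1 (\<lambda>_. \<mu>)) (0\<^sub>m 1 n) (0\<^sub>m n 1) A1)"
    then have ij: "i < Suc n" "j < Suc n" using A1c by auto
    show "B $$ (i, j) = four_block_mat (mat 1 1 (\<lambda>_. \<mu>)) (0\<^sub>m 1 n) (0\<^sub>m n 1) A1 $$ (i, j)"
      using ij A1c B_0[of i] B_0[of j] B_sym[of 0 j] by (auto simp: A1_def)
  qed (use A1c Bc in auto)
  obtain V where V: "V \<in> carrier_mat n n" "transpose_mat V * V = 1\<^sub>m n" "V * transpose_mat V = 1\<^sub>m n"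
    "diagonal_mat (transpose_mat V * A1 * V)" using Suc.IH[OF A1] by auto
  define W where "W = four_block_mat (1\<^sub>m 1) (0\<^sub>m 1 n) (0\<^sub>m n 1) V"
  have Wc: "W \<in> carrier_mat (Suc n) (Suc n)" using V by (auto simp: W_def)
  have Wt: "transpose_mat W = four_block_mat (1\<^sub>m 1) (0\<^sub>m 1 n) (0\<^sub>m n 1) (transpose_mat V)"
    unfolding W_def using V by (subst transpose_four_block_mat[of _ 1 1 _ n _ n]) auto
  have one: "four_block_mat (1\<^sub>m 1) (0\<^sub>m 1 n) (0\<^sub>m n 1) (1\<^sub>m n) = (1\<^sub>m (Suc n) :: real mat)"
    using four_block_one_mat[of 1 n] by simp
  have WtW: "transpose_mat W * W = 1\<^sub>m (Suc n)"
    unfolding Wt unfolding W_def using V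
    by (subst mult_four_block_mat[of _ 1 1 _ n _ n _ _ 1 _ n]) (auto simp: one)
  have WWt: "W * transpose_mat W = 1\<^sub>m (Suc n)"
    unfolding Wt unfolding W_def using V
    by (subst mult_four_block_mat[of _ 1 1 _ n _ n _ _ 1 _ n]) (auto simp: one)
  have WBW: "transpose_mat W * B * W = four_block_mat (mat 1 1 (\<lambda>_. \<mu>)) (0\<^sub>m 1 n) (0\<^sub>m n 1) (transpose_mat V * A1 * V)"
    unfolding Wt Bblock unfolding W_def using V A1c
    by (subst mult_four_block_mat[of _ 1 1 _ n _ n _ _ 1 _ n], simp_all)+
  define U where "U = H * W"
  have Uc: "U \<in> carrier_mat (Suc n) (Suc n)" using Hc Wc by (simp add: U_def)
  have Ut: "transpose_mat U = transpose_mat W * H"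
    unfolding U_def using Hc Wc by (simp add: transpose_mult[of _ "Suc n" "Suc n" _ "Suc n"] Ht)
  have Wtc: "transpose_mat W \<in> carrier_mat (Suc n) (Suc n)" using Wc by simp
  note asc = assoc_mult_mat[of _ "Suc n" "Suc n" _ "Suc n" _ "Suc n"]
  have "transpose_mat U * U = transpose_mat W * ((H * H) * W)"
    unfolding Ut unfolding U_def using Hc Wc Wtc by (simp add: asc)
  then have 1: "transpose_mat U * U = 1\<^sub>m (Suc n)" using H(2) Wc WtW by simp
  have "U * transpose_mat U = H * ((W * transpose_mat W) * H)"
    unfolding Ut unfolding U_def using Hc Wc Wtc by (simp add: asc)
  then have 2: "U * transpose_mat U = 1\<^sub>m (Suc n)" using H(2) Hc WWt by simp
  have "transpose_mat U * A * U = transpose_mat W * B * W"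
    unfolding Ut unfolding U_def B_def using Hc Wc Wtc Ac by (simp add: asc)
  then have 3: "diagonal_mat (transpose_mat U * A * U)"
    using V A1c unfolding WBW diagonal_mat_def by (auto simp: four_block_mat_def Let_def)
  show ?case using Uc 1 2 3 by blast
qed

section \<open>Square roots of positive semidefinite matrices\<close>

lemma psd_carrier: "psd n A \<Longrightarrow> A \<in> carrier_mat n n"
  by (simp add: psd_def sym_mats_def)

lemma psd_transpose: "psd n A \<Longrightarrow> transpose_mat A = A"
  by (simp add: psd_def sym_mats_def)

lemma scalar_prod_congruence:
  fixes A :: "real mat"
  assumes A: "A \<in> carrier_mat n n" and U: "U \<in> carrier_mat n m" and x: "x \<in> carrier_vec m"
  shows "x \<bullet> ((transpose_mat U * A * U) *\<^sub>v x) = (U *\<^sub>v x) \<bullet> (A *\<^sub>v (U *\<^sub>v x))"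
proof -
  have Ux: "U *\<^sub>v x \<in> carrier_vec n" and AUx: "A *\<^sub>v (U *\<^sub>v x) \<in> carrier_vec n" using A U x by auto
  have "(transpose_mat U * A * U) *\<^sub>v x = transpose_mat U *\<^sub>v (A *\<^sub>v (U *\<^sub>v x))"
    using A U x by (simp add: assoc_mult_mat_vec[of _ m n _ m] assoc_mult_mat_vec[of _ m n _ n])
  then have "x \<bullet> ((transpose_mat U * A * U) *\<^sub>v x) = x \<bullet> (transpose_mat U *\<^sub>v (A *\<^sub>v (U *\<^sub>v x)))"
    by simp
  also have "\<dots> = (transpose_mat U *\<^sub>v (A *\<^sub>v (U *\<^sub>v x))) \<bullet> x"
    using x U AUx by (intro comm_scalar_prod[of _ m]) auto
  also have "\<dots> = (A *\<^sub>v (U *\<^sub>v x)) \<bullet> (U *\<^sub>v x)"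
    using transpose_vec_mult_scalar[OF U x AUx] .
  also have "\<dots> = (U *\<^sub>v x) \<bullet> (A *\<^sub>v (U *\<^sub>v x))"
    using Ux AUx by (rule comm_scalar_prod[symmetric])
  finally show ?thesis .
qed

lemma sym_mats_congruence:
  assumes "A \<in> sym_mats n" and "U \<in> carrier_mat n m"
  shows "transpose_mat U * A * U \<in> sym_mats m"
proof -
  have A: "A \<in> carrier_mat n n" "transpose_mat A = A" using assms(1) by (auto simp: sym_mats_def)
  have AU: "A * U \<in> carrier_mat n m" using A assms(2) by simp
  have eq: "transpose_mat U * A * U = transpose_mat U * (A * U)"
    using A assms(2) by (simp add: assoc_mult_mat[of _ m n _ n _ m])
  have "transpose_mat (transpose_mat U * (A * U)) = transpose_mat (A * U) * U"
    using AU assms(2) by (simp add: transpose_mult[of _ m n _ m])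
  also have "transpose_mat (A * U) = transpose_mat U * A"
    using A assms(2) by (simp add: transpose_mult[of _ n n _ m])
  finally have "transpose_mat (transpose_mat U * A * U) = transpose_mat U * A * U" by (simp only: eq)
  then show ?thesis using A assms(2) by (simp add: sym_mats_def)
qed

lemma psd_congruence:
  assumes A: "psd n A" and U: "U \<in> carrier_mat n m"
  shows "psd m (transpose_mat U * A * U)"
  unfolding psd_def
proof (intro conjI ballI)
  show "transpose_mat U * A * U \<in> sym_mats m"
    using A U by (intro sym_mats_congruence) (auto simp: psd_def)
  fix x :: "real vec" assume x: "x \<in> carrier_vec m"
  show "0 \<le> x \<bullet> ((transpose_mat U * A * U) *\<^sub>v x)"
    unfolding scalar_prod_congruence[OF psd_carrier[OF A] U x] using A U x by (auto simp: psd_def)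
qed

lemma psd_diagonal_nonneg:
  assumes A: "psd n A" and i: "i < n"
  shows "0 \<le> A $$ (i, i)"
proof -
  have "qform n A (\<lambda>j. if j = i then 1 else 0)
    = (\<Sum>p<n. \<Sum>q<n. if q = i then (if p = i then A $$ (i, i) else 0) else 0)"
    unfolding bilin_def by (intro sum.cong refl) auto
  also have "\<dots> = A $$ (i, i)" using i by simp
  finally show ?thesis using A unfolding psd_iff_bilin by metis
qed

lemma mat_diag_psd:
  assumes "\<And>i. i < n \<Longrightarrow> 0 \<le> d i"
  shows "psd n (mat_diag n d)"
proof -
  have "qform n (mat_diag n d) f = (\<Sum>i<n. d i * (f i)\<^sup>2)" for f
    unfolding bilin_def
  proof (intro sum.cong refl)
    fix i assume "i \<in> {..<n}"
    then have "(\<Sum>j<n. mat_diag n d $$ (i, j) * f i * f j) = (\<Sum>j<n. if j = i then d i * (f i)\<^sup>2 else 0)"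
      by (intro sum.cong refl) (auto simp: mat_diag_def power2_eq_square)
    then show "(\<Sum>j<n. mat_diag n d $$ (i, j) * f i * f j) = d i * (f i)\<^sup>2" using \<open>i \<in> {..<n}\<close> by simp
  qed
  moreover have "mat_diag n d \<in> sym_mats n" by (auto simp: sym_mats_def mat_diag_def)
  ultimately show ?thesis using assms by (auto simp: psd_iff_bilin intro!: sum_nonneg)
qed

lemma diagonal_mat_eq_mat_diag:
  assumes "D \<in> carrier_mat n n" "diagonal_mat D"
  shows "D = mat_diag n (\<lambda>i. D $$ (i, i))"
  using assms by (intro eq_matI) (auto simp: mat_diag_def diagonal_mat_def)

lemma orthogonal_conjugate_cancel:
  fixes U :: "real mat"
  assumes U: "U \<in> carrier_mat n n" "U * transpose_mat U = 1\<^sub>m n" and A: "A \<in> carrier_mat n n"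
  shows "U * (transpose_mat U * A * U) * transpose_mat U = A"
proof -
  note asc = assoc_mult_mat[of _ n n _ n _ n]
  have "U * (transpose_mat U * A * U) * transpose_mat U = (U * transpose_mat U) * (A * (U * transpose_mat U))"
    using U(1) A by (simp add: asc)
  then show ?thesis using U A by simp
qed

lemma psd_square_root_exists:
  assumes A: "psd n A"
  shows "\<exists>B. psd n B \<and> B * B = A"
proof -
  have Ac: "A \<in> carrier_mat n n" using A by (rule psd_carrier)
  obtain U where U: "U \<in> carrier_mat n n" "transpose_mat U * U = 1\<^sub>m n" "U * transpose_mat U = 1\<^sub>m n"
    and diag: "diagonal_mat (transpose_mat U * A * U)"
    using sym_mat_diagonalizable[of A n] A by (auto simp: psd_def)
  define D where "D = transpose_mat U * A * U"
  have D: "psd n D" unfolding D_def by (rule psd_congruence[OF A U(1)])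
  define d where "d i = D $$ (i, i)" for i
  have d0: "0 \<le> d i" if "i < n" for i unfolding d_def using psd_diagonal_nonneg[OF D that] .
  have Dd: "D = mat_diag n d"
    unfolding d_def using diag psd_carrier[OF D] by (intro diagonal_mat_eq_mat_diag) (auto simp: D_def)
  define T where "T = mat_diag n (\<lambda>i. sqrt (d i))"
  have T: "psd n T" unfolding T_def by (intro mat_diag_psd) (simp add: d0)
  have Tc: "T \<in> carrier_mat n n" using T by (rule psd_carrier)
  have TT: "T * T = D" unfolding T_def Dd mat_diag_diag using d0 by (intro eq_matI) (auto simp: mat_diag_def)
  have B: "psd n (U * T * transpose_mat U)"
    using psd_congruence[OF T, of "transpose_mat U" n] U(1) by simp
  have "(U * T * transpose_mat U) * (U * T * transpose_mat U) = U * (T * ((transpose_mat U * U) * (T * transpose_mat U)))"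
    using U(1) Tc by (simp add: assoc_mult_mat[of _ n n _ n _ n])
  also have "\<dots> = U * D * transpose_mat U"
    using U(1,2) Tc by (simp add: assoc_mult_mat[of _ n n _ n _ n] flip: TT)
  also have "\<dots> = A" unfolding D_def by (rule orthogonal_conjugate_cancel[OF U(1,3) Ac])
  finally show ?thesis using B by blast
qed

text \<open>
  In an orthonormal basis that diagonalizes \<open>B - C\<close>, the two matrices differ only on the
  diagonal. The diagonal entries of \<open>B * B = C * C\<close> then say that the diagonal entries of
  \<open>B\<close> and \<open>C\<close> have equal squares, and they are nonnegative.
\<close>

lemma psd_square_root_unique:
  assumes B: "psd n B" and C: "psd n C" and eq: "B * B = C * C"
  shows "B = C"
proof -
  have Bc: "B \<in> carrier_mat n n" and Cc: "C \<in> carrier_mat n n" using B C by (auto intro: psd_carrier)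
  have "B - C \<in> sym_mats n" using B C by (auto simp: psd_def sym_mats_def transpose_minus)
  then obtain U where U: "U \<in> carrier_mat n n" "transpose_mat U * U = 1\<^sub>m n" "U * transpose_mat U = 1\<^sub>m n"
    and diag: "diagonal_mat (transpose_mat U * (B - C) * U)"
    using sym_mat_diagonalizable by blast
  define B' C' where "B' = transpose_mat U * B * U" and "C' = transpose_mat U * C * U"
  have B': "psd n B'" and C': "psd n C'" unfolding B'_def C'_def by (rule psd_congruence[OF B U(1)] psd_congruence[OF C U(1)])+
  have Bc': "B' \<in> carrier_mat n n" and Cc': "C' \<in> carrier_mat n n" using B' C' by (auto intro: psd_carrier)
  have D': "transpose_mat U * (B - C) * U = B' - C'"
    unfolding B'_def C'_def using U(1) Bc Cc
    by (simp add: mult_minus_distrib_mat[of _ n n _ n] minus_mult_distrib_mat[of _ n n _ _ n])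
  have sq: "(transpose_mat U * X * U) * (transpose_mat U * X * U) = transpose_mat U * (X * X) * U"
    if X: "X \<in> carrier_mat n n" for X
  proof -
    have "(transpose_mat U * X * U) * (transpose_mat U * X * U)
      = transpose_mat U * (X * ((U * transpose_mat U) * (X * U)))"
      using U(1) X by (simp add: assoc_mult_mat[of _ n n _ n _ n])
    then show ?thesis using U(1,3) X by (simp add: assoc_mult_mat[of _ n n _ n _ n])
  qed
  have eq': "B' * B' = C' * C'" unfolding B'_def C'_def sq[OF Bc] sq[OF Cc] eq ..
  have off: "B' $$ (i, j) = C' $$ (i, j)" if "i < n" "j < n" "i \<noteq> j" for i j
    using diag that Bc' Cc' unfolding D' diagonal_mat_def by auto
  have "B' $$ (i, i) = C' $$ (i, i)" if i: "i < n" for i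
  proof -
    have "(\<Sum>k<n. B' $$ (i, k) * B' $$ (k, i)) = (\<Sum>k<n. C' $$ (i, k) * C' $$ (k, i))"
      using arg_cong[OF eq', of "\<lambda>M. M $$ (i, i)"] i Bc' Cc' by (simp add: scalar_prod_def atLeast0LessThan)
    moreover have "(\<Sum>k\<in>{..<n} - {i}. B' $$ (i, k) * B' $$ (k, i)) = (\<Sum>k\<in>{..<n} - {i}. C' $$ (i, k) * C' $$ (k, i))"
      using i by (intro sum.cong refl) (auto simp: off)
    ultimately have "B' $$ (i, i) * B' $$ (i, i) = C' $$ (i, i) * C' $$ (i, i)"
      using i by (simp add: sum.remove[of "{..<n}" i])
    then show ?thesis using psd_diagonal_nonneg[OF B' i] psd_diagonal_nonneg[OF C' i]
      by (simp flip: power2_eq_square)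
  qed
  then have "B' $$ (i, j) = C' $$ (i, j)" if "i < n" "j < n" for i j
    using off that by (cases "i = j") auto
  then have "B' = C'" using Bc' Cc' by (intro eq_matI) auto
  have "B = U * B' * transpose_mat U"
    unfolding B'_def by (rule orthogonal_conjugate_cancel[OF U(1,3) Bc, symmetric])
  also have "\<dots> = C"
    unfolding \<open>B' = C'\<close> C'_def by (rule orthogonal_conjugate_cancel[OF U(1,3) Cc])
  finally show ?thesis .
qed

lemma psd_sqrt_correct:
  assumes "psd n A"
  shows "psd n (psd_sqrt n A)" and "psd_sqrt n A * psd_sqrt n A = A"
proof -
  have "\<exists>!B. psd n B \<and> B * B = A"
    using psd_square_root_exists[OF assms] psd_square_root_unique by blast
  then have "psd n (psd_sqrt n A) \<and> psd_sqrt n A * psd_sqrt n A = A"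
    unfolding psd_sqrt_def by (rule theI')
  then show "psd n (psd_sqrt n A)" and "psd_sqrt n A * psd_sqrt n A = A" by auto
qed

section \<open>Rounding a family of vectors to a single vector\<close>

text \<open>
  An orthogonal recombination of the family preserves \<open>\<Sum>\<^sub>i v\<^sub>i v\<^sub>i\<^sup>T\<close>, hence the total value
  of every quadratic form; diagonalizing the Gram matrix of \<open>B\<close> supplies the recombination.
\<close>

lemma diagonalizing_rotation:
  fixes v :: "nat \<Rightarrow> nat \<Rightarrow> real" and m :: nat
  assumes B: "B \<in> sym_mats n"
  obtains v' where "\<And>i l. i < m \<Longrightarrow> l < m \<Longrightarrow> i \<noteq> l \<Longrightarrow> bilin n B (v' i) (v' l) = 0"
    and "\<And>A. (\<Sum>i<m. qform n A (v' i)) = (\<Sum>i<m. qform n A (v i))"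
proof -
  define G where "G = mat m m (\<lambda>(i, j). bilin n B (v i) (v j))"
  have "G \<in> sym_mats m" unfolding G_def sym_mats_def by (auto simp: bilin_commute[OF B])
  then obtain U where U: "U \<in> carrier_mat m m" "U * transpose_mat U = 1\<^sub>m m"
    and diag: "diagonal_mat (transpose_mat U * G * U)"
    using sym_mat_diagonalizable by blast
  define v' where "v' i = (\<lambda>k. \<Sum>j<m. U $$ (j, i) * v j k)" for i
  have expand: "bilin n A (v' i) (v' l) = (\<Sum>j<m. \<Sum>p<m. U $$ (j, i) * U $$ (p, l) * bilin n A (v j) (v p))" for A i l
    unfolding v'_def bilin_sum_left bilin_sum_right bilin_scale_left bilin_scale_right
    by (simp add: sum_distrib_left mult_ac)
  have 1: "bilin n B (v' i) (v' l) = 0" if il: "i < m" "l < m" "i \<noteq> l" for i l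
  proof -
    have "(transpose_mat U * G * U) $$ (i, l) = (\<Sum>p<m. \<Sum>j<m. U $$ (j, i) * G $$ (j, p) * U $$ (p, l))"
      using U(1) il by (simp add: G_def scalar_prod_def atLeast0LessThan sum_distrib_right)
    also have "\<dots> = (\<Sum>j<m. \<Sum>p<m. U $$ (j, i) * G $$ (j, p) * U $$ (p, l))" by (rule sum.swap)
    also have "\<dots> = bilin n B (v' i) (v' l)" unfolding expand by (intro sum.cong refl) (simp add: G_def)
    finally show ?thesis using diag il U(1) by (auto simp: diagonal_mat_def)
  qed
  have 2: "(\<Sum>i<m. qform n A (v' i)) = (\<Sum>i<m. qform n A (v i))" for A
  proof -
    have UU: "(\<Sum>i<m. U $$ (j, i) * U $$ (p, i)) = (if j = p then 1 else 0)" if "j < m" "p < m" for j p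
      using arg_cong[OF U(2), of "\<lambda>M. M $$ (j, p)"] that U(1) by (simp add: scalar_prod_def atLeast0LessThan)
    have "(\<Sum>i<m. qform n A (v' i)) = (\<Sum>i<m. \<Sum>j<m. \<Sum>p<m. U $$ (j, i) * U $$ (p, i) * bilin n A (v j) (v p))"
      unfolding expand ..
    also have "\<dots> = (\<Sum>j<m. \<Sum>i<m. \<Sum>p<m. U $$ (j, i) * U $$ (p, i) * bilin n A (v j) (v p))" by (rule sum.swap)
    also have "\<dots> = (\<Sum>j<m. \<Sum>p<m. \<Sum>i<m. U $$ (j, i) * U $$ (p, i) * bilin n A (v j) (v p))"
      by (intro sum.cong refl sum.swap)
    also have "\<dots> = (\<Sum>j<m. \<Sum>p<m. if p = j then bilin n A (v j) (v p) else 0)"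
      unfolding sum_distrib_right[symmetric] by (intro sum.cong refl) (simp add: UU)
    also have "\<dots> = (\<Sum>i<m. qform n A (v i))" by simp
    finally show ?thesis .
  qed
  show ?thesis using that[of v'] 1 2 by blast
qed

text \<open>
  The left-hand side bounds the exponential moment of one normalized constraint. That it is less
  than 3 is the whole numerical content of the factor \<open>3 ln (6 K)\<close>.
\<close>

lemma exp_third_sqrt3_less: "exp (1 / 3) * sqrt 3 < (3 :: real)"
proof (rule power_less_imp_less_base)
  define e :: real where "e = exp (1 / 3)"
  have "e ^ 3 = exp 1" using exp_of_nat_mult[of 3 "1 / 3 :: real"] by (simp add: e_def)
  then have e3: "e ^ 3 \<le> 3" using exp_le by simp
  have e0: "0 \<le> e" by (simp add: e_def)
  have "(e * sqrt 3) ^ 6 = (e ^ 3)\<^sup>2 * ((sqrt 3)\<^sup>2) ^ 3"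
    by (simp only: power_mult_distrib power_mult[symmetric]) simp
  also have "\<dots> \<le> 3\<^sup>2 * 3 ^ 3" using e3 e0 by (intro mult_mono power_mono) auto
  also have "\<dots> < 3 ^ 6" by simp
  finally show "(exp (1 / 3) * sqrt 3 :: real) ^ 6 < 3 ^ 6" unfolding e_def .
qed simp

text \<open>
  The family satisfies the constraints only in total, with bounds \<open>c k\<close>; one vector \<open>x\<close>
  satisfies them individually, after the bounds are enlarged by the factor \<open>3 ln (6 K)\<close>, without
  losing any of the objective. The exponents \<open>1 / (3 c)\<close> leave \<open>1 - 2 r / (3 c) \<ge> 1/3\<close>, which gives
  the constants \<open>exp (1/3)\<close> and \<open>sqrt 3\<close>. Constraints with \<open>c k = 0\<close> cannot be normalized, but they
  force all the vectors involved into the kernel of \<open>S k\<close>.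
\<close>

lemma ellitope_rounding:
  fixes S :: "'k::finite \<Rightarrow> real mat" and y :: "nat \<Rightarrow> nat \<Rightarrow> real" and b :: "nat \<Rightarrow> real"
  assumes B: "B \<in> sym_mats n" and S: "\<And>k. psd n (S k)"
    and tau: "(\<Sum>j<m. (\<tau> j)\<^sup>2) = 1"
    and c: "\<And>k. (\<Sum>j<m. qform n (S k) (y j)) \<le> c k"
  obtains x where "\<And>k. qform n (S k) x \<le> 3 * ln (6 * real CARD('k)) * c k"
    and "(\<Sum>j<m. qform n B (y j) + 2 * \<tau> j * (\<Sum>i<n. b i * y j i)) \<le> qform n B x + 2 * (\<Sum>i<n. b i * x i)"
proof -
  define w where "w = (\<lambda>i. \<Sum>j<m. \<tau> j * y j i)"
  \<comment> \<open>As \<open>\<tau>\<close> is a unit vector, \<open>\<Sum>\<^sub>j v\<^sub>j v\<^sub>j\<^sup>T = \<Sum>\<^sub>j y\<^sub>j y\<^sub>j\<^sup>T - w w\<^sup>T\<close>.\<close>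
  define v where "v j = (\<lambda>i. y j i + (- \<tau> j) * w i)" for j
  have split: "(\<Sum>j<m. qform n A (y j)) = qform n A w + (\<Sum>j<m. qform n A (v j))"
    if A: "A \<in> sym_mats n" for A
  proof -
    have "(\<Sum>j<m. qform n A (v j))
       = (\<Sum>j<m. qform n A (y j) + 2 * (- \<tau> j) * bilin n A (y j) w + (- \<tau> j)\<^sup>2 * qform n A w)"
      unfolding v_def bilin_square_add_scaled[OF A] ..
    also have "\<dots> = (\<Sum>j<m. qform n A (y j)) - 2 * (\<Sum>j<m. \<tau> j * bilin n A (y j) w) + (\<Sum>j<m. (\<tau> j)\<^sup>2) * qform n A w"
    proof -
      have "(\<Sum>j<m. qform n A (y j) + 2 * (- \<tau> j) * bilin n A (y j) w + (- \<tau> j)\<^sup>2 * qform n A w)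
        = (\<Sum>j<m. qform n A (y j) - 2 * (\<tau> j * bilin n A (y j) w) + (\<tau> j)\<^sup>2 * qform n A w)"
        by (simp add: mult.assoc)
      then show ?thesis by (simp only: sum.distrib sum_subtractf sum_distrib_left[symmetric] sum_distrib_right[symmetric])
    qed
    also have "(\<Sum>j<m. \<tau> j * bilin n A (y j) w) = qform n A w"
      unfolding w_def bilin_sum_left bilin_scale_left ..
    finally show ?thesis using tau by simp
  qed
  obtain u where orth: "\<And>i l. i < m \<Longrightarrow> l < m \<Longrightarrow> i \<noteq> l \<Longrightarrow> bilin n B (u i) (u l) = 0"
    and trace: "\<And>A. (\<Sum>i<m. qform n A (u i)) = (\<Sum>i<m. qform n A (v i))"
    using diagonalizing_rotation[OF B, of m v] by blast
  define a r where "a k = qform n (S k) w" and "r k = (\<Sum>j<m. qform n (S k) (u j))" for k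
  have sym: "S k \<in> sym_mats n" for k using S by (simp add: psd_def)
  have ar: "a k + r k \<le> c k" for k
    using c[of k] split[OF sym, of k] trace[of "S k"] by (simp add: a_def r_def)
  have a0: "0 \<le> a k" for k using S by (simp add: a_def psd_iff_bilin)
  have u0: "0 \<le> qform n (S k) (u j)" for k j using S by (simp add: psd_iff_bilin)
  have r0: "0 \<le> r k" for k unfolding r_def by (intro sum_nonneg u0)
  \<comment> \<open>Each form occurs with the two points \<open>w\<close> and \<open>- w\<close>: the value at \<open>- w + h\<close> is that at \<open>w - h\<close>,
     so that one choice of signs handles both points \<open>w + h\<close> and \<open>w - h\<close>.\<close>
  define I where "I = {k. 0 < c k} \<times> {1, - 1 :: real}"
  have fin: "finite I" by (simp add: I_def)
  have cardI: "card I \<le> 2 * CARD('k)"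
  proof -
    have "card {k. 0 < c k} \<le> CARD('k)" by (rule card_mono) auto
    then show ?thesis by (simp add: I_def card_cartesian_product)
  qed
  define \<alpha> where "\<alpha> i = 1 / (3 * c (fst i))" for i :: "'k \<times> real"
  have "2 * \<alpha> i * (\<Sum>j<m. qform n (S (fst i)) (u j)) < 1" if "i \<in> I" for i
    using that ar[of "fst i"] a0[of "fst i"] unfolding r_def[symmetric] by (auto simp: I_def \<alpha>_def field_simps)
  then have "\<exists>e. (\<forall>j. e j = 1 \<or> e j = - 1) \<and>
    (\<Sum>i\<in>I. exp (\<alpha> i * qform n (S (fst i)) (\<lambda>k. snd i * w k + (\<Sum>j<m. e j * u j k))))
    \<le> (\<Sum>i\<in>I. moment_bound n (S (fst i)) (\<alpha> i) (\<Sum>j<m. qform n (S (fst i)) (u j)) (\<lambda>k. snd i * w k))"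
    by (intro rademacher_signs S) (auto simp: I_def \<alpha>_def)
  then obtain e where e: "\<And>j. e j = 1 \<or> e j = - 1" and pot:
    "(\<Sum>i\<in>I. exp (\<alpha> i * qform n (S (fst i)) (\<lambda>k. snd i * w k + (\<Sum>j<m. e j * u j k))))
    \<le> (\<Sum>i\<in>I. moment_bound n (S (fst i)) (\<alpha> i) (\<Sum>j<m. qform n (S (fst i)) (u j)) (\<lambda>k. snd i * w k))"
    by blast
  define h where "h = (\<lambda>k. \<Sum>j<m. e j * u j k)"
  define F where "F i = exp (\<alpha> i * qform n (S (fst i)) (\<lambda>k. snd i * w k + h k))" for i
  have term_less: "moment_bound n (S (fst i)) (\<alpha> i) (r (fst i)) (\<lambda>k. snd i * w k) < 3" if i: "i \<in> I" for i
  proof -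
    have ck: "0 < c (fst i)" and si: "(snd i)\<^sup>2 = 1" using i by (auto simp: I_def)
    have Q: "qform n (S (fst i)) (\<lambda>k. snd i * w k) = a (fst i)"
      using si by (simp add: bilin_scale_left bilin_scale_right a_def power2_eq_square mult.assoc[symmetric])
    define p where "p = 1 - 2 * \<alpha> i * r (fst i)"
    have p: "1 / 3 \<le> p" using ck ar[of "fst i"] a0[of "fst i"] by (simp add: p_def \<alpha>_def field_simps)
    have "c (fst i) * p = c (fst i) - 2 / 3 * r (fst i)" using ck by (simp add: p_def \<alpha>_def field_simps)
    then have "a (fst i) \<le> c (fst i) * p" using ar[of "fst i"] r0[of "fst i"] by linarith
    then have "\<alpha> i * a (fst i) / p \<le> 1 / 3" using ck p by (simp add: \<alpha>_def field_simps)
    moreover have "1 / sqrt p \<le> sqrt 3"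
    proof -
      have "sqrt (1 / 3) \<le> sqrt p" using p by simp
      then have "1 \<le> sqrt 3 * sqrt p" by (simp add: real_sqrt_divide pos_divide_le_eq mult.commute)
      then show ?thesis using p by (simp add: pos_divide_le_eq)
    qed
    ultimately have "exp (\<alpha> i * a (fst i) / p) * (1 / sqrt p) \<le> exp (1 / 3) * sqrt 3"
      using p by (intro mult_mono) auto
    then show ?thesis using exp_third_sqrt3_less unfolding moment_bound_def Q p_def[symmetric] by simp
  qed
  have total: "sum F I < 6 * real CARD('k)"
  proof (cases "I = {}")
    case False
    have "sum F I \<le> (\<Sum>i\<in>I. moment_bound n (S (fst i)) (\<alpha> i) (r (fst i)) (\<lambda>k. snd i * w k))"
      using pot unfolding r_def h_def F_def .
    also have "\<dots> < (\<Sum>i\<in>I. 3)" by (intro sum_strict_mono fin False term_less)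
    also have "\<dots> \<le> 6 * real CARD('k)" using cardI by simp
    finally show ?thesis .
  qed simp
  have small: "exp (1 / (3 * c k) * qform n (S k) (\<lambda>i. s * w i + h i)) < 6 * real CARD('k)"
    if "0 < c k" "s = 1 \<or> s = - 1" for k s
  proof -
    have "(k, s) \<in> I" using that by (auto simp: I_def)
    then have "F (k, s) \<le> sum F I" by (intro member_le_sum fin) (auto simp: F_def)
    also have "\<dots> < 6 * real CARD('k)" by (rule total)
    finally show ?thesis by (simp add: F_def \<alpha>_def)
  qed
  have lnpos: "0 \<le> ln (6 * real CARD('k))"
  proof -
    have "1 \<le> real CARD('k)" by (simp add: Suc_le_eq)
    then show ?thesis by (intro ln_ge_zero) linarith
  qed
  have feas: "qform n (S k) (\<lambda>i. s * w i + h i) \<le> 3 * ln (6 * real CARD('k)) * c k"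
    if s: "s = 1 \<or> s = - 1" for k s
  proof (cases "0 < c k")
    case True
    have "1 / (3 * c k) * qform n (S k) (\<lambda>i. s * w i + h i) < ln (6 * real CARD('k))"
      using ln_less_cancel_iff[THEN iffD2, OF _ _ small[OF True s]] by simp
    then show ?thesis using True by (simp add: field_simps)
  next
    case False
    then have z: "c k = 0" "a k = 0" "r k = 0" using ar[of k] a0[of k] r0[of k] by auto
    have null: "bilin n (S k) f g = 0" if "qform n (S k) f = 0" for f g
      using bilin_Cauchy_Schwarz[OF S, of k f g] that by simp
    have uz: "qform n (S k) (u j) = 0" if "j < m" for j
    proof -
      have "\<forall>j\<in>{..<m}. qform n (S k) (u j) = 0"
        using z(3) unfolding r_def by (subst (asm) sum_nonneg_eq_0_iff) (auto simp: u0)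
      then show ?thesis using that by simp
    qed
    have "bilin n (S k) h g = 0" for g
      unfolding h_def bilin_sum_left bilin_scale_left by (intro sum.neutral) (simp add: null[OF uz])
    moreover have "bilin n (S k) w g = 0" for g by (rule null[of w]) (use z(2) in \<open>simp add: a_def\<close>)
    ultimately show ?thesis using z(1) by (simp add: bilin_add_left bilin_scale_left)
  qed
  define l where "l f = (\<Sum>i<n. b i * f i)" for f
  have l_add: "l (\<lambda>i. s * f i + g i) = s * l f + l g" for s f g
    by (simp add: l_def algebra_simps sum.distrib sum_distrib_left)
  have l_sum: "l w = (\<Sum>j<m. \<tau> j * l (y j))"
    unfolding l_def w_def by (simp add: sum_distrib_left mult_ac) (rule sum.swap)
  have Bh: "qform n B h = (\<Sum>j<m. qform n B (v j))"
  proof -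
    have "qform n B h = (\<Sum>j<m. \<Sum>p<m. e j * (e p * bilin n B (u j) (u p)))"
      unfolding h_def bilin_sum_left bilin_sum_right bilin_scale_left bilin_scale_right
      by (simp add: sum_distrib_left)
    also have "\<dots> = (\<Sum>j<m. \<Sum>p<m. if p = j then qform n B (u j) else 0)"
    proof (intro sum.cong refl)
      fix j p assume "j \<in> {..<m}" "p \<in> {..<m}"
      then show "e j * (e p * bilin n B (u j) (u p)) = (if p = j then qform n B (u j) else 0)"
        using e[of j] orth[of j p] by auto
    qed
    also have "\<dots> = (\<Sum>j<m. qform n B (u j))" by simp
    finally show ?thesis unfolding trace .
  qed
  have goal_eq: "(\<Sum>j<m. qform n B (y j) + 2 * \<tau> j * (\<Sum>i<n. b i * y j i)) = qform n B w + qform n B h + 2 * l w"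
    unfolding sum.distrib split[OF B] Bh l_sum l_def[symmetric] by (simp add: sum_distrib_left mult_ac)
  \<comment> \<open>Both \<open>w + h\<close> and \<open>w - h\<close> are feasible; the sign is chosen to make the term linear in \<open>h\<close>
     nonnegative. The point is written as \<open>s (s w + h)\<close> since feasibility is known in this form.\<close>
  define s :: real where "s = (if 0 \<le> bilin n B w h + l h then 1 else - 1)"
  define x where "x = (\<lambda>i. s * (s * w i + h i))"
  have s2: "s = 1 \<or> s = - 1" "s * s = 1" by (auto simp: s_def)
  have xq: "qform n A x = qform n A (\<lambda>i. s * w i + h i)" for A
    unfolding x_def bilin_scale_left bilin_scale_right using s2(2) by (simp add: mult.assoc[symmetric])
  have x_eq: "x = (\<lambda>i. w i + s * h i)" using s2(2) by (auto simp: x_def algebra_simps)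
  have Bx: "qform n B x = qform n B w + 2 * s * bilin n B w h + qform n B h"
    unfolding x_eq bilin_square_add_scaled[OF B] using s2(2) by (simp add: power2_eq_square)
  have lx: "l x = l w + s * l h" unfolding x_eq using l_add[of s h w] by (simp add: add.commute)
  have "0 \<le> s * (bilin n B w h + l h)" by (auto simp: s_def)
  then have "0 \<le> s * bilin n B w h + s * l h" by (simp add: distrib_left)
  then have le: "(\<Sum>j<m. qform n B (y j) + 2 * \<tau> j * (\<Sum>i<n. b i * y j i)) \<le> qform n B x + 2 * l x"
    unfolding goal_eq Bx lx by (simp add: algebra_simps)
  show ?thesis
  proof (rule that[of x])
    show "qform n (S k) x \<le> 3 * ln (6 * real CARD('k)) * c k" for k
      using feas[OF s2(1), of k] unfolding xq .
  qed (use le in \<open>simp only: l_def\<close>)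
qed

section \<open>Duality for the averaged problem\<close>

text \<open>
  The homogenization of \<open>y \<mapsto> y\<^sup>T B y + 2 b\<^sup>T y\<close>, whose values are those at \<open>(y, 1)\<close>.
\<close>

definition hom_quad :: "nat \<Rightarrow> real mat \<Rightarrow> (nat \<Rightarrow> real) \<Rightarrow> (nat \<Rightarrow> real) \<times> real \<Rightarrow> real" where
  "hom_quad n B b p = qform n B (fst p) + 2 * snd p * (\<Sum>i<n. b i * fst p i)"

definition pair_scale :: "real \<Rightarrow> (nat \<Rightarrow> real) \<times> real \<Rightarrow> (nat \<Rightarrow> real) \<times> real" where
  "pair_scale c p = (\<lambda>i. c * fst p i, c * snd p)"

lemma bilin_pair_scale: "qform n A (fst (pair_scale c p)) = c\<^sup>2 * qform n A (fst p)"
  by (simp add: pair_scale_def bilin_scale_left bilin_scale_right power2_eq_square)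

lemma snd_pair_scale: "(snd (pair_scale c p))\<^sup>2 = c\<^sup>2 * (snd p)\<^sup>2"
  by (simp add: pair_scale_def power_mult_distrib)

lemma hom_quad_pair_scale: "hom_quad n B b (pair_scale c p) = c\<^sup>2 * hom_quad n B b p"
proof -
  have "(\<Sum>i<n. b i * (c * fst p i)) = c * (\<Sum>i<n. b i * fst p i)"
    by (simp add: sum_distrib_left mult_ac)
  then show ?thesis
    by (simp add: hom_quad_def pair_scale_def bilin_scale_left bilin_scale_right power2_eq_square algebra_simps)
qed

text \<open>
  The assumption \<open>weak\<close> says that \<open>\<xi>\<close> bounds the semidefinite relaxation, a finite family
  of pairs standing for the positive semidefinite matrix \<open>\<Sum>\<^sub>p p p\<^sup>T\<close>. The vectors of constraint
  and objective values that families can reach form a convex cone (concatenation adds families,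
  and scaling all members by \<open>sqrt r\<close> scales the values by \<open>r\<close>), disjoint from the set of values
  that would violate \<open>\<xi>\<close>; a separating hyperplane consists of the multipliers. Since the
  separation takes place in a finite-dimensional space, no closedness is needed and the
  multipliers are attained. The point \<open>t0\<close> keeps the hyperplane from being vertical.
\<close>

lemma relaxation_duality:
  fixes S :: "'k::finite \<Rightarrow> real mat" and T :: "(real ^ 'k) set"
  assumes T: "convex T" and t0: "t0 \<in> T" "\<And>k. 0 < t0 $h k" and s: "0 < s"
    and weak: "\<And>ps t. t \<in> T \<Longrightarrow> (\<And>k. (\<Sum>p\<leftarrow>ps. qform n (S k) (fst p)) \<le> s * t $h k) \<Longrightarrow>
      (\<Sum>p\<leftarrow>ps. (snd p)\<^sup>2) = 1 \<Longrightarrow> (\<Sum>p\<leftarrow>ps. hom_quad n B b p) \<le> \<xi>"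
  obtains l :: "real ^ 'k" and \<tau> where "\<And>k. 0 \<le> l $h k"
    and "\<And>t. t \<in> T \<Longrightarrow> s * inner l t + \<tau> \<le> \<xi>"
    and "\<And>p. hom_quad n B b p \<le> (\<Sum>k\<in>UNIV. l $h k * qform n (S k) (fst p)) + \<tau> * (snd p)\<^sup>2"
proof -
  define C :: "((real ^ 'k) \<times> real \<times> real) set" where
    "C = {(a, d, c). \<exists>ps. (\<forall>k. (\<Sum>p\<leftarrow>ps. qform n (S k) (fst p)) \<le> a $h k) \<and>
      (\<Sum>p\<leftarrow>ps. (snd p)\<^sup>2) = d \<and> c \<le> (\<Sum>p\<leftarrow>ps. hom_quad n B b p)}"
  define D :: "((real ^ 'k) \<times> real \<times> real) set" where
    "D = {(a, d, c). \<exists>t\<in>T. a = s *\<^sub>R t \<and> d = 1 \<and> \<xi> < c}"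
  have C_add: "x + y \<in> C" if "x \<in> C" "y \<in> C" for x y
  proof -
    obtain a d c ps where x: "x = (a, d, c)" and ps: "\<forall>k. (\<Sum>p\<leftarrow>ps. qform n (S k) (fst p)) \<le> a $h k"
      "(\<Sum>p\<leftarrow>ps. (snd p)\<^sup>2) = d" "c \<le> (\<Sum>p\<leftarrow>ps. hom_quad n B b p)"
      using \<open>x \<in> C\<close> unfolding C_def by blast
    obtain a' d' c' ps' where y: "y = (a', d', c')" and ps': "\<forall>k. (\<Sum>p\<leftarrow>ps'. qform n (S k) (fst p)) \<le> a' $h k"
      "(\<Sum>p\<leftarrow>ps'. (snd p)\<^sup>2) = d'" "c' \<le> (\<Sum>p\<leftarrow>ps'. hom_quad n B b p)"
      using \<open>y \<in> C\<close> unfolding C_def by blast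
    have "\<forall>k. (\<Sum>p\<leftarrow>ps @ ps'. qform n (S k) (fst p)) \<le> (a + a') $h k"
      using ps(1) ps'(1) by (simp add: add_mono)
    moreover have "(\<Sum>p\<leftarrow>ps @ ps'. (snd p)\<^sup>2) = d + d'" using ps(2) ps'(2) by simp
    moreover have "c + c' \<le> (\<Sum>p\<leftarrow>ps @ ps'. hom_quad n B b p)" using ps(3) ps'(3) by simp
    ultimately show ?thesis unfolding x y C_def by (simp only: add_Pair mem_Collect_eq prod.case) blast
  qed
  have C_scale: "r *\<^sub>R x \<in> C" if "x \<in> C" "0 \<le> r" for x r
  proof -
    obtain a d c ps where x: "x = (a, d, c)" and ps: "\<forall>k. (\<Sum>p\<leftarrow>ps. qform n (S k) (fst p)) \<le> a $h k"
      "(\<Sum>p\<leftarrow>ps. (snd p)\<^sup>2) = d" "c \<le> (\<Sum>p\<leftarrow>ps. hom_quad n B b p)"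
      using \<open>x \<in> C\<close> unfolding C_def by blast
    define qs where "qs = map (pair_scale (sqrt r)) ps"
    have sq: "(sqrt r)\<^sup>2 = r" using that by simp
    have qs_sum: "(\<Sum>p\<leftarrow>qs. f p) = r * (\<Sum>p\<leftarrow>ps. f p)" if "\<And>c p. f (pair_scale c p) = c\<^sup>2 * f p" for f
      unfolding qs_def by (simp add: o_def that sq sum_list_const_mult)
    have "\<forall>k. (\<Sum>p\<leftarrow>qs. qform n (S k) (fst p)) \<le> (r *\<^sub>R a) $h k"
      using ps(1) \<open>0 \<le> r\<close> by (simp add: qs_sum bilin_pair_scale mult_left_mono)
    moreover have "(\<Sum>p\<leftarrow>qs. (snd p)\<^sup>2) = r * d" using ps(2) by (simp add: qs_sum snd_pair_scale)
    moreover have "r * c \<le> (\<Sum>p\<leftarrow>qs. hom_quad n B b p)"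
      using ps(3) \<open>0 \<le> r\<close> by (simp add: qs_sum hom_quad_pair_scale mult_left_mono)
    ultimately show ?thesis unfolding x C_def scaleR_Pair real_scaleR_def
      by (simp only: mem_Collect_eq prod.case) blast
  qed
  have C_pair: "(vec_lambda (\<lambda>k. qform n (S k) (fst p)), (snd p)\<^sup>2, hom_quad n B b p) \<in> C" for p
    unfolding C_def by (simp add: exI[of _ "[p]"])
  have C_pos: "(a, 0, c) \<in> C" if "\<And>k. 0 \<le> a $h k" "c \<le> 0" for a c
    unfolding C_def using that by (simp add: exI[of _ "[]"])
  have "convex C" by (intro convexI C_add C_scale)
  moreover have "convex D"
  proof (rule convexI)
    fix x y :: "(real ^ 'k) \<times> real \<times> real" and u v :: real
    assume x: "x \<in> D" and y: "y \<in> D" and uv: "0 \<le> u" "0 \<le> v" "u + v = 1"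
    obtain t c where x: "x = (s *\<^sub>R t, 1, c)" "t \<in> T" "\<xi> < c" using x unfolding D_def by blast
    obtain t' c' where y: "y = (s *\<^sub>R t', 1, c')" "t' \<in> T" "\<xi> < c'" using y unfolding D_def by blast
    have "u *\<^sub>R t + v *\<^sub>R t' \<in> T" using T x y uv by (simp add: convex_def)
    moreover have "\<xi> < u * c + v * c'"
    proof (cases "u = 0")
      case False
      then have "u * \<xi> + v * \<xi> < u * c + v * c'"
        using x(3) y(3) uv by (intro add_less_le_mono mult_strict_left_mono mult_left_mono) auto
      then show ?thesis using uv(3) by (simp flip: distrib_right)
    qed (use uv y in auto)
    ultimately show "u *\<^sub>R x + v *\<^sub>R y \<in> D"
      unfolding D_def x(1) y(1) using uv(3)
      by (auto simp: scaleR_add_right mult.commute intro!: bexI[of _ "u *\<^sub>R t + v *\<^sub>R t'"])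
  qed
  moreover have "C \<noteq> {}" using C_pair by blast
  moreover have "D \<noteq> {}" using t0(1) unfolding D_def by (auto intro!: bexI[of _ t0] exI[of _ "\<xi> + 1"])
  moreover have "C \<inter> D = {}"
  proof (rule ccontr)
    assume "C \<inter> D \<noteq> {}"
    then obtain t c ps where "t \<in> T" "\<xi> < c" "\<forall>k. (\<Sum>p\<leftarrow>ps. qform n (S k) (fst p)) \<le> (s *\<^sub>R t) $h k"
      "(\<Sum>p\<leftarrow>ps. (snd p)\<^sup>2) = 1" "c \<le> (\<Sum>p\<leftarrow>ps. hom_quad n B b p)"
      unfolding C_def D_def by blast
    then show False using weak[of t ps] by simp
  qed
  ultimately obtain h \<beta> where h: "h \<noteq> 0" and hD: "\<forall>x\<in>D. inner h x \<le> \<beta>" and hC: "\<forall>x\<in>C. \<beta> \<le> inner h x"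
    using separating_hyperplane_sets[of D C] by (metis inf_commute)
  have "0 \<in> C" using C_pos[of 0 0] by (simp add: zero_prod_def)
  then have beta: "\<beta> \<le> 0" using hC by fastforce
  have C0: "0 \<le> inner h x" if x: "x \<in> C" for x
  proof (rule ccontr)
    assume neg: "\<not> 0 \<le> inner h x"
    define r where "r = (\<beta> - 1) / inner h x"
    have "0 \<le> r" unfolding r_def using beta neg by (intro divide_nonpos_neg) auto
    then have "\<beta> \<le> inner h (r *\<^sub>R x)" using hC C_scale[OF x] by blast
    also have "\<dots> = \<beta> - 1" using neg by (simp add: r_def)
    finally show False by simp
  qed
  obtain l' \<tau>' m' where h_eq: "h = (l', \<tau>', m')" by (metis prod.collapse)
  define \<mu> where "\<mu> = - m'"
  have C1: "0 \<le> inner l' a + \<tau>' * d - \<mu> * c" if "(a, d, c) \<in> C" for a d c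
    using C0[OF that] by (simp add: h_eq inner_prod_def \<mu>_def)
  have D1: "s * inner l' t + \<tau>' - \<mu> * v \<le> 0" if "t \<in> T" "\<xi> < v" for t v
  proof -
    have "(s *\<^sub>R t, 1, v) \<in> D" using that unfolding D_def by blast
    then have "inner h (s *\<^sub>R t, 1, v) \<le> 0" using hD beta by fastforce
    then show ?thesis by (simp add: h_eq inner_prod_def \<mu>_def)
  qed
  have l0: "0 \<le> l' $h k" for k
  proof -
    have "0 \<le> (axis k 1 :: real ^ 'k) $h j" for j by (simp add: axis_def)
    then have "0 \<le> inner l' (axis k 1)" using C1[OF C_pos[of "axis k 1" 0]] by simp
    then show ?thesis by (simp add: inner_axis)
  qed
  have mu0: "0 \<le> \<mu>" using C1[OF C_pos[of 0 "- 1"]] by simp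
  have tau0: "0 \<le> \<tau>'" 
  proof -
    have z: "bilin n A (\<lambda>_. 0) g = 0" for A g by (simp add: bilin_def)
    have "hom_quad n B b (\<lambda>_. 0, 1) = 0" by (simp add: hom_quad_def z)
    moreover have "vec_lambda (\<lambda>k. qform n (S k) (\<lambda>_. 0)) = (0 :: real ^ 'k)" by (simp add: z Finite_Cartesian_Product.vec_eq_iff)
    ultimately show ?thesis using C1[OF C_pair[of "(\<lambda>_. 0, 1)"]] by simp
  qed
  \<comment> \<open>With \<open>\<mu> = 0\<close>, the separation at \<open>t0\<close> forces all the other coefficients, which are
     nonnegative, to vanish as well.\<close>
  have "\<mu> \<noteq> 0"
  proof
    assume m: "\<mu> = 0"
    have "s * inner l' t0 + \<tau>' \<le> 0" using D1[OF t0(1), of "\<xi> + 1"] m by simp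
    moreover have "0 \<le> inner l' t0"
      unfolding inner_vec_def using l0 t0(2) by (intro sum_nonneg) (simp add: less_imp_le)
    ultimately have "inner l' t0 = 0" "\<tau>' = 0" 
      using s tau0 by (smt (verit) mult_pos_pos mult_nonneg_nonneg)+
    then have "\<forall>k\<in>UNIV. l' $h k * t0 $h k = 0"
      unfolding inner_vec_def using l0 t0(2) by (subst (asm) sum_nonneg_eq_0_iff) (auto simp: less_imp_le)
    then have "l' $h k = 0" for k using t0(2) by (metis UNIV_I less_irrefl mult_eq_0_iff)
    then have "l' = 0" by (simp add: Finite_Cartesian_Product.vec_eq_iff)
    then show False using h m \<open>\<tau>' = 0\<close> by (simp add: h_eq \<mu>_def zero_prod_def)
  qed
  then have mu: "0 < \<mu>" using mu0 by simp
  show ?thesis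
  proof (rule that[of "(1 / \<mu>) *\<^sub>R l'" "\<tau>' / \<mu>"])
    show "0 \<le> ((1 / \<mu>) *\<^sub>R l') $h k" for k using mu l0 by simp
  next
    fix t assume t: "t \<in> T"
    have "(s * inner l' t + \<tau>') / \<mu> \<le> \<xi>"
    proof (rule dense_ge)
      fix v assume "\<xi> < v"
      then show "(s * inner l' t + \<tau>') / \<mu> \<le> v"
        using D1[OF t, of v] mu by (simp add: pos_divide_le_eq mult.commute)
    qed
    then show "s * inner ((1 / \<mu>) *\<^sub>R l') t + \<tau>' / \<mu> \<le> \<xi>" by (simp add: add_divide_distrib)
  next
    fix p :: "(nat \<Rightarrow> real) \<times> real"
    define q where "q = (\<Sum>k\<in>UNIV. l' $h k * qform n (S k) (fst p))"
    have "0 \<le> q + \<tau>' * (snd p)\<^sup>2 - \<mu> * hom_quad n B b p"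
      using C1[OF C_pair[of p]] by (simp add: inner_vec_def q_def)
    then have "hom_quad n B b p \<le> (q + \<tau>' * (snd p)\<^sup>2) / \<mu>" using mu by (simp add: pos_le_divide_eq mult.commute)
    also have "\<dots> = q / \<mu> + \<tau>' / \<mu> * (snd p)\<^sup>2" by (simp add: add_divide_distrib)
    also have "q / \<mu> = (\<Sum>k\<in>UNIV. ((1 / \<mu>) *\<^sub>R l') $h k * qform n (S k) (fst p))"
      unfolding q_def sum_divide_distrib by (intro sum.cong refl) simp
    finally show "hom_quad n B b p
      \<le> (\<Sum>k\<in>UNIV. ((1 / \<mu>) *\<^sub>R l') $h k * qform n (S k) (fst p)) + \<tau>' / \<mu> * (snd p)\<^sup>2" .
  qed
qed

text \<open>
  The elements are only assumed to admit combinations along which \<open>G\<close> and \<open>H\<close> behave like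
  quadratic forms. If \<open>G u > 0 > G v\<close>, some rotation of the pair \<open>(u, v)\<close> makes \<open>G\<close> vanish at the
  first member while \<open>G u + G v\<close> and \<open>H u + H v\<close> do not change. Either this
  member already has \<open>H > 0\<close>, or it can be dropped, which shortens the list.
\<close>

lemma rank_one_extraction:
  fixes G H :: "'v \<Rightarrow> real" and comb :: "real \<Rightarrow> real \<Rightarrow> 'v \<Rightarrow> 'v \<Rightarrow> 'v"
  assumes G: "\<And>u v. \<exists>g. \<forall>a b. G (comb a b u v) = a\<^sup>2 * G u + 2 * a * b * g + b\<^sup>2 * G v"
    and H: "\<And>u v. \<exists>g. \<forall>a b. H (comb a b u v) = a\<^sup>2 * H u + 2 * a * b * g + b\<^sup>2 * H v"
    and "(\<Sum>p\<leftarrow>ps. G p) \<le> 0" and "0 < (\<Sum>p\<leftarrow>ps. H p)"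
  shows "\<exists>w. G w \<le> 0 \<and> 0 < H w"
  using assms(3,4)
proof (induction "length ps" arbitrary: ps rule: less_induct)
  case less
  show ?case
  proof (cases "\<forall>p\<in>set ps. G p \<le> 0")
    case True
    have "\<exists>p\<in>set ps. 0 < H p"
    proof (rule ccontr)
      assume "\<not> (\<exists>p\<in>set ps. 0 < H p)"
      then have "(\<Sum>p\<leftarrow>ps. H p) \<le> 0" by (intro sum_list_nonpos) (auto simp: not_less)
      then show False using less.prems by simp
    qed
    then show ?thesis using True by blast
  next
    case False
    then obtain u where u: "u \<in> set ps" "0 < G u" by (auto simp: not_le)
    have uG: "(\<Sum>p\<leftarrow>ps. f p) = f u + (\<Sum>p\<leftarrow>remove1 u ps. f p)" for f :: "'v \<Rightarrow> real"
      by (rule sum_list_map_remove1[OF u(1)])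
    have "\<exists>v\<in>set (remove1 u ps). G v < 0"
    proof (rule ccontr)
      assume "\<not> (\<exists>v\<in>set (remove1 u ps). G v < 0)"
      then have "0 \<le> (\<Sum>p\<leftarrow>remove1 u ps. G p)" by (intro sum_list_nonneg) (auto simp: not_less)
      then show False using less.prems(1) u(2) uG[of G] by simp
    qed
    then obtain v where v: "v \<in> set (remove1 u ps)" "G v < 0" by blast
    define qs where "qs = remove1 v (remove1 u ps)"
    have split: "(\<Sum>p\<leftarrow>ps. f p) = f u + f v + (\<Sum>p\<leftarrow>qs. f p)" for f :: "'v \<Rightarrow> real"
      using uG[of f] sum_list_map_remove1[OF v(1), of f] by (simp add: qs_def)
    have len: "length (r # qs) < length ps" for r
    proof -
      have "length (remove1 u ps) = length ps - 1" "length qs = length (remove1 u ps) - 1" "0 < length (remove1 u ps)"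
        unfolding qs_def using u(1) v(1) by (auto simp: length_remove1 length_greater_0_conv[symmetric] simp del: length_greater_0_conv dest: length_pos_if_in_set)
      then show ?thesis by simp
    qed
    obtain g where g: "\<And>a b. G (comb a b u v) = a\<^sup>2 * G u + 2 * a * b * g + b\<^sup>2 * G v" using G by blast
    obtain h where h: "\<And>a b. H (comb a b u v) = a\<^sup>2 * H u + 2 * a * b * h + b\<^sup>2 * H v" using H by blast
    define \<phi> where "\<phi> = (\<lambda>t. (cos t)\<^sup>2 * G u + 2 * cos t * sin t * g + (sin t)\<^sup>2 * G v)"
    \<comment> \<open>The rotation goes from \<open>u\<close>, where \<open>G\<close> is positive, to \<open>v\<close>, where it is negative.\<close>
    have "\<exists>t\<ge>0. t \<le> pi / 2 \<and> \<phi> t = 0"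
      by (rule IVT2') (use u v in \<open>auto simp: \<phi>_def intro!: continuous_intros\<close>)
    then obtain t where t: "\<phi> t = 0" by blast
    define w w' where "w = comb (cos t) (sin t) u v" and "w' = comb (- sin t) (cos t) u v"
    have cs: "(cos t)\<^sup>2 + (sin t)\<^sup>2 = 1" by simp
    have Gw: "G w = 0" using t by (simp add: w_def g \<phi>_def)
    have "G w + G w' = ((cos t)\<^sup>2 + (sin t)\<^sup>2) * (G u + G v)"
      unfolding w_def w'_def g by (simp only: power2_minus algebra_simps)
    then have Gs: "G w + G w' = G u + G v" unfolding cs by simp
    have "H w + H w' = ((cos t)\<^sup>2 + (sin t)\<^sup>2) * (H u + H v)"
      unfolding w_def w'_def h by (simp only: power2_minus algebra_simps)
    then have Hs: "H w + H w' = H u + H v" unfolding cs by simp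
    show ?thesis
    proof (cases "0 < H w")
      case True
      then show ?thesis using Gw by (intro exI[of _ w]) simp
    next
      case False
      then have "(\<Sum>p\<leftarrow>w' # qs. G p) \<le> 0" "0 < (\<Sum>p\<leftarrow>w' # qs. H p)"
        using Gs Hs Gw less.prems split[of G] split[of H] by simp_all
      then show ?thesis by (rule less.hyps[OF len])
    qed
  qed
qed

section \<open>Certificates for quadratic inequalities on an ellitope\<close>

lemma bilin_weighted_S:
  "bilin (ell_dim el) (weighted_S el l) f g = (\<Sum>k\<in>UNIV. l $h k * bilin (ell_dim el) (ell_S el k) f g)"
proof -
  have "bilin (ell_dim el) (weighted_S el l) f g
    = (\<Sum>i<ell_dim el. \<Sum>j<ell_dim el. \<Sum>k\<in>UNIV. l $h k * (ell_S el k $$ (i, j) * f i * g j))"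
    unfolding bilin_def by (intro sum.cong refl) (simp add: weighted_S_def sum_distrib_right sum_distrib_left mult_ac)
  also have "\<dots> = (\<Sum>i<ell_dim el. \<Sum>k\<in>UNIV. \<Sum>j<ell_dim el. l $h k * (ell_S el k $$ (i, j) * f i * g j))"
    by (intro sum.cong refl sum.swap)
  also have "\<dots> = (\<Sum>k\<in>UNIV. \<Sum>i<ell_dim el. \<Sum>j<ell_dim el. l $h k * (ell_S el k $$ (i, j) * f i * g j))"
    by (rule sum.swap)
  finally show ?thesis by (simp add: bilin_def sum_distrib_left)
qed

lemma posdef_bilin_zero:
  assumes A: "posdef n A" and z: "qform n A f \<le> 0" and i: "i < n"
  shows "f i = 0"
proof -
  have Ac: "A \<in> carrier_mat n n" using A by (simp add: posdef_def sym_mats_def)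
  have "vec n f \<bullet> (A *\<^sub>v vec n f) = qform n A f"
    unfolding bilin_eq_scalar_prod[OF Ac vec_carrier vec_carrier] by (rule bilin_cong) auto
  then have "vec n f = 0\<^sub>v n" using A z by (auto simp: posdef_def)
  then show ?thesis using i by (metis index_vec index_zero_vec(1))
qed

lemma UNIV_eq_singleton:
  assumes "CARD('k::finite) = 1"
  shows "UNIV = {k :: 'k}"
  using assms by (metis UNIV_I card_1_singletonE singletonD)

lemma ellitope_positive_point:
  assumes "ellitope_wf nz (el :: ('k::finite) ellitope)"
  obtains t where "t \<in> ell_T el" "\<And>k. 0 < t $h k"
proof -
  have "ell_T el \<inter> interior {t. \<forall>k. 0 \<le> t $h k} \<noteq> {}" using assms by (simp add: ellitope_wf_def)
  then obtain t where t: "t \<in> ell_T el" "t \<in> interior {t. \<forall>k. 0 \<le> t $h k}" by blast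
  then obtain e where e: "0 < e" "ball t e \<subseteq> {t. \<forall>k. 0 \<le> t $h k}" unfolding mem_interior by blast
  have "0 < t $h k" for k
  proof -
    have "t - axis k (e / 2) \<in> ball t e" using e(1) by (simp add: dist_norm norm_eq_sqrt_inner inner_axis_axis real_sqrt_divide)
    then have "0 \<le> (t - axis k (e / 2)) $h k" using e(2) by blast
    then show ?thesis using e(1) by simp
  qed
  then show ?thesis using that t(1) by blast
qed

text \<open>
  One constraint, no loss. The extraction is applied to the constraint and to the objective after
  both have been homogenized with \<open>\<Sum>\<^sub>p (snd p)\<^sup>2 = 1\<close>. A resulting pair with last component 0
  would be zero by positive definiteness; every other pair can be normalized.
\<close>

lemma rank_one_weak_duality:
  fixes S :: "real mat"
  assumes S: "S \<in> sym_mats n" and B: "B \<in> sym_mats n" and posS: "posdef n S"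
    and point: "\<And>y. qform n S y \<le> c \<Longrightarrow> hom_quad n B b (y, 1) \<le> \<xi>"
    and feas: "(\<Sum>p\<leftarrow>ps. qform n S (fst p)) \<le> c" and one: "(\<Sum>p\<leftarrow>ps. (snd p)\<^sup>2) = 1"
  shows "(\<Sum>p\<leftarrow>ps. hom_quad n B b p) \<le> \<xi>"
proof (rule ccontr)
  assume "\<not> (\<Sum>p\<leftarrow>ps. hom_quad n B b p) \<le> \<xi>"
  define G where "G p = qform n S (fst p) - c * (snd p)\<^sup>2" for p :: "(nat \<Rightarrow> real) \<times> real"
  define H where "H p = hom_quad n B b p - \<xi> * (snd p)\<^sup>2" for p
  define comb :: "real \<Rightarrow> real \<Rightarrow> (nat \<Rightarrow> real) \<times> real \<Rightarrow> (nat \<Rightarrow> real) \<times> real \<Rightarrow> (nat \<Rightarrow> real) \<times> real"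
    where "comb \<alpha> \<beta> p q = (\<lambda>i. \<alpha> * fst p i + \<beta> * fst q i, \<alpha> * snd p + \<beta> * snd q)" for \<alpha> \<beta> p q
  have bil: "qform n A (\<lambda>i. \<alpha> * f i + \<beta> * g i)
      = \<alpha>\<^sup>2 * qform n A f + 2 * \<alpha> * \<beta> * bilin n A f g + \<beta>\<^sup>2 * qform n A g"
    if "A \<in> sym_mats n" for A \<alpha> \<beta> f g
    using that by (simp add: bilin_square_add bilin_scale_left bilin_scale_right power2_eq_square)
  have lin: "(\<Sum>i<n. b i * (\<alpha> * f i + \<beta> * g i)) = \<alpha> * (\<Sum>i<n. b i * f i) + \<beta> * (\<Sum>i<n. b i * g i)" for \<alpha> \<beta> f g
    by (simp add: algebra_simps sum.distrib sum_distrib_left)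
  have GG: "\<exists>g. \<forall>\<alpha> \<beta>. G (comb \<alpha> \<beta> u v) = \<alpha>\<^sup>2 * G u + 2 * \<alpha> * \<beta> * g + \<beta>\<^sup>2 * G v" for u v
    by (rule exI[of _ "bilin n S (fst u) (fst v) - c * snd u * snd v"])
       (simp add: G_def comb_def bil[OF S] power2_sum power_mult_distrib algebra_simps power2_eq_square)
  have HH: "\<exists>g. \<forall>\<alpha> \<beta>. H (comb \<alpha> \<beta> u v) = \<alpha>\<^sup>2 * H u + 2 * \<alpha> * \<beta> * g + \<beta>\<^sup>2 * H v" for u v
  proof -
    define L where "L p = (\<Sum>i<n. b i * fst p i)" for p :: "(nat \<Rightarrow> real) \<times> real"
    have L: "L (comb \<alpha> \<beta> u v) = \<alpha> * L u + \<beta> * L v" for \<alpha> \<beta>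
      unfolding L_def comb_def fst_conv by (rule lin)
    show ?thesis
      unfolding H_def hom_quad_def L_def[symmetric] L
      by (rule exI[of _ "bilin n B (fst u) (fst v) + snd u * L v + snd v * L u - \<xi> * snd u * snd v"])
         (simp add: comb_def bil[OF B] algebra_simps power2_eq_square)
  qed
  have sub: "(\<Sum>p\<leftarrow>ps. f p - d * (snd p)\<^sup>2) = (\<Sum>p\<leftarrow>ps. f p) - d" for f :: "(nat \<Rightarrow> real) \<times> real \<Rightarrow> real" and d
    using one by (simp add: sum_list_subtractf sum_list_const_mult)
  have "(\<Sum>p\<leftarrow>ps. G p) \<le> 0" "0 < (\<Sum>p\<leftarrow>ps. H p)"
    using feas \<open>\<not> _\<close> unfolding G_def H_def sub by simp_all
  then obtain w where w: "G w \<le> 0" "0 < H w"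
    using rank_one_extraction[of G comb H ps, OF GG HH] by blast
  show False
  proof (cases "snd w = 0")
    case True
    then have "qform n S (fst w) \<le> 0" using w(1) by (simp add: G_def)
    then have "fst w i = 0" if "i < n" for i using posdef_bilin_zero[OF posS _ that] by blast
    then have "qform n B (fst w) = 0" by (simp add: bilin_def)
    then show False using w(2) True by (simp add: H_def hom_quad_def)
  next
    case False
    define y where "y = (\<lambda>i. (1 / snd w) * fst w i)"
    have p: "pair_scale (1 / snd w) w = (y, 1)" using False by (simp add: pair_scale_def y_def)
    have pos: "0 < (snd w)\<^sup>2" using False by simp
    have "qform n S y = qform n S (fst w) / (snd w)\<^sup>2"
      using bilin_pair_scale[of n S "1 / snd w" w] unfolding p by (simp add: power_divide)
    also have "\<dots> \<le> c" using w(1) pos by (simp add: G_def pos_divide_le_eq)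
    finally have "hom_quad n B b (y, 1) \<le> \<xi>" by (rule point)
    moreover have "hom_quad n B b (y, 1) = hom_quad n B b w / (snd w)\<^sup>2"
      using hom_quad_pair_scale[of n B b "1 / snd w" w] unfolding p by (simp add: power_divide)
    ultimately have "hom_quad n B b w \<le> \<xi> * (snd w)\<^sup>2" using pos by (simp add: pos_divide_le_eq)
    then show False using w(2) by (simp add: H_def)
  qed
qed

lemma rounding_weak_duality:
  fixes S :: "'k::finite \<Rightarrow> real mat"
  assumes S: "\<And>k. psd n (S k)" and B: "B \<in> sym_mats n"
    and point: "\<And>y. (\<And>k. qform n (S k) y \<le> 3 * ln (6 * real CARD('k)) * c k) \<Longrightarrow> hom_quad n B b (y, 1) \<le> \<xi>"
    and feas: "\<And>k. (\<Sum>p\<leftarrow>ps. qform n (S k) (fst p)) \<le> c k" and one: "(\<Sum>p\<leftarrow>ps. (snd p)\<^sup>2) = 1"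
  shows "(\<Sum>p\<leftarrow>ps. hom_quad n B b p) \<le> \<xi>"
proof -
  have nth_sum: "(\<Sum>p\<leftarrow>ps. f p) = (\<Sum>j<length ps. f (ps ! j))" for f :: "(nat \<Rightarrow> real) \<times> real \<Rightarrow> real"
    by (simp add: sum_list_sum_nth atLeast0LessThan)
  obtain x where x: "\<And>k. qform n (S k) x \<le> 3 * ln (6 * real CARD('k)) * c k"
    "(\<Sum>j<length ps. qform n B (fst (ps ! j)) + 2 * snd (ps ! j) * (\<Sum>i<n. b i * fst (ps ! j) i))
      \<le> qform n B x + 2 * (\<Sum>i<n. b i * x i)"
    using ellitope_rounding[of B n S "\<lambda>j. snd (ps ! j)" "length ps" "\<lambda>j. fst (ps ! j)" c b]
      B S feas one unfolding nth_sum by blast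
  have "(\<Sum>p\<leftarrow>ps. hom_quad n B b p) \<le> hom_quad n B b (x, 1)"
    using x(2) unfolding nth_sum hom_quad_def by simp
  also have "\<dots> \<le> \<xi>" by (rule point[OF x(1)])
  finally show ?thesis .
qed

text \<open>
  The bound is assumed on the larger ellitope of level \<open>s'\<close>, the multipliers certify it at level
  \<open>s\<close>; for \<open>K = 1\<close> both levels agree.
\<close>

lemma ellitope_certificate:
  fixes el :: "('k::finite) ellitope"
  assumes el: "ellitope_wf nz el" and B: "B \<in> sym_mats (ell_dim el)" and s: "0 < s"
    and s': "s' = (if CARD('k) = 1 then s else 3 * ln (6 * real CARD('k)) * s)"
    and point: "\<And>y t. t \<in> ell_T el \<Longrightarrow> (\<And>k. qform (ell_dim el) (ell_S el k) y \<le> s' * t $h k) \<Longrightarrow>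
      hom_quad (ell_dim el) B b (y, 1) \<le> \<xi>"
  obtains l :: "real ^ 'k" and \<tau> where "\<And>k. 0 \<le> l $h k"
    and "\<And>t. t \<in> ell_T el \<Longrightarrow> s * inner l t + \<tau> \<le> \<xi>"
    and "\<And>p. hom_quad (ell_dim el) B b p \<le> qform (ell_dim el) (weighted_S el l) (fst p) + \<tau> * (snd p)\<^sup>2"
proof -
  obtain t0 where t0: "t0 \<in> ell_T el" "\<And>k. 0 < t0 $h k" using ellitope_positive_point[OF el] by blast
  have conv: "convex (ell_T el)" and S: "\<And>k. psd (ell_dim el) (ell_S el k)"
    and pos: "posdef (ell_dim el) (weighted_S el (vec_lambda (\<lambda>_. 1)))"
    using el by (auto simp: ellitope_wf_def)
  have weak: "(\<Sum>p\<leftarrow>ps. hom_quad (ell_dim el) B b p) \<le> \<xi>"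
    if t: "t \<in> ell_T el" and feas: "\<And>k. (\<Sum>p\<leftarrow>ps. qform (ell_dim el) (ell_S el k) (fst p)) \<le> s * t $h k"
      and one: "(\<Sum>p\<leftarrow>ps. (snd p)\<^sup>2) = 1" for ps t
  proof (cases "CARD('k) = 1")
    case True
    define k :: 'k where "k = undefined"
    have univ: "UNIV = {k}" by (rule UNIV_eq_singleton[OF True])
    have "weighted_S el (vec_lambda (\<lambda>_. 1)) = ell_S el k"
      using carrier_matD[OF psd_carrier[OF S[of k]]] by (intro eq_matI) (auto simp: weighted_S_def univ)
    then have posS: "posdef (ell_dim el) (ell_S el k)" using pos by simp
    show ?thesis
    proof (rule rank_one_weak_duality[OF _ B posS _ feas[of k] one])
      show "ell_S el k \<in> sym_mats (ell_dim el)" using S by (simp add: psd_def)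
    next
      fix y assume y: "qform (ell_dim el) (ell_S el k) y \<le> s * t $h k"
      have "qform (ell_dim el) (ell_S el j) y \<le> s' * t $h j" for j
      proof -
        have "j = k" using univ by blast
        then show ?thesis using y True by (simp add: s')
      qed
      then show "hom_quad (ell_dim el) B b (y, 1) \<le> \<xi>" by (rule point[OF t])
    qed
  next
    case False
    show ?thesis
    proof (rule rounding_weak_duality[OF S B _ feas one])
      fix y assume "\<And>k. qform (ell_dim el) (ell_S el k) y \<le> 3 * ln (6 * real CARD('k)) * (s * t $h k)"
      then show "hom_quad (ell_dim el) B b (y, 1) \<le> \<xi>" using False by (intro point[OF t]) (simp add: s' mult.assoc)
    qed
  qed
  show ?thesis
    using relaxation_duality[OF conv t0 s, of "ell_dim el" "ell_S el" B b \<xi>] weak that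
    unfolding bilin_weighted_S by blast
qed

section \<open>Bordered matrices and Schur complements\<close>

lemma bilin_diff_mat:
  assumes "A \<in> carrier_mat n n" "B \<in> carrier_mat n n"
  shows "bilin n (A - B) f g = bilin n A f g - bilin n B f g"
  using assms by (simp add: bilin_def algebra_simps sum_subtractf)

lemma bilin_smult_mat:
  assumes "A \<in> carrier_mat n n"
  shows "bilin n (c \<cdot>\<^sub>m A) f g = c * bilin n A f g"
  using assms by (simp add: bilin_def sum_distrib_left mult_ac)

lemma sym_mats_diff: "A \<in> sym_mats n \<Longrightarrow> B \<in> sym_mats n \<Longrightarrow> A - B \<in> sym_mats n"
  by (auto simp: sym_mats_def transpose_minus)

lemma sym_matsI:
  assumes "A \<in> carrier_mat n n" "\<And>i j. i < n \<Longrightarrow> j < n \<Longrightarrow> A $$ (i, j) = A $$ (j, i)"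
  shows "A \<in> sym_mats n"
  using assms by (auto simp: sym_mats_def intro!: eq_matI)

lemma bordered_last_carrier:
  assumes "X \<in> carrier_mat n n" "x \<in> carrier_vec n"
  shows "bordered_last X x a \<in> carrier_mat (Suc n) (Suc n)"
  using assms unfolding bordered_last_def
  by (intro carrier_matI) (auto simp: scalar_block_def)

lemma bordered_last_index:
  assumes "X \<in> carrier_mat n n" "x \<in> carrier_vec n" "i < Suc n" "j < Suc n"
  shows "bordered_last X x a $$ (i, j) =
    (if i < n then if j < n then X $$ (i, j) else x $ i else if j < n then x $ j else a)"
  using assms unfolding bordered_last_def
  by (auto simp: scalar_block_def col_block_def row_block_def mat_of_cols_def mat_of_rows_def less_Suc_eq)

lemma bilin_bordered_last:
  assumes "X \<in> carrier_mat n n" "x \<in> carrier_vec n"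
  shows "qform (Suc n) (bordered_last X x a) f
    = qform n X f + 2 * f n * (\<Sum>i<n. x $ i * f i) + a * (f n)\<^sup>2"
proof -
  have "qform (Suc n) (bordered_last X x a) f
    = (\<Sum>i<n. (\<Sum>j<n. X $$ (i, j) * f i * f j) + x $ i * f i * f n) + ((\<Sum>j<n. x $ j * f n * f j) + a * f n * f n)"
    using assms by (simp add: bilin_def bordered_last_index)
  also have "\<dots> = qform n X f + (f n * (\<Sum>i<n. x $ i * f i) + f n * (\<Sum>i<n. x $ i * f i)) + a * f n * f n"
    by (simp add: bilin_def sum.distrib sum_distrib_left mult_ac)
  finally show ?thesis by (simp add: power2_eq_square)
qed

lemma psd_bordered_lastI:
  assumes X: "X \<in> sym_mats n" and x: "x \<in> carrier_vec n"
    and "\<And>f \<sigma>. 0 \<le> qform n X f + 2 * \<sigma> * (\<Sum>i<n. x $ i * f i) + a * \<sigma>\<^sup>2"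
  shows "psd (n + 1) (bordered_last X x a)"
proof -
  have Xc: "X \<in> carrier_mat n n" using X by (rule sym_mats_carrier)
  have "bordered_last X x a \<in> sym_mats (Suc n)"
    by (rule sym_matsI[OF bordered_last_carrier[OF Xc x]])
       (auto simp: bordered_last_index[OF Xc x] sym_mats_entry[OF X])
  then show ?thesis unfolding psd_iff_bilin using assms(3) by (simp add: bilin_bordered_last[OF Xc x])
qed

lemma psd_bordered_lastD:
  assumes psd: "psd (n + 1) (bordered_last X x a)" and Xc: "X \<in> carrier_mat n n" and x: "x \<in> carrier_vec n"
  shows "0 \<le> qform n X f + 2 * \<sigma> * (\<Sum>i<n. x $ i * f i) + a * \<sigma>\<^sup>2"
proof -
  define g where "g = f(n := \<sigma>)"
  have "0 \<le> qform (Suc n) (bordered_last X x a) g" using psd by (simp add: psd_iff_bilin)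
  also have "\<dots> = qform n X g + 2 * g n * (\<Sum>i<n. x $ i * g i) + a * (g n)\<^sup>2"
    by (rule bilin_bordered_last[OF Xc x])
  also have "qform n X g = qform n X f" by (rule bilin_cong) (auto simp: g_def)
  finally show ?thesis by (simp add: g_def)
qed

lemma bordered_first_carrier:
  assumes "X \<in> carrier_mat n n" "x \<in> carrier_vec n"
  shows "bordered_first a x X \<in> carrier_mat (Suc n) (Suc n)"
  using assms unfolding bordered_first_def
  by (intro carrier_matI) (auto simp: scalar_block_def)

lemma bordered_first_index:
  assumes "X \<in> carrier_mat n n" "x \<in> carrier_vec n" "i < Suc n" "j < Suc n"
  shows "bordered_first a x X $$ (i, j) =
    (case i of 0 \<Rightarrow> (case j of 0 \<Rightarrow> a | Suc j \<Rightarrow> x $ j) | Suc i \<Rightarrow> (case j of 0 \<Rightarrow> x $ i | Suc j \<Rightarrow> X $$ (i, j)))"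
  using assms unfolding bordered_first_def
  by (auto simp: scalar_block_def col_block_def row_block_def mat_of_cols_def mat_of_rows_def split: nat.split)

lemma bilin_bordered_first:
  assumes "X \<in> carrier_mat n n" "x \<in> carrier_vec n"
  shows "qform (Suc n) (bordered_first a x X) f
    = qform n X (\<lambda>i. f (Suc i)) + 2 * f 0 * (\<Sum>i<n. x $ i * f (Suc i)) + a * (f 0)\<^sup>2"
proof -
  have "qform (Suc n) (bordered_first a x X) f
    = (a * f 0 * f 0 + (\<Sum>j<n. x $ j * f 0 * f (Suc j)))
      + (\<Sum>i<n. x $ i * f (Suc i) * f 0 + (\<Sum>j<n. X $$ (i, j) * f (Suc i) * f (Suc j)))"
    unfolding bilin_def sum.lessThan_Suc_shift using assms by (simp add: bordered_first_index)
  also have "\<dots> = qform n X (\<lambda>i. f (Suc i))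
      + (f 0 * (\<Sum>i<n. x $ i * f (Suc i)) + f 0 * (\<Sum>i<n. x $ i * f (Suc i))) + a * f 0 * f 0"
    by (simp add: bilin_def sum.distrib sum_distrib_left mult_ac)
  finally show ?thesis by (simp add: power2_eq_square)
qed

lemma psd_bordered_firstI:
  assumes X: "X \<in> sym_mats n" and x: "x \<in> carrier_vec n"
    and "\<And>f \<sigma>. 0 \<le> qform n X f + 2 * \<sigma> * (\<Sum>i<n. x $ i * f i) + a * \<sigma>\<^sup>2"
  shows "psd (n + 1) (bordered_first a x X)"
proof -
  have Xc: "X \<in> carrier_mat n n" using X by (rule sym_mats_carrier)
  have "bordered_first a x X \<in> sym_mats (Suc n)"
    by (rule sym_matsI[OF bordered_first_carrier[OF Xc x]])
       (auto simp: bordered_first_index[OF Xc x] sym_mats_entry[OF X] split: nat.split)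
  then show ?thesis unfolding psd_iff_bilin using assms(3) by (simp add: bilin_bordered_first[OF Xc x])
qed

lemma psd_bordered_firstD:
  assumes psd: "psd (n + 1) (bordered_first a x X)" and Xc: "X \<in> carrier_mat n n" and x: "x \<in> carrier_vec n"
  shows "0 \<le> qform n X f + 2 * \<sigma> * (\<Sum>i<n. x $ i * f i) + a * \<sigma>\<^sup>2"
proof -
  define g where "g i = (case i of 0 \<Rightarrow> \<sigma> | Suc i \<Rightarrow> f i)" for i
  have "0 \<le> qform (Suc n) (bordered_first a x X) g" using psd by (simp add: psd_iff_bilin)
  also have "\<dots> = qform n X f + 2 * \<sigma> * (\<Sum>i<n. x $ i * f i) + a * \<sigma>\<^sup>2"
    unfolding bilin_bordered_first[OF Xc x] by (simp add: g_def)
  finally show ?thesis .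
qed

lemma bordered_last_of_sym_mat:
  assumes M: "M \<in> sym_mats (n + 1)"
  shows "bordered_last (mat n n (($$) M)) (vec n (\<lambda>i. M $$ (i, n))) (M $$ (n, n)) = M"
proof (rule eq_matI)
  let ?X = "mat n n (($$) M)" and ?x = "vec n (\<lambda>i. M $$ (i, n))"
  have c: "?X \<in> carrier_mat n n" "?x \<in> carrier_vec n" by simp_all
  note bc = bordered_last_carrier[OF c, of "M $$ (n, n)"]
  have Mc: "M \<in> carrier_mat (Suc n) (Suc n)" using M by (simp add: sym_mats_def)
  show "dim_row (bordered_last ?X ?x (M $$ (n, n))) = dim_row M"
    "dim_col (bordered_last ?X ?x (M $$ (n, n))) = dim_col M" using bc Mc by auto
  fix i j assume "i < dim_row M" "j < dim_col M"
  then have ij: "i < Suc n" "j < Suc n" using Mc by auto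
  then show "bordered_last ?X ?x (M $$ (n, n)) $$ (i, j) = M $$ (i, j)"
    unfolding bordered_last_index[OF c ij] using sym_mats_entry[OF M, of n j]
    by (auto simp: less_Suc_eq)
qed

lemma psd_zero_diff:
  assumes "M \<in> carrier_mat n n"
  shows "psd n (M - M)"
proof -
  have "M - M = 0\<^sub>m n n" using assms by (intro eq_matI) auto
  moreover have "0\<^sub>m n n \<in> sym_mats n" by (simp add: sym_mats_def)
  ultimately show ?thesis by (simp add: psd_iff_bilin bilin_def)
qed

text \<open>
  Completing the square: the form of the block matrix at \<open>[y; z]\<close> is that of \<open>Sig - G G\<^sup>T\<close> at
  \<open>y\<close> plus the squared length of \<open>G\<^sup>T y + z\<close>.
\<close>

lemma schur_complement:
  assumes Sig: "Sig \<in> sym_mats m" and G: "G \<in> carrier_mat m k"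
  shows "psd (m + k) (four_block_mat Sig G (transpose_mat G) (1\<^sub>m k)) \<longleftrightarrow> psd m (Sig - G * transpose_mat G)"
proof -
  have Sc: "Sig \<in> carrier_mat m m" and St: "transpose_mat Sig = Sig" using Sig by (auto simp: sym_mats_def)
  have Gt: "transpose_mat G \<in> carrier_mat k m" using G by simp
  have GG: "G * transpose_mat G \<in> carrier_mat m m" using G by simp
  let ?M = "four_block_mat Sig G (transpose_mat G) (1\<^sub>m k)"
  have Msym: "?M \<in> sym_mats (m + k)"
    unfolding sym_mats_def using Sc G Gt St
    by (auto simp: transpose_four_block_mat[OF Sc G Gt one_carrier_mat])
  have "G * transpose_mat G \<in> sym_mats m"
    unfolding sym_mats_def using G by (auto simp: transpose_mult[OF G Gt])
  then have Dsym: "Sig - G * transpose_mat G \<in> sym_mats m" using Sig by (rule sym_mats_diff[rotated])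
  have quad: "(y @\<^sub>v z) \<bullet> (?M *\<^sub>v (y @\<^sub>v z)) = y \<bullet> ((Sig - G * transpose_mat G) *\<^sub>v y)
      + (transpose_mat G *\<^sub>v y + z) \<bullet> (transpose_mat G *\<^sub>v y + z)"
    if y: "y \<in> carrier_vec m" and z: "z \<in> carrier_vec k" for y z
  proof -
    define h where "h = transpose_mat G *\<^sub>v y"
    have h: "h \<in> carrier_vec k" using Gt y by (simp add: h_def)
    have Sy: "Sig *\<^sub>v y \<in> carrier_vec m" using Sc y by simp
    have Gz: "G *\<^sub>v z \<in> carrier_vec m" using G z by simp
    have Gh: "G *\<^sub>v h \<in> carrier_vec m" using G h by simp
    have yG: "y \<bullet> (G *\<^sub>v u) = h \<bullet> u" if u: "u \<in> carrier_vec k" for u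
      using transpose_vec_mult_scalar[OF G u y] by (simp add: h_def)
    have "?M *\<^sub>v (y @\<^sub>v z) = (Sig *\<^sub>v y + G *\<^sub>v z) @\<^sub>v (h + z)"
      unfolding h_def using four_block_mat_mult_vec[OF Sc G Gt one_carrier_mat y z] z by simp
    then have "(y @\<^sub>v z) \<bullet> (?M *\<^sub>v (y @\<^sub>v z)) = y \<bullet> (Sig *\<^sub>v y + G *\<^sub>v z) + z \<bullet> (h + z)"
      using y z Sy Gz h by (simp add: scalar_prod_append[of _ m _ k])
    also have "\<dots> = y \<bullet> (Sig *\<^sub>v y) + h \<bullet> z + (h \<bullet> z + z \<bullet> z)"
      using scalar_prod_add_distrib[OF y Sy Gz] scalar_prod_add_distrib[OF z h z]
        comm_scalar_prod[OF z h] yG[OF z] by simp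
    finally have 1: "(y @\<^sub>v z) \<bullet> (?M *\<^sub>v (y @\<^sub>v z)) = y \<bullet> (Sig *\<^sub>v y) + h \<bullet> z + (h \<bullet> z + z \<bullet> z)" .
    have "(Sig - G * transpose_mat G) *\<^sub>v y = Sig *\<^sub>v y - G *\<^sub>v h"
      unfolding h_def using minus_mult_distrib_mat_vec[OF Sc GG y] assoc_mult_mat_vec[OF G Gt y] by simp
    then have 2: "y \<bullet> ((Sig - G * transpose_mat G) *\<^sub>v y) = y \<bullet> (Sig *\<^sub>v y) - h \<bullet> h"
      using scalar_prod_minus_distrib[OF y Sy Gh] yG[OF h] by simp
    have hz: "h + z \<in> carrier_vec k" using h z by simp
    have "(h + z) \<bullet> (h + z) = h \<bullet> h + h \<bullet> z + (h \<bullet> z + z \<bullet> z)"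
      using add_scalar_prod_distrib[OF h z hz] scalar_prod_add_distrib[OF h h z]
        scalar_prod_add_distrib[OF z h z] comm_scalar_prod[OF z h] by simp
    then show ?thesis unfolding h_def[symmetric] 1 2 by simp
  qed
  show ?thesis
  proof
    assume p: "psd (m + k) ?M"
    show "psd m (Sig - G * transpose_mat G)"
      unfolding psd_def
    proof (intro conjI Dsym ballI)
      fix y :: "real vec" assume y: "y \<in> carrier_vec m"
      define z where "z = - (transpose_mat G *\<^sub>v y)"
      have z: "z \<in> carrier_vec k" using Gt y by (simp add: z_def)
      have "0 \<le> (y @\<^sub>v z) \<bullet> (?M *\<^sub>v (y @\<^sub>v z))" using p y z by (simp add: psd_def)
      moreover have "transpose_mat G *\<^sub>v y + z = 0\<^sub>v k" using Gt y by (auto simp: z_def intro!: eq_vecI)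
      ultimately show "0 \<le> y \<bullet> ((Sig - G * transpose_mat G) *\<^sub>v y)" unfolding quad[OF y z] by simp
    qed
  next
    assume p: "psd m (Sig - G * transpose_mat G)"
    show "psd (m + k) ?M"
      unfolding psd_def
    proof (intro conjI Msym, unfold all_vec_append, intro ballI)
      fix y z :: "real vec" assume y: "y \<in> carrier_vec m" and z: "z \<in> carrier_vec k"
      have sq: "0 \<le> u \<bullet> u" for u :: "real vec" by (auto simp: scalar_prod_def intro!: sum_nonneg)
      show "0 \<le> (y @\<^sub>v z) \<bullet> (?M *\<^sub>v (y @\<^sub>v z))"
        unfolding quad[OF y z] using p y sq by (simp add: psd_def add_nonneg_nonneg)
    qed
  qed
qed

section \<open>The closed loop is affine in the disturbances\<close>

lemma aug_carrier: "\<zeta> \<in> carrier_vec n \<Longrightarrow> aug \<zeta> \<in> carrier_vec (Suc n)"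
  by (rule carrier_vecI) (simp add: aug_def)

lemma aug_index: "\<zeta> \<in> carrier_vec n \<Longrightarrow> i < Suc n \<Longrightarrow> aug \<zeta> $ i = (if i < n then \<zeta> $ i else 1)"
  by (auto simp: aug_def less_Suc_eq)

lemma mult_aug_index:
  assumes "Z \<in> carrier_mat m (Suc n)" "\<zeta> \<in> carrier_vec n" "i < m"
  shows "(Z *\<^sub>v aug \<zeta>) $ i = (\<Sum>j<n. Z $$ (i, j) * \<zeta> $ j) + Z $$ (i, n)"
proof -
  have "(Z *\<^sub>v aug \<zeta>) $ i = (\<Sum>j<Suc n. Z $$ (i, j) * aug \<zeta> $ j)"
    using assms aug_carrier[OF assms(2)] by (simp add: scalar_prod_def atLeast0LessThan)
  also have "\<dots> = (\<Sum>j<n. Z $$ (i, j) * \<zeta> $ j) + Z $$ (i, n)"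
    using assms by (simp add: aug_index)
  finally show ?thesis .
qed

text \<open>
  Evaluation at zero and at the unit vectors. This makes the definite descriptions that define
  \<open>traj_mats\<close> and \<open>pq_coeffs\<close> unambiguous.
\<close>

lemma affine_coeffs_unique:
  fixes a a' :: "nat \<Rightarrow> real"
  assumes eq: "\<And>\<zeta>. \<zeta> \<in> carrier_vec n \<Longrightarrow> (\<Sum>j<n. a j * \<zeta> $ j) + c = (\<Sum>j<n. a' j * \<zeta> $ j) + c'"
  shows "c = c'" and "i < n \<Longrightarrow> a i = a' i"
proof -
  show c: "c = c'" using eq[of "0\<^sub>v n"] by simp
  assume i: "i < n"
  have u: "(\<Sum>j<n. b j * unit_vec n i $ j) = b i" for b :: "nat \<Rightarrow> real"
  proof -
    have "(\<Sum>j<n. b j * unit_vec n i $ j) = (\<Sum>j<n. if j = i then b i else 0)"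
      by (intro sum.cong refl) (auto simp: unit_vec_def)
    then show ?thesis using i by simp
  qed
  show "a i = a' i" using eq[of "unit_vec n i"] c by (simp add: u)
qed

text \<open>
  Affine functions of the pair of disturbances are described coordinatewise; the matrices are
  assembled from the coefficients only once, for the whole trajectory.
\<close>

definition affine_fun :: "nat \<Rightarrow> nat \<Rightarrow> (real vec \<Rightarrow> real vec \<Rightarrow> real) \<Rightarrow> bool" where
  "affine_fun n m f \<longleftrightarrow> (\<exists>a b c. \<forall>\<zeta> \<in> carrier_vec n. \<forall>e \<in> carrier_vec m.
     f \<zeta> e = (\<Sum>j<n. a j * \<zeta> $ j) + (\<Sum>j<m. b j * e $ j) + c)"

definition affine_vec_fun :: "nat \<Rightarrow> nat \<Rightarrow> nat \<Rightarrow> (real vec \<Rightarrow> real vec \<Rightarrow> real vec) \<Rightarrow> bool" where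
  "affine_vec_fun n m d F \<longleftrightarrow> (\<forall>\<zeta> \<in> carrier_vec n. \<forall>e \<in> carrier_vec m. F \<zeta> e \<in> carrier_vec d) \<and>
     (\<forall>i<d. affine_fun n m (\<lambda>\<zeta> e. F \<zeta> e $ i))"

lemma affine_fun_cong:
  assumes "affine_fun n m f" "\<And>\<zeta> e. \<zeta> \<in> carrier_vec n \<Longrightarrow> e \<in> carrier_vec m \<Longrightarrow> f \<zeta> e = g \<zeta> e"
  shows "affine_fun n m g"
proof -
  obtain a b c where "\<forall>\<zeta> \<in> carrier_vec n. \<forall>e \<in> carrier_vec m.
      f \<zeta> e = (\<Sum>j<n. a j * \<zeta> $ j) + (\<Sum>j<m. b j * e $ j) + c" using assms(1) unfolding affine_fun_def by blast
  then have "\<forall>\<zeta> \<in> carrier_vec n. \<forall>e \<in> carrier_vec m.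
      g \<zeta> e = (\<Sum>j<n. a j * \<zeta> $ j) + (\<Sum>j<m. b j * e $ j) + c" using assms(2) by simp
  then show ?thesis unfolding affine_fun_def by blast
qed

lemma affine_fun_const: "affine_fun n m (\<lambda>_ _. c)"
  unfolding affine_fun_def by (intro exI[of _ "\<lambda>_. 0"] exI[of _ c]) simp

lemma affine_fun_add:
  assumes "affine_fun n m f" "affine_fun n m g"
  shows "affine_fun n m (\<lambda>\<zeta> e. f \<zeta> e + g \<zeta> e)"
proof -
  obtain a b c where f: "\<And>\<zeta> e. \<zeta> \<in> carrier_vec n \<Longrightarrow> e \<in> carrier_vec m \<Longrightarrow>
      f \<zeta> e = (\<Sum>j<n. a j * \<zeta> $ j) + (\<Sum>j<m. b j * e $ j) + c" using assms(1) unfolding affine_fun_def by blast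
  obtain a' b' c' where g: "\<And>\<zeta> e. \<zeta> \<in> carrier_vec n \<Longrightarrow> e \<in> carrier_vec m \<Longrightarrow>
      g \<zeta> e = (\<Sum>j<n. a' j * \<zeta> $ j) + (\<Sum>j<m. b' j * e $ j) + c'" using assms(2) unfolding affine_fun_def by blast
  show ?thesis unfolding affine_fun_def
    by (intro exI[of _ "\<lambda>j. a j + a' j"] exI[of _ "\<lambda>j. b j + b' j"] exI[of _ "c + c'"])
       (simp add: f g algebra_simps sum.distrib)
qed

lemma affine_fun_scale:
  assumes "affine_fun n m f"
  shows "affine_fun n m (\<lambda>\<zeta> e. k * f \<zeta> e)"
proof -
  obtain a b c where f: "\<And>\<zeta> e. \<zeta> \<in> carrier_vec n \<Longrightarrow> e \<in> carrier_vec m \<Longrightarrow>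
      f \<zeta> e = (\<Sum>j<n. a j * \<zeta> $ j) + (\<Sum>j<m. b j * e $ j) + c" using assms(1) unfolding affine_fun_def by blast
  show ?thesis unfolding affine_fun_def
    by (intro exI[of _ "\<lambda>j. k * a j"] exI[of _ "\<lambda>j. k * b j"] exI[of _ "k * c"])
       (simp add: f algebra_simps sum_distrib_left)
qed

lemma affine_fun_sum:
  assumes "\<And>j. j \<in> J \<Longrightarrow> affine_fun n m (f j)"
  shows "affine_fun n m (\<lambda>\<zeta> e. \<Sum>j\<in>J. f j \<zeta> e)"
  using assms by (induction J rule: infinite_finite_induct) (simp_all add: affine_fun_const affine_fun_add)

lemma sum_indicator_mult: "i < n \<Longrightarrow> (\<Sum>j<n. (if j = i then 1 else 0) * f j) = (f i :: real)" for n :: nat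
proof -
  assume i: "i < n"
  have "(\<Sum>j<n. (if j = i then 1 else 0) * f j) = (\<Sum>j<n. if j = i then f i else 0)"
    by (intro sum.cong refl) auto
  then show ?thesis using i by simp
qed

lemma affine_fun_left: "i < n \<Longrightarrow> affine_fun n m (\<lambda>\<zeta> e. \<zeta> $ i)"
  unfolding affine_fun_def
  by (intro exI[of _ "\<lambda>j. if j = i then 1 else 0"] exI[of _ "\<lambda>_. 0"] exI[of _ 0])
     (simp add: sum_indicator_mult del: mult_if_delta)

lemma affine_fun_right: "i < m \<Longrightarrow> affine_fun n m (\<lambda>\<zeta> e. e $ i)"
  unfolding affine_fun_def
  by (intro exI[of _ "\<lambda>_. 0"] exI[of _ "\<lambda>j. if j = i then 1 else 0"] exI[of _ 0])
     (simp add: sum_indicator_mult del: mult_if_delta)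

lemma affine_vec_funI:
  assumes "\<And>\<zeta> e. \<zeta> \<in> carrier_vec n \<Longrightarrow> e \<in> carrier_vec m \<Longrightarrow> F \<zeta> e \<in> carrier_vec d"
    and "\<And>i. i < d \<Longrightarrow> affine_fun n m (f i)"
    and "\<And>\<zeta> e i. \<zeta> \<in> carrier_vec n \<Longrightarrow> e \<in> carrier_vec m \<Longrightarrow> i < d \<Longrightarrow> F \<zeta> e $ i = f i \<zeta> e"
  shows "affine_vec_fun n m d F"
  unfolding affine_vec_fun_def
proof (intro conjI ballI allI impI)
  fix i assume "i < d"
  then show "affine_fun n m (\<lambda>\<zeta> e. F \<zeta> e $ i)"
    by (intro affine_fun_cong[OF assms(2)]) (simp_all add: assms(3))
qed (use assms(1) in simp)

lemma affine_vec_fun_carrier: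
  "affine_vec_fun n m d F \<Longrightarrow> \<zeta> \<in> carrier_vec n \<Longrightarrow> e \<in> carrier_vec m \<Longrightarrow> F \<zeta> e \<in> carrier_vec d"
  by (simp add: affine_vec_fun_def)

lemma affine_vec_fun_dim:
  "affine_vec_fun n m d F \<Longrightarrow> \<zeta> \<in> carrier_vec n \<Longrightarrow> e \<in> carrier_vec m \<Longrightarrow> dim_vec (F \<zeta> e) = d"
  by (simp add: affine_vec_fun_def)

lemma affine_vec_fun_index:
  "affine_vec_fun n m d F \<Longrightarrow> i < d \<Longrightarrow> affine_fun n m (\<lambda>\<zeta> e. F \<zeta> e $ i)"
  by (simp add: affine_vec_fun_def)

lemma affine_vec_fun_const: "v \<in> carrier_vec d \<Longrightarrow> affine_vec_fun n m d (\<lambda>_ _. v)"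
  by (rule affine_vec_funI[where f = "\<lambda>i _ _. v $ i"]) (simp_all add: affine_fun_const)

lemma affine_vec_fun_add:
  assumes "affine_vec_fun n m d F" "affine_vec_fun n m d G"
  shows "affine_vec_fun n m d (\<lambda>\<zeta> e. F \<zeta> e + G \<zeta> e)"
  by (rule affine_vec_funI[where f = "\<lambda>i \<zeta> e. F \<zeta> e $ i + G \<zeta> e $ i"])
     (use assms in \<open>auto simp: affine_vec_fun_dim affine_vec_fun_carrier intro!: affine_fun_add affine_vec_fun_index\<close>)

lemma affine_vec_fun_mult:
  assumes A: "A \<in> carrier_mat d' d" and F: "affine_vec_fun n m d F"
  shows "affine_vec_fun n m d' (\<lambda>\<zeta> e. A *\<^sub>v F \<zeta> e)"
proof (rule affine_vec_funI[where f = "\<lambda>i \<zeta> e. \<Sum>j<d. A $$ (i, j) * F \<zeta> e $ j"])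
  show "affine_fun n m (\<lambda>\<zeta> e. \<Sum>j<d. A $$ (i, j) * F \<zeta> e $ j)" for i
    by (intro affine_fun_sum affine_fun_scale affine_vec_fun_index[OF F]) simp
  fix \<zeta> e :: "real vec" and i assume *: "\<zeta> \<in> carrier_vec n" "e \<in> carrier_vec m" "i < d'"
  show "(A *\<^sub>v F \<zeta> e) $ i = (\<Sum>j<d. A $$ (i, j) * F \<zeta> e $ j)"
    using A affine_vec_fun_carrier[OF F *(1,2)] *(3) by (auto simp: scalar_prod_def atLeast0LessThan)
qed (auto intro!: mult_mat_vec_carrier[OF A] affine_vec_fun_carrier[OF F])

lemma affine_vec_fun_diff:
  assumes "affine_vec_fun n m d F" "affine_vec_fun n m d G"
  shows "affine_vec_fun n m d (\<lambda>\<zeta> e. F \<zeta> e - G \<zeta> e)"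
proof (rule affine_vec_funI[where f = "\<lambda>i \<zeta> e. F \<zeta> e $ i + (- 1) * G \<zeta> e $ i"])
  show "affine_fun n m (\<lambda>\<zeta> e. F \<zeta> e $ i + (- 1) * G \<zeta> e $ i)" if "i < d" for i
    by (intro affine_fun_add affine_fun_scale affine_vec_fun_index[OF assms(1) that] affine_vec_fun_index[OF assms(2) that])
qed (use assms in \<open>auto simp: affine_vec_fun_dim affine_vec_fun_carrier\<close>)

lemma affine_vec_fun_slice_left:
  assumes "off + d \<le> n"
  shows "affine_vec_fun n m d (\<lambda>\<zeta> e. vec_slice \<zeta> off d)"
  by (rule affine_vec_funI[where f = "\<lambda>i \<zeta> e. \<zeta> $ (off + i)"])
     (use assms in \<open>auto simp: vec_slice_def intro!: affine_fun_left\<close>)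

lemma affine_vec_fun_slice_right:
  assumes "off + d \<le> m"
  shows "affine_vec_fun n m d (\<lambda>\<zeta> e. vec_slice e off d)"
  by (rule affine_vec_funI[where f = "\<lambda>i \<zeta> e. e $ (off + i)"])
     (use assms in \<open>auto simp: vec_slice_def intro!: affine_fun_right\<close>)

lemma affine_vec_fun_append:
  assumes F: "affine_vec_fun n m d F" and G: "affine_vec_fun n m d' G"
  shows "affine_vec_fun n m (d + d') (\<lambda>\<zeta> e. F \<zeta> e @\<^sub>v G \<zeta> e)"
proof (rule affine_vec_funI[where f = "\<lambda>i \<zeta> e. if i < d then F \<zeta> e $ i else G \<zeta> e $ (i - d)"])
  show "affine_fun n m (\<lambda>\<zeta> e. if i < d then F \<zeta> e $ i else G \<zeta> e $ (i - d))" if "i < d + d'" for i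
    using that affine_vec_fun_index[OF F, of i] affine_vec_fun_index[OF G, of "i - d"] by (cases "i < d") simp_all
  fix \<zeta> e :: "real vec" and i assume *: "\<zeta> \<in> carrier_vec n" "e \<in> carrier_vec m" "i < d + d'"
  show "(F \<zeta> e @\<^sub>v G \<zeta> e) $ i = (if i < d then F \<zeta> e $ i else G \<zeta> e $ (i - d))"
    using affine_vec_fun_carrier[OF F *(1,2)] affine_vec_fun_carrier[OF G *(1,2)] *(3) by auto
qed (auto intro!: append_carrier_vec affine_vec_fun_carrier[OF F] affine_vec_fun_carrier[OF G])

lemma affine_vec_fun_vstack:
  assumes "\<And>t. t < N \<Longrightarrow> affine_vec_fun n m d (F t)"
  shows "affine_vec_fun n m (d * N) (\<lambda>\<zeta> e. vstack (\<lambda>t. F t \<zeta> e) N)"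
  using assms
proof (induction N)
  case 0
  then show ?case using affine_vec_fun_const[of "0\<^sub>v 0" 0] by simp
next
  case (Suc N)
  then show ?case using affine_vec_fun_append[of n m "d * N" _ d "F N"] by (simp add: add.commute)
qed

lemma d_block_bound: "t < horizon sys \<Longrightarrow> x_dim sys + (\<Sum>\<tau><t. d_dim sys \<tau>) + d_dim sys t \<le> n_zeta sys"
  using sum_mono2[of "{..<horizon sys}" "{..<Suc t}" "d_dim sys"] by (simp add: n_zeta_def)

lemma e_block_bound: "t < horizon sys \<Longrightarrow> x_dim sys + (\<Sum>\<tau><t. e_dim sys \<tau>) + e_dim sys t \<le> n_eps sys"
  using sum_mono2[of "{..<horizon sys}" "{..<Suc t}" "e_dim sys"] by (simp add: n_eps_def)

declare state.simps [simp del] model_state.simps [simp del] purified.simps [simp del] control.simps [simp del]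

text \<open>
  By induction on time. A control at time \<open>t\<close> uses purified outputs up to time \<open>t\<close>,
  and the purified output at time \<open>t\<close> uses the states at time \<open>t\<close> but not the control.
\<close>

lemma closed_loop_affine:
  assumes wf: "plant_wf sys" and c: "c \<in> pob_laws sys" and t: "t \<le> horizon sys"
  defines "aff \<equiv> affine_vec_fun (n_zeta sys) (n_eps sys)"
  shows "(\<forall>s\<le>t. aff (x_dim sys) (\<lambda>\<zeta> e. state sys c \<zeta> e s) \<and> aff (x_dim sys) (\<lambda>\<zeta> e. model_state sys c \<zeta> e s)) \<and>
    (\<forall>s<t. aff (y_dim sys) (\<lambda>\<zeta> e. purified sys c \<zeta> e s) \<and> aff (u_dim sys) (\<lambda>\<zeta> e. control sys c \<zeta> e s))"
  using t
proof (induction t)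
  case 0
  have "aff (x_dim sys) (\<lambda>\<zeta> e. z_part sys \<zeta> + s_part sys e)"
    unfolding aff_def z_part_def s_part_def
    by (intro affine_vec_fun_add affine_vec_fun_slice_left affine_vec_fun_slice_right) (simp_all add: n_zeta_def n_eps_def)
  moreover have "aff (x_dim sys) (\<lambda>\<zeta> e. 0\<^sub>v (x_dim sys))" unfolding aff_def by (rule affine_vec_fun_const) simp
  ultimately show ?case by (simp add: state.simps model_state.simps)
next
  case (Suc t)
  then have t: "t < horizon sys" by simp
  have mats: "matA sys t \<in> carrier_mat (x_dim sys) (x_dim sys)" "matB sys t \<in> carrier_mat (x_dim sys) (u_dim sys)"
     "matBd sys t \<in> carrier_mat (x_dim sys) (d_dim sys t)" "matBs sys t \<in> carrier_mat (x_dim sys) (e_dim sys t)"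
     "matC sys t \<in> carrier_mat (y_dim sys) (x_dim sys)" "matDd sys t \<in> carrier_mat (y_dim sys) (d_dim sys t)"
     "matDs sys t \<in> carrier_mat (y_dim sys) (e_dim sys t)"
    using wf t unfolding plant_wf_def by auto
  have IH: "\<And>s. s \<le> t \<Longrightarrow> aff (x_dim sys) (\<lambda>\<zeta> e. state sys c \<zeta> e s)"
    "\<And>s. s \<le> t \<Longrightarrow> aff (x_dim sys) (\<lambda>\<zeta> e. model_state sys c \<zeta> e s)"
    "\<And>s. s < t \<Longrightarrow> aff (y_dim sys) (\<lambda>\<zeta> e. purified sys c \<zeta> e s)"
    "\<And>s. s < t \<Longrightarrow> aff (u_dim sys) (\<lambda>\<zeta> e. control sys c \<zeta> e s)"
    using Suc.IH t by auto
  have d: "aff (d_dim sys t) (\<lambda>\<zeta> e. d_part sys \<zeta> t)" unfolding aff_def d_part_def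
    by (rule affine_vec_fun_slice_left) (rule d_block_bound[OF t])
  have e: "aff (e_dim sys t) (\<lambda>\<zeta> e. e_part sys e t)" unfolding aff_def e_part_def
    by (rule affine_vec_fun_slice_right) (rule e_block_bound[OF t])
  note cl = affine_vec_fun_add affine_vec_fun_diff affine_vec_fun_mult
  have pur: "aff (y_dim sys) (\<lambda>\<zeta> e. purified sys c \<zeta> e t)"
    unfolding purified.simps using IH(1)[of t] IH(2)[of t] d e mats unfolding aff_def by (intro cl) auto
  have pur': "aff (y_dim sys) (\<lambda>\<zeta> e. purified sys c \<zeta> e s)" if "s \<le> t" for s
    using pur IH(3)[of s] that by (cases "s = t") auto
  have "aff (u_dim sys) (\<lambda>\<zeta> e. fst c t + vec (u_dim sys) (\<lambda>a. \<Sum>i\<le>t. (snd c t i *\<^sub>v purified sys c \<zeta> e i) $ a))"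
    unfolding aff_def
  proof (intro affine_vec_fun_add affine_vec_fun_const)
    show "fst c t \<in> carrier_vec (u_dim sys)" using c t by (auto simp: pob_laws_def PiE_iff)
    have H: "snd c t i \<in> carrier_mat (u_dim sys) (y_dim sys)" if "i \<le> t" for i
      using c t that by (auto simp: pob_laws_def PiE_iff)
    show "affine_vec_fun (n_zeta sys) (n_eps sys) (u_dim sys)
      (\<lambda>\<zeta> e. vec (u_dim sys) (\<lambda>a. \<Sum>i\<le>t. (snd c t i *\<^sub>v purified sys c \<zeta> e i) $ a))"
    proof (rule affine_vec_funI[where f = "\<lambda>a \<zeta> e. \<Sum>i\<le>t. (snd c t i *\<^sub>v purified sys c \<zeta> e i) $ a"])
      fix a assume a: "a < u_dim sys"
      show "affine_fun (n_zeta sys) (n_eps sys) (\<lambda>\<zeta> e. \<Sum>i\<le>t. (snd c t i *\<^sub>v purified sys c \<zeta> e i) $ a)"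
        by (intro affine_fun_sum affine_vec_fun_index[OF affine_vec_fun_mult[OF H _] a])
           (use pur' in \<open>auto simp: aff_def\<close>)
    qed simp_all
  qed
  then have con: "aff (u_dim sys) (\<lambda>\<zeta> e. control sys c \<zeta> e t)" by (simp only: control.simps)
  have st: "aff (x_dim sys) (\<lambda>\<zeta> e. state sys c \<zeta> e (Suc t))"
    unfolding state.simps using IH(1)[of t] con d e mats unfolding aff_def by (intro cl) auto
  have mo: "aff (x_dim sys) (\<lambda>\<zeta> e. model_state sys c \<zeta> e (Suc t))"
    unfolding model_state.simps using IH(2)[of t] con mats unfolding aff_def by (intro cl) auto
  show ?case
    using IH pur con st mo by (auto simp: le_Suc_eq less_Suc_eq)
qed

lemma traj_affine:
  assumes wf: "plant_wf sys" and c: "c \<in> pob_laws sys"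
  shows "affine_vec_fun (n_zeta sys) (n_eps sys) (n_w sys) (traj sys c)"
proof -
  have "affine_vec_fun (n_zeta sys) (n_eps sys) (x_dim sys * horizon sys + u_dim sys * horizon sys)
    (\<lambda>\<zeta> e. vstack (\<lambda>t. state sys c \<zeta> e (Suc t)) (horizon sys) @\<^sub>v vstack (\<lambda>t. control sys c \<zeta> e t) (horizon sys))"
    using closed_loop_affine[OF wf c order_refl]
    by (intro affine_vec_fun_append affine_vec_fun_vstack) auto
  moreover have "traj sys c = (\<lambda>\<zeta> e. vstack (\<lambda>t. state sys c \<zeta> e (Suc t)) (horizon sys) @\<^sub>v vstack (\<lambda>t. control sys c \<zeta> e t) (horizon sys))"
    by (intro ext) (simp only: traj_def)
  ultimately show ?thesis by (simp only: n_w_def add_mult_distrib)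
qed

lemma closed_loop_matrices:
  assumes wf: "plant_wf sys" and c: "c \<in> pob_laws sys"
  shows "Zmat sys c \<in> carrier_mat (n_w sys) (Suc (n_zeta sys))"
    and "Emat sys c \<in> carrier_mat (n_w sys) (n_eps sys)"
    and "\<zeta> \<in> carrier_vec (n_zeta sys) \<Longrightarrow> e \<in> carrier_vec (n_eps sys) \<Longrightarrow>
      traj sys c \<zeta> e = Zmat sys c *\<^sub>v aug \<zeta> + Emat sys c *\<^sub>v e"
proof -
  define nz ne nw where "nz = n_zeta sys" and "ne = n_eps sys" and "nw = n_w sys"
  define Q where "Q = (\<lambda>(Z, E). Z \<in> carrier_mat nw (nz + 1) \<and> E \<in> carrier_mat nw ne \<and>
     (\<forall>\<zeta> \<in> carrier_vec nz. \<forall>e \<in> carrier_vec ne. traj sys c \<zeta> e = Z *\<^sub>v aug \<zeta> + E *\<^sub>v e))"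
  have aff: "affine_vec_fun nz ne nw (traj sys c)"
    unfolding nz_def ne_def nw_def by (rule traj_affine[OF wf c])
  have rhs: "(Z *\<^sub>v aug \<zeta> + E *\<^sub>v e) $ i = (\<Sum>j<nz. Z $$ (i, j) * \<zeta> $ j) + (\<Sum>j<ne. E $$ (i, j) * e $ j) + Z $$ (i, nz)"
    if "Z \<in> carrier_mat nw (Suc nz)" "E \<in> carrier_mat nw ne" "\<zeta> \<in> carrier_vec nz" "e \<in> carrier_vec ne" "i < nw" for Z E \<zeta> e i
  proof -
    have "(Z *\<^sub>v aug \<zeta> + E *\<^sub>v e) $ i = (Z *\<^sub>v aug \<zeta>) $ i + (E *\<^sub>v e) $ i" using that by simp
    also have "(E *\<^sub>v e) $ i = (\<Sum>j<ne. E $$ (i, j) * e $ j)" using that by (simp add: scalar_prod_def atLeast0LessThan)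
    finally show ?thesis unfolding mult_aug_index[OF that(1,3,5)] by simp
  qed
  define R where "R i a b k \<longleftrightarrow> (\<forall>\<zeta> \<in> carrier_vec nz. \<forall>e \<in> carrier_vec ne.
      traj sys c \<zeta> e $ i = (\<Sum>j<nz. a j * \<zeta> $ j) + (\<Sum>j<ne. b j * e $ j) + k)" for i a b k
  have "\<exists>a b k. R i a b k" if "i < nw" for i
    using affine_vec_fun_index[OF aff that] unfolding affine_fun_def R_def .
  then obtain a b k where "\<And>i. i < nw \<Longrightarrow> R i (a i) (b i) (k i)" by metis
  then have abk: "traj sys c \<zeta> e $ i = (\<Sum>j<nz. a i j * \<zeta> $ j) + (\<Sum>j<ne. b i j * e $ j) + k i"
    if "i < nw" "\<zeta> \<in> carrier_vec nz" "e \<in> carrier_vec ne" for i \<zeta> e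
    using that unfolding R_def by blast
  define Z0 E0 where "Z0 = mat nw (Suc nz) (\<lambda>(i, j). if j < nz then a i j else k i)" and "E0 = mat nw ne (\<lambda>(i, j). b i j)"
  have Z0: "Z0 \<in> carrier_mat nw (Suc nz)" and E0: "E0 \<in> carrier_mat nw ne" by (simp_all add: Z0_def E0_def)
  have "traj sys c \<zeta> e = Z0 *\<^sub>v aug \<zeta> + E0 *\<^sub>v e" if v: "\<zeta> \<in> carrier_vec nz" "e \<in> carrier_vec ne" for \<zeta> e
  proof (rule eq_vecI)
    have tc: "traj sys c \<zeta> e \<in> carrier_vec nw" by (rule affine_vec_fun_carrier[OF aff v])
    show "dim_vec (traj sys c \<zeta> e) = dim_vec (Z0 *\<^sub>v aug \<zeta> + E0 *\<^sub>v e)" using tc E0 by simp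
    fix i assume "i < dim_vec (Z0 *\<^sub>v aug \<zeta> + E0 *\<^sub>v e)"
    then have i: "i < nw" using E0 by simp
    show "traj sys c \<zeta> e $ i = (Z0 *\<^sub>v aug \<zeta> + E0 *\<^sub>v e) $ i"
      unfolding abk[OF i v] rhs[OF Z0 E0 v i] using i by (simp add: Z0_def E0_def)
  qed
  then have ex: "Q (Z0, E0)" using Z0 E0 by (simp add: Q_def)
  have uniq: "(Z, E) = (Z', E')" if q: "Q (Z, E)" and q': "Q (Z', E')" for Z E Z' E'
  proof -
    have c1: "Z \<in> carrier_mat nw (Suc nz)" "E \<in> carrier_mat nw ne" "Z' \<in> carrier_mat nw (Suc nz)" "E' \<in> carrier_mat nw ne"
      using q q' by (auto simp: Q_def)
    have eq: "(\<Sum>j<nz. Z $$ (i, j) * \<zeta> $ j) + (\<Sum>j<ne. E $$ (i, j) * e $ j) + Z $$ (i, nz)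
      = (\<Sum>j<nz. Z' $$ (i, j) * \<zeta> $ j) + (\<Sum>j<ne. E' $$ (i, j) * e $ j) + Z' $$ (i, nz)"
      if "\<zeta> \<in> carrier_vec nz" "e \<in> carrier_vec ne" "i < nw" for \<zeta> e i
      using q q' that unfolding rhs[OF c1(1,2) that, symmetric] rhs[OF c1(3,4) that, symmetric] by (simp add: Q_def)
    have Zeq: "(\<Sum>j<nz. Z $$ (i, j) * \<zeta> $ j) + Z $$ (i, nz) = (\<Sum>j<nz. Z' $$ (i, j) * \<zeta> $ j) + Z' $$ (i, nz)"
      if "i < nw" "\<zeta> \<in> carrier_vec nz" for i \<zeta> using eq[OF that(2) zero_carrier_vec[of ne] that(1)] by simp
    have last: "Z $$ (i, nz) = Z' $$ (i, nz)" if "i < nw" for i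
      using affine_coeffs_unique(1)[of nz, OF Zeq[OF that]] .
    have "Z $$ (i, j) = Z' $$ (i, j)" if "i < nw" "j < nz" for i j
      using affine_coeffs_unique(2)[of nz, OF Zeq[OF that(1)] that(2)] .
    then have "Z = Z'" using c1 last by (intro eq_matI) (auto simp: less_Suc_eq)
    have Eeq: "(\<Sum>j<ne. E $$ (i, j) * e $ j) + Z $$ (i, nz) = (\<Sum>j<ne. E' $$ (i, j) * e $ j) + Z' $$ (i, nz)"
      if "i < nw" "e \<in> carrier_vec ne" for i e using eq[OF zero_carrier_vec[of nz] that(2,1)] by simp
    have "E $$ (i, j) = E' $$ (i, j)" if "i < nw" "j < ne" for i j
      using affine_coeffs_unique(2)[of ne, OF Eeq[OF that(1)] that(2)] .
    then have "E = E'" using c1 by (intro eq_matI) auto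
    show ?thesis using \<open>Z = Z'\<close> \<open>E = E'\<close> by simp
  qed
  have "\<exists>!p. Q p" using ex uniq by (metis prod.collapse)
  then have "Q (THE p. Q p)" by (rule theI')
  moreover have "traj_mats sys c = (THE p. Q p)"
    unfolding traj_mats_def Q_def nz_def ne_def nw_def ..
  ultimately have "Q (Zmat sys c, Emat sys c)" by (simp add: Zmat_def Emat_def)
  then show "Zmat sys c \<in> carrier_mat (n_w sys) (Suc (n_zeta sys))"
    and "Emat sys c \<in> carrier_mat (n_w sys) (n_eps sys)"
    and "\<zeta> \<in> carrier_vec (n_zeta sys) \<Longrightarrow> e \<in> carrier_vec (n_eps sys) \<Longrightarrow>
      traj sys c \<zeta> e = Zmat sys c *\<^sub>v aug \<zeta> + Emat sys c *\<^sub>v e"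
    by (auto simp: Q_def nz_def ne_def nw_def)
qed

section \<open>Moments of the trajectory\<close>

lemma zero_mean_with_covD:
  assumes "zero_mean_with_cov M eps n Cov"
  shows "\<omega> \<in> space M \<Longrightarrow> eps \<omega> \<in> carrier_vec n" and "Cov \<in> carrier_mat n n"
    and "i < n \<Longrightarrow> integrable M (\<lambda>\<omega>. eps \<omega> $ i)" and "i < n \<Longrightarrow> (\<integral>\<omega>. eps \<omega> $ i \<partial>M) = 0"
    and "i < n \<Longrightarrow> j < n \<Longrightarrow> integrable M (\<lambda>\<omega>. eps \<omega> $ i * eps \<omega> $ j)"
    and "i < n \<Longrightarrow> j < n \<Longrightarrow> (\<integral>\<omega>. eps \<omega> $ i * eps \<omega> $ j \<partial>M) = Cov $$ (i, j)"
  using assms by (simp_all add: zero_mean_with_cov_def)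

lemma integral_affine:
  assumes "prob_space M" and zm: "zero_mean_with_cov M eps n Cov"
  shows "integrable M (\<lambda>\<omega>. k + (\<Sum>i<n. g i * eps \<omega> $ i))"
    and "(\<integral>\<omega>. k + (\<Sum>i<n. g i * eps \<omega> $ i) \<partial>M) = k"
proof -
  interpret prob_space M by fact
  have int: "integrable M (\<lambda>\<omega>. \<Sum>i<n. g i * eps \<omega> $ i)"
    by (intro Bochner_Integration.integrable_sum integrable_mult_right zero_mean_with_covD(3)[OF zm]) simp
  then show "integrable M (\<lambda>\<omega>. k + (\<Sum>i<n. g i * eps \<omega> $ i))" by simp
  have "(\<integral>\<omega>. (\<Sum>i<n. g i * eps \<omega> $ i) \<partial>M) = (\<Sum>i<n. \<integral>\<omega>. g i * eps \<omega> $ i \<partial>M)"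
    by (intro Bochner_Integration.integral_sum integrable_mult_right zero_mean_with_covD(3)[OF zm]) simp
  also have "\<dots> = 0" by (intro sum.neutral) (simp add: zero_mean_with_covD(4)[OF zm])
  finally have "(\<integral>\<omega>. (\<Sum>i<n. g i * eps \<omega> $ i) \<partial>M) = 0" .
  then show "(\<integral>\<omega>. k + (\<Sum>i<n. g i * eps \<omega> $ i) \<partial>M) = k"
    using int by (simp add: prob_space)
qed

lemma integral_quadratic:
  assumes zm: "zero_mean_with_cov M eps n Cov"
  shows "integrable M (\<lambda>\<omega>. \<Sum>i<n. \<Sum>j<n. a i j * (eps \<omega> $ i * eps \<omega> $ j))"
    and "(\<integral>\<omega>. (\<Sum>i<n. \<Sum>j<n. a i j * (eps \<omega> $ i * eps \<omega> $ j)) \<partial>M) = (\<Sum>i<n. \<Sum>j<n. a i j * Cov $$ (i, j))"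
proof -
  have int: "integrable M (\<lambda>\<omega>. a i j * (eps \<omega> $ i * eps \<omega> $ j))" if "i < n" "j < n" for i j
    using zero_mean_with_covD(5)[OF zm that] by simp
  show "integrable M (\<lambda>\<omega>. \<Sum>i<n. \<Sum>j<n. a i j * (eps \<omega> $ i * eps \<omega> $ j))"
    by (intro Bochner_Integration.integrable_sum int) simp_all
  have "(\<integral>\<omega>. (\<Sum>i<n. \<Sum>j<n. a i j * (eps \<omega> $ i * eps \<omega> $ j)) \<partial>M)
    = (\<Sum>i<n. \<integral>\<omega>. (\<Sum>j<n. a i j * (eps \<omega> $ i * eps \<omega> $ j)) \<partial>M)"
    by (intro Bochner_Integration.integral_sum Bochner_Integration.integrable_sum int) simp_all
  also have "\<dots> = (\<Sum>i<n. \<Sum>j<n. \<integral>\<omega>. a i j * (eps \<omega> $ i * eps \<omega> $ j) \<partial>M)"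
    by (intro sum.cong refl Bochner_Integration.integral_sum int) simp_all
  also have "\<dots> = (\<Sum>i<n. \<Sum>j<n. a i j * Cov $$ (i, j))"
    by (intro sum.cong refl) (simp add: zero_mean_with_covD(6)[OF zm])
  finally show "(\<integral>\<omega>. (\<Sum>i<n. \<Sum>j<n. a i j * (eps \<omega> $ i * eps \<omega> $ j)) \<partial>M) = (\<Sum>i<n. \<Sum>j<n. a i j * Cov $$ (i, j))" .
qed

text \<open>
  The form of the covariance matrix at \<open>f\<close> is the expectation of \<open>(\<Sum>\<^sub>i f\<^sub>i \<epsilon>\<^sub>i)\<^sup>2\<close>.
\<close>

lemma covariance_psd:
  assumes zm: "zero_mean_with_cov M eps n Cov"
  shows "psd n Cov"
  unfolding psd_iff_bilin
proof (intro conjI allI)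
  show "Cov \<in> sym_mats n"
  proof (rule sym_matsI[OF zero_mean_with_covD(2)[OF zm]])
    fix i j assume "i < n" "j < n"
    then show "Cov $$ (i, j) = Cov $$ (j, i)"
      by (simp add: zero_mean_with_covD(6)[OF zm, symmetric] mult.commute)
  qed
  fix f :: "nat \<Rightarrow> real"
  have "qform n Cov f = (\<Sum>i<n. \<Sum>j<n. (f i * f j) * Cov $$ (i, j))"
    by (simp add: bilin_def mult_ac)
  also have "\<dots> = (\<integral>\<omega>. (\<Sum>i<n. \<Sum>j<n. (f i * f j) * (eps \<omega> $ i * eps \<omega> $ j)) \<partial>M)"
    by (rule integral_quadratic(2)[OF zm, symmetric])
  also have "\<dots> = (\<integral>\<omega>. (\<Sum>i<n. f i * eps \<omega> $ i)\<^sup>2 \<partial>M)"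
    by (simp add: power2_eq_square sum_product mult_ac)
  also have "0 \<le> \<dots>" by (rule Bochner_Integration.integral_nonneg) simp
  finally show "0 \<le> qform n Cov f" .
qed

lemma mean_traj_eq:
  assumes wf: "plant_wf sys" and c: "c \<in> pob_laws sys" and pr: "prob_space M"
    and zm: "zero_mean_with_cov M eps (n_eps sys) Cov" and z: "\<zeta> \<in> carrier_vec (n_zeta sys)"
  shows "mean_traj M eps sys c \<zeta> = Zmat sys c *\<^sub>v aug \<zeta>"
proof (rule eq_vecI)
  note tm = closed_loop_matrices[OF wf c]
  show "dim_vec (mean_traj M eps sys c \<zeta>) = dim_vec (Zmat sys c *\<^sub>v aug \<zeta>)"
    using tm(1) by (simp add: mean_traj_def)
  fix j assume "j < dim_vec (Zmat sys c *\<^sub>v aug \<zeta>)"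
  then have j: "j < n_w sys" using tm(1) by simp
  have "mean_traj M eps sys c \<zeta> $ j = (\<integral>\<omega>. traj sys c \<zeta> (eps \<omega>) $ j \<partial>M)"
    using j by (simp add: mean_traj_def)
  also have "\<dots> = (\<integral>\<omega>. (Zmat sys c *\<^sub>v aug \<zeta>) $ j + (\<Sum>i<n_eps sys. Emat sys c $$ (j, i) * eps \<omega> $ i) \<partial>M)"
  proof (rule Bochner_Integration.integral_cong[OF refl])
    fix \<omega> assume w: "\<omega> \<in> space M"
    have e: "eps \<omega> \<in> carrier_vec (n_eps sys)" by (rule zero_mean_with_covD(1)[OF zm w])
    show "traj sys c \<zeta> (eps \<omega>) $ j = (Zmat sys c *\<^sub>v aug \<zeta>) $ j + (\<Sum>i<n_eps sys. Emat sys c $$ (j, i) * eps \<omega> $ i)"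
      unfolding tm(3)[OF z e] using j tm(2) e by (simp add: scalar_prod_def atLeast0LessThan)
  qed
  also have "\<dots> = (Zmat sys c *\<^sub>v aug \<zeta>) $ j" by (rule integral_affine(2)[OF pr zm])
  finally show "mean_traj M eps sys c \<zeta> $ j = (Zmat sys c *\<^sub>v aug \<zeta>) $ j" .
qed

lemma expectation_quadratic:
  assumes pr: "prob_space M" and zm: "zero_mean_with_cov M eps n Cov"
    and A: "A \<in> sym_mats d" and E: "E \<in> carrier_mat d n" and m: "m \<in> carrier_vec d"
  shows "(\<integral>\<omega>. (A *\<^sub>v (m + E *\<^sub>v eps \<omega>)) \<bullet> (m + E *\<^sub>v eps \<omega>) \<partial>M)
    = (A *\<^sub>v m) \<bullet> m + (\<Sum>k<n. \<Sum>l<n. bilin d A (\<lambda>i. E $$ (i, k)) (\<lambda>i. E $$ (i, l)) * Cov $$ (k, l))"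
proof -
  interpret prob_space M by fact
  have Ac: "A \<in> carrier_mat d d" using A by (rule sym_mats_carrier)
  define col where "col k = (\<lambda>i. E $$ (i, k))" for k
  define g where "g k = 2 * bilin d A (($) m) (col k)" for k
  define k0 where "k0 = qform d A (($) m)"
  have quad: "(A *\<^sub>v v) \<bullet> v = qform d A (($) v)" if v: "v \<in> carrier_vec d" for v
  proof -
    have "A *\<^sub>v v \<in> carrier_vec d" using Ac v by simp
    then have "(A *\<^sub>v v) \<bullet> v = v \<bullet> (A *\<^sub>v v)" using v by (rule comm_scalar_prod)
    then show ?thesis using bilin_eq_scalar_prod[OF Ac v v] by simp
  qed
  have expand: "(A *\<^sub>v (m + E *\<^sub>v e)) \<bullet> (m + E *\<^sub>v e)
     = (k0 + (\<Sum>k<n. g k * e $ k)) + (\<Sum>k<n. \<Sum>l<n. bilin d A (col k) (col l) * (e $ k * e $ l))"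
    if e: "e \<in> carrier_vec n" for e
  proof -
    have Ee: "E *\<^sub>v e \<in> carrier_vec d" using E e by simp
    then have me: "m + E *\<^sub>v e \<in> carrier_vec d" using m by simp
    define h where "h = (\<lambda>i. \<Sum>k<n. e $ k * col k i)"
    have "(m + E *\<^sub>v e) $ i = m $ i + h i" if "i < d" for i
      using that E e by (simp add: h_def col_def scalar_prod_def atLeast0LessThan mult.commute)
    then have "(A *\<^sub>v (m + E *\<^sub>v e)) \<bullet> (m + E *\<^sub>v e) = qform d A (\<lambda>i. m $ i + h i)"
      unfolding quad[OF me] by (intro bilin_cong)
    also have "\<dots> = k0 + 2 * bilin d A (($) m) h + qform d A h"
      by (simp add: bilin_square_add[OF A] k0_def)
    also have "2 * bilin d A (($) m) h = (\<Sum>k<n. g k * e $ k)"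
      unfolding h_def bilin_sum_right bilin_scale_right g_def by (simp add: sum_distrib_left mult_ac)
    also have "qform d A h = (\<Sum>k<n. \<Sum>l<n. bilin d A (col k) (col l) * (e $ k * e $ l))"
      unfolding h_def bilin_sum_right bilin_sum_left bilin_scale_right bilin_scale_left
      by (simp add: sum_distrib_left mult_ac bilin_commute[OF A])
    finally show ?thesis .
  qed
  have "(\<integral>\<omega>. (A *\<^sub>v (m + E *\<^sub>v eps \<omega>)) \<bullet> (m + E *\<^sub>v eps \<omega>) \<partial>M)
    = (\<integral>\<omega>. (k0 + (\<Sum>k<n. g k * eps \<omega> $ k))
        + (\<Sum>k<n. \<Sum>l<n. bilin d A (col k) (col l) * (eps \<omega> $ k * eps \<omega> $ l)) \<partial>M)"
    by (rule Bochner_Integration.integral_cong[OF refl]) (rule expand[OF zero_mean_with_covD(1)[OF zm]])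
  also have "\<dots> = k0 + (\<Sum>k<n. \<Sum>l<n. bilin d A (col k) (col l) * Cov $$ (k, l))"
    using integral_affine[OF pr zm, of k0 g] integral_quadratic[OF zm, of "\<lambda>k l. bilin d A (col k) (col l)"]
    by (subst Bochner_Integration.integral_add) auto
  finally show ?thesis unfolding quad[OF m] by (simp add: k0_def col_def)
qed

text \<open>
  Both sides are the trace of \<open>A E Cov E\<^sup>T\<close>.
\<close>

lemma frob_norm_sqrt_product:
  assumes A: "psd d A" and Cov: "psd n Cov" and E: "E \<in> carrier_mat d n"
  shows "(frob_norm (psd_sqrt d A * E * psd_sqrt n Cov))\<^sup>2
    = (\<Sum>k<n. \<Sum>l<n. bilin d A (\<lambda>i. E $$ (i, k)) (\<lambda>i. E $$ (i, l)) * Cov $$ (k, l))"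
proof -
  define L R where "L = psd_sqrt d A" and "R = psd_sqrt n Cov"
  have L: "psd d L" "L * L = A" and R: "psd n R" "R * R = Cov"
    unfolding L_def R_def by (rule psd_sqrt_correct[OF A] psd_sqrt_correct[OF Cov])+
  have Ls: "L \<in> sym_mats d" and Rs: "R \<in> sym_mats n" using L R by (auto simp: psd_def)
  have Lc: "L \<in> carrier_mat d d" and Rc: "R \<in> carrier_mat n n" using L R by (auto intro: psd_carrier)
  define h where "h k a = (\<Sum>i<d. L $$ (a, i) * E $$ (i, k))" for k a
  have entry: "(L * E * R) $$ (a, j) = (\<Sum>k<n. h k a * R $$ (k, j))" if "a < d" "j < n" for a j
    using that Lc Rc E by (simp add: h_def scalar_prod_def atLeast0LessThan del: assoc_mult_mat)
  have A_entry: "A $$ (i, j) = (\<Sum>a<d. L $$ (a, i) * L $$ (a, j))" if "i < d" "j < d" for i j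
    using that Lc by (simp add: L(2)[symmetric] scalar_prod_def atLeast0LessThan sym_mats_entry[OF Ls, of i])
  have Cov_entry: "Cov $$ (k, l) = (\<Sum>j<n. R $$ (k, j) * R $$ (l, j))" if "k < n" "l < n" for k l
    using that Rc by (simp add: R(2)[symmetric] scalar_prod_def atLeast0LessThan sym_mats_entry[OF Rs, of _ l])
  have bil: "bilin d A (\<lambda>i. E $$ (i, k)) (\<lambda>i. E $$ (i, l)) = (\<Sum>a<d. h k a * h l a)" for k l
  proof -
    have "bilin d A (\<lambda>i. E $$ (i, k)) (\<lambda>i. E $$ (i, l))
      = (\<Sum>i<d. \<Sum>j<d. \<Sum>a<d. (L $$ (a, i) * E $$ (i, k)) * (L $$ (a, j) * E $$ (j, l)))"
      unfolding bilin_def by (intro sum.cong refl) (simp add: A_entry sum_distrib_left sum_distrib_right mult_ac)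
    also have "\<dots> = (\<Sum>i<d. \<Sum>a<d. \<Sum>j<d. (L $$ (a, i) * E $$ (i, k)) * (L $$ (a, j) * E $$ (j, l)))"
      by (intro sum.cong refl sum.swap)
    also have "\<dots> = (\<Sum>a<d. \<Sum>i<d. \<Sum>j<d. (L $$ (a, i) * E $$ (i, k)) * (L $$ (a, j) * E $$ (j, l)))"
      by (rule sum.swap)
    also have "\<dots> = (\<Sum>a<d. h k a * h l a)" unfolding h_def sum_product ..
    finally show ?thesis .
  qed
  have "(frob_norm (L * E * R))\<^sup>2 = (\<Sum>a<d. \<Sum>j<n. ((L * E * R) $$ (a, j))\<^sup>2)"
    using Lc Rc by (simp add: frob_norm_def sum_nonneg)
  also have "\<dots> = (\<Sum>a<d. \<Sum>j<n. \<Sum>k<n. \<Sum>l<n. (h k a * h l a) * (R $$ (k, j) * R $$ (l, j)))"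
    by (intro sum.cong refl) (simp add: entry power2_eq_square sum_product mult_ac)
  also have "\<dots> = (\<Sum>a<d. \<Sum>k<n. \<Sum>j<n. \<Sum>l<n. (h k a * h l a) * (R $$ (k, j) * R $$ (l, j)))"
    by (intro sum.cong refl sum.swap)
  also have "\<dots> = (\<Sum>a<d. \<Sum>k<n. \<Sum>l<n. \<Sum>j<n. (h k a * h l a) * (R $$ (k, j) * R $$ (l, j)))"
    by (intro sum.cong refl sum.swap)
  also have "\<dots> = (\<Sum>a<d. \<Sum>k<n. \<Sum>l<n. (h k a * h l a) * Cov $$ (k, l))"
    by (intro sum.cong refl) (simp add: Cov_entry sum_distrib_left)
  also have "\<dots> = (\<Sum>k<n. \<Sum>a<d. \<Sum>l<n. (h k a * h l a) * Cov $$ (k, l))" by (rule sum.swap)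
  also have "\<dots> = (\<Sum>k<n. \<Sum>l<n. \<Sum>a<d. (h k a * h l a) * Cov $$ (k, l))" by (intro sum.cong refl sum.swap)
  also have "\<dots> = (\<Sum>k<n. \<Sum>l<n. bilin d A (\<lambda>i. E $$ (i, k)) (\<lambda>i. E $$ (i, l)) * Cov $$ (k, l))"
    unfolding bil by (simp add: sum_distrib_right)
  finally show ?thesis unfolding L_def R_def .
qed

text \<open>
  The stochastic part has mean zero, so the expectation is the value at the mean
  trajectory plus a variance that does not depend on \<open>\<zeta>\<close>.
\<close>

lemma expected_quad_traj:
  assumes wf: "plant_wf sys" and c: "c \<in> pob_laws sys" and pr: "prob_space M"
    and zm: "zero_mean_with_cov M eps (n_eps sys) Cov" and z: "\<zeta> \<in> carrier_vec (n_zeta sys)"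
    and A: "psd (n_w sys) A" and b: "\<beta> \<in> carrier_vec (n_w sys)"
  shows "(\<integral>\<omega>. (A *\<^sub>v (traj sys c \<zeta> (eps \<omega>) - \<beta>)) \<bullet> (traj sys c \<zeta> (eps \<omega>) - \<beta>) \<partial>M)
    = (A *\<^sub>v (Zmat sys c *\<^sub>v aug \<zeta> - \<beta>)) \<bullet> (Zmat sys c *\<^sub>v aug \<zeta> - \<beta>)
      + (frob_norm (psd_sqrt (n_w sys) A * Emat sys c * psd_sqrt (n_eps sys) Cov))\<^sup>2"
proof -
  note tm = closed_loop_matrices[OF wf c]
  define m where "m = Zmat sys c *\<^sub>v aug \<zeta> - \<beta>"
  have Zc: "Zmat sys c *\<^sub>v aug \<zeta> \<in> carrier_vec (n_w sys)"
    using tm(1) aug_carrier[OF z] by (rule mult_mat_vec_carrier)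
  have m: "m \<in> carrier_vec (n_w sys)" using Zc b by (simp add: m_def)
  have shift: "traj sys c \<zeta> (eps \<omega>) - \<beta> = m + Emat sys c *\<^sub>v eps \<omega>" if "\<omega> \<in> space M" for \<omega>
  proof -
    have e: "eps \<omega> \<in> carrier_vec (n_eps sys)" by (rule zero_mean_with_covD(1)[OF zm that])
    show ?thesis unfolding tm(3)[OF z e] m_def using Zc b tm(2) e by (intro eq_vecI) auto
  qed
  have As: "A \<in> sym_mats (n_w sys)" using A by (simp add: psd_def)
  have "(\<integral>\<omega>. (A *\<^sub>v (traj sys c \<zeta> (eps \<omega>) - \<beta>)) \<bullet> (traj sys c \<zeta> (eps \<omega>) - \<beta>) \<partial>M)
    = (\<integral>\<omega>. (A *\<^sub>v (m + Emat sys c *\<^sub>v eps \<omega>)) \<bullet> (m + Emat sys c *\<^sub>v eps \<omega>) \<partial>M)"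
    by (rule Bochner_Integration.integral_cong[OF refl]) (simp add: shift)
  also have "\<dots> = (A *\<^sub>v m) \<bullet> m + (frob_norm (psd_sqrt (n_w sys) A * Emat sys c * psd_sqrt (n_eps sys) Cov))\<^sup>2"
    unfolding expectation_quadratic[OF pr zm As tm(2) m] frob_norm_sqrt_product[OF A covariance_psd[OF zm] tm(2)] ..
  finally show ?thesis unfolding m_def .
qed

section \<open>The linear parts of the constraints\<close>

lemma scalar_prod_mult_aug:
  assumes Z: "Z \<in> carrier_mat d (Suc n)" and v: "v \<in> carrier_vec d" and z: "\<zeta> \<in> carrier_vec n"
  shows "v \<bullet> (Z *\<^sub>v aug \<zeta>) = (\<Sum>j<n. (\<Sum>i<d. v $ i * Z $$ (i, j)) * \<zeta> $ j) + (\<Sum>i<d. v $ i * Z $$ (i, n))"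
proof -
  have "v \<bullet> (Z *\<^sub>v aug \<zeta>) = (\<Sum>i<d. v $ i * ((\<Sum>j<n. Z $$ (i, j) * \<zeta> $ j) + Z $$ (i, n)))"
    using Z by (auto simp: scalar_prod_def atLeast0LessThan mult_aug_index[OF Z z] simp del: index_mult_mat_vec intro!: sum.cong)
  also have "\<dots> = (\<Sum>i<d. \<Sum>j<n. v $ i * Z $$ (i, j) * \<zeta> $ j) + (\<Sum>i<d. v $ i * Z $$ (i, n))"
    by (simp add: distrib_left sum.distrib sum_distrib_left mult.assoc)
  also have "(\<Sum>i<d. \<Sum>j<n. v $ i * Z $$ (i, j) * \<zeta> $ j) = (\<Sum>j<n. \<Sum>i<d. v $ i * Z $$ (i, j) * \<zeta> $ j)"
    by (rule sum.swap)
  finally show ?thesis by (simp add: sum_distrib_right)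
qed

text \<open>
  Stated for the shape of definite description that defines \<open>pq_coeffs\<close>, which the quadratic
  and the linear constraints instantiate with different functions.
\<close>

lemma affine_coeffs_THE:
  fixes F :: "real vec \<Rightarrow> real"
  assumes F: "\<And>\<zeta>. \<zeta> \<in> carrier_vec n \<Longrightarrow> F \<zeta> = (\<Sum>j<n. a j * \<zeta> $ j) + k"
    and pq: "pq = (THE (p, q). p \<in> carrier_vec n \<and> (\<forall>\<zeta> \<in> carrier_vec n. F \<zeta> = 2 * (p \<bullet> \<zeta>) + q))"
  shows "fst pq \<in> carrier_vec n" and "\<zeta> \<in> carrier_vec n \<Longrightarrow> F \<zeta> = 2 * (fst pq \<bullet> \<zeta>) + snd pq"
proof -
  define Q where "Q = (\<lambda>(p, q). p \<in> carrier_vec n \<and> (\<forall>\<zeta> \<in> carrier_vec n. F \<zeta> = 2 * (p \<bullet> \<zeta>) + q))"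
  have dot: "2 * (p \<bullet> \<zeta>) = (\<Sum>j<n. 2 * p $ j * \<zeta> $ j)" if "p \<in> carrier_vec n" "\<zeta> \<in> carrier_vec n" for p \<zeta> :: "real vec"
    using that by (simp add: scalar_prod_def atLeast0LessThan sum_distrib_left mult.assoc)
  have ex: "Q (vec n (\<lambda>j. a j / 2), k)"
    unfolding Q_def by (auto simp: F dot)
  have uniq: "pq1 = pq2" if q1: "Q pq1" and q2: "Q pq2" for pq1 pq2
  proof -
    obtain p1 k1 p2 k2 where e: "pq1 = (p1, k1)" "pq2 = (p2, k2)" by (metis prod.collapse)
    have p: "p1 \<in> carrier_vec n" "p2 \<in> carrier_vec n" using q1 q2 by (auto simp: Q_def e)
    have eq: "(\<Sum>j<n. 2 * p1 $ j * \<zeta> $ j) + k1 = (\<Sum>j<n. 2 * p2 $ j * \<zeta> $ j) + k2" if z: "\<zeta> \<in> carrier_vec n" for \<zeta>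
      using q1 q2 z unfolding dot[OF p(1) z, symmetric] dot[OF p(2) z, symmetric] by (auto simp: Q_def e)
    have "k1 = k2" by (rule affine_coeffs_unique(1)[OF eq])
    moreover have "2 * p1 $ i = 2 * p2 $ i" if "i < n" for i by (rule affine_coeffs_unique(2)[OF eq that])
    then have "p1 = p2" using p by (intro eq_vecI) auto
    ultimately show ?thesis by (simp add: e)
  qed
  have "\<exists>!x. Q x" using ex uniq by blast
  then have "Q (THE x. Q x)" by (rule theI')
  then have "Q pq" unfolding pq Q_def .
  then show "fst pq \<in> carrier_vec n" and "\<zeta> \<in> carrier_vec n \<Longrightarrow> F \<zeta> = 2 * (fst pq \<bullet> \<zeta>) + snd pq"
    by (auto simp: Q_def split: prod.splits)
qed

lemma pq_coeffs_lin:
  assumes wf: "plant_wf sys" and c: "c \<in> pob_laws sys" and sp: "specs_wf (n_w sys) sp" and i: "i \<in> I2 sp"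
  shows "p_coeff sys sp i c \<in> carrier_vec (n_zeta sys)"
    and "\<zeta> \<in> carrier_vec (n_zeta sys) \<Longrightarrow>
      lin_a sp i \<bullet> (Zmat sys c *\<^sub>v aug \<zeta>) = 2 * (p_coeff sys sp i c \<bullet> \<zeta>) + q_coeff sys sp i c"
proof -
  have a: "lin_a sp i \<in> carrier_vec (n_w sys)" using sp i by (simp add: specs_wf_def)
  note coeffs = affine_coeffs_THE[where n = "n_zeta sys" and F = "\<lambda>\<zeta>. lin_a sp i \<bullet> (Zmat sys c *\<^sub>v aug \<zeta>)"
      and pq = "pq_coeffs sys sp i c", OF scalar_prod_mult_aug[OF closed_loop_matrices(1)[OF wf c] a]]
  have "pq_coeffs sys sp i c = (THE (p, q). p \<in> carrier_vec (n_zeta sys) \<and>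
     (\<forall>\<zeta> \<in> carrier_vec (n_zeta sys). lin_a sp i \<bullet> (Zmat sys c *\<^sub>v aug \<zeta>) = 2 * (p \<bullet> \<zeta>) + q))"
    using i by (simp add: pq_coeffs_def)
  from coeffs[OF _ this]
  show "p_coeff sys sp i c \<in> carrier_vec (n_zeta sys)"
    and "\<zeta> \<in> carrier_vec (n_zeta sys) \<Longrightarrow>
      lin_a sp i \<bullet> (Zmat sys c *\<^sub>v aug \<zeta>) = 2 * (p_coeff sys sp i c \<bullet> \<zeta>) + q_coeff sys sp i c"
    by (simp_all add: p_coeff_def q_coeff_def)
qed

lemma pq_coeffs_quad:
  assumes wf: "plant_wf sys" and c: "c \<in> pob_laws sys" and sp: "specs_wf (n_w sys) sp" and i: "i \<in> I1 sp \<union> I3 sp"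
  shows "p_coeff sys sp i c \<in> carrier_vec (n_zeta sys)"
    and "\<zeta> \<in> carrier_vec (n_zeta sys) \<Longrightarrow>
      - 2 * (center sp i \<bullet> (quadA sp i *\<^sub>v (Zmat sys c *\<^sub>v aug \<zeta>))) = 2 * (p_coeff sys sp i c \<bullet> \<zeta>) + q_coeff sys sp i c"
proof -
  have b: "center sp i \<in> carrier_vec (n_w sys)" and A: "psd (n_w sys) (quadA sp i)" using sp i by (auto simp: specs_wf_def)
  have i2: "i \<notin> I2 sp" using sp i by (auto simp: specs_wf_def)
  note Ac = psd_carrier[OF A]
  define v where "v = quadA sp i *\<^sub>v center sp i"
  have v: "v \<in> carrier_vec (n_w sys)" using Ac b by (simp add: v_def)
  have move: "center sp i \<bullet> (quadA sp i *\<^sub>v (Zmat sys c *\<^sub>v aug \<zeta>)) = v \<bullet> (Zmat sys c *\<^sub>v aug \<zeta>)"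
    if z: "\<zeta> \<in> carrier_vec (n_zeta sys)" for \<zeta>
    using transpose_vec_mult_scalar[OF Ac mult_mat_vec_carrier[OF closed_loop_matrices(1)[OF wf c] aug_carrier[OF z]] b]
    by (simp add: v_def psd_transpose[OF A])
  have scale: "- 2 * ((\<Sum>j<n. C j * f j) + k) = (\<Sum>j<n. (- 2 * C j) * f j) + (- 2 * k)"
    for C f :: "nat \<Rightarrow> real" and n k
    by (simp add: distrib_left sum_distrib_left mult.assoc)
  have F: "- 2 * (center sp i \<bullet> (quadA sp i *\<^sub>v (Zmat sys c *\<^sub>v aug \<zeta>)))
    = (\<Sum>j<n_zeta sys. (- 2 * (\<Sum>i<n_w sys. v $ i * Zmat sys c $$ (i, j))) * \<zeta> $ j) + (- 2 * (\<Sum>i<n_w sys. v $ i * Zmat sys c $$ (i, n_zeta sys)))"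
    if z: "\<zeta> \<in> carrier_vec (n_zeta sys)" for \<zeta>
    unfolding move[OF z] scalar_prod_mult_aug[OF closed_loop_matrices(1)[OF wf c] v z]
    by (rule scale)
  have "pq_coeffs sys sp i c = (THE (p, q). p \<in> carrier_vec (n_zeta sys) \<and>
     (\<forall>\<zeta> \<in> carrier_vec (n_zeta sys). - 2 * (center sp i \<bullet> (quadA sp i *\<^sub>v (Zmat sys c *\<^sub>v aug \<zeta>))) = 2 * (p \<bullet> \<zeta>) + q))"
    using i2 by (simp add: pq_coeffs_def)
  from affine_coeffs_THE[OF F this]
  show "p_coeff sys sp i c \<in> carrier_vec (n_zeta sys)"
    and "\<zeta> \<in> carrier_vec (n_zeta sys) \<Longrightarrow>
      - 2 * (center sp i \<bullet> (quadA sp i *\<^sub>v (Zmat sys c *\<^sub>v aug \<zeta>))) = 2 * (p_coeff sys sp i c \<bullet> \<zeta>) + q_coeff sys sp i c"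
    by (simp_all add: p_coeff_def q_coeff_def)
qed

lemma quad_value:
  assumes wf: "plant_wf sys" and c: "c \<in> pob_laws sys" and sp: "specs_wf (n_w sys) sp" and i: "i \<in> I1 sp \<union> I3 sp"
    and z: "\<zeta> \<in> carrier_vec (n_zeta sys)"
  shows "(quadA sp i *\<^sub>v (Zmat sys c *\<^sub>v aug \<zeta> - center sp i)) \<bullet> (Zmat sys c *\<^sub>v aug \<zeta> - center sp i)
    = aug \<zeta> \<bullet> ((transpose_mat (Zmat sys c) * quadA sp i * Zmat sys c) *\<^sub>v aug \<zeta>)
      + 2 * (p_coeff sys sp i c \<bullet> \<zeta>) + q_coeff sys sp i c + r_const sp i"
proof -
  have b: "center sp i \<in> carrier_vec (n_w sys)" and A: "psd (n_w sys) (quadA sp i)" using sp i by (auto simp: specs_wf_def)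
  note Ac = psd_carrier[OF A]
  define w where "w = Zmat sys c *\<^sub>v aug \<zeta>"
  have w: "w \<in> carrier_vec (n_w sys)"
    unfolding w_def by (rule mult_mat_vec_carrier[OF closed_loop_matrices(1)[OF wf c] aug_carrier[OF z]])
  have Aw: "quadA sp i *\<^sub>v w \<in> carrier_vec (n_w sys)" and Ab: "quadA sp i *\<^sub>v center sp i \<in> carrier_vec (n_w sys)"
    using Ac w b by auto
  have wAb: "(quadA sp i *\<^sub>v center sp i) \<bullet> w = center sp i \<bullet> (quadA sp i *\<^sub>v w)"
    using transpose_vec_mult_scalar[OF Ac w b] by (simp add: psd_transpose[OF A])
  have wb: "w - center sp i \<in> carrier_vec (n_w sys)" using w b by simp
  have "(quadA sp i *\<^sub>v (w - center sp i)) \<bullet> (w - center sp i)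
    = (quadA sp i *\<^sub>v w - quadA sp i *\<^sub>v center sp i) \<bullet> (w - center sp i)"
    by (simp add: mult_minus_distrib_mat_vec[OF Ac w b])
  also have "\<dots> = (quadA sp i *\<^sub>v w) \<bullet> w - (quadA sp i *\<^sub>v w) \<bullet> center sp i
      - ((quadA sp i *\<^sub>v center sp i) \<bullet> w - (quadA sp i *\<^sub>v center sp i) \<bullet> center sp i)"
    by (simp add: minus_scalar_prod_distrib[OF Aw Ab wb] scalar_prod_minus_distrib[OF Aw w b] scalar_prod_minus_distrib[OF Ab w b])
  also have "\<dots> = w \<bullet> (quadA sp i *\<^sub>v w) - 2 * (center sp i \<bullet> (quadA sp i *\<^sub>v w)) + r_const sp i"
    using comm_scalar_prod[OF Aw w] comm_scalar_prod[OF Aw b] comm_scalar_prod[OF Ab b] wAb by (simp add: r_const_def)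
  also have "- 2 * (center sp i \<bullet> (quadA sp i *\<^sub>v w)) = 2 * (p_coeff sys sp i c \<bullet> \<zeta>) + q_coeff sys sp i c"
    unfolding w_def by (rule pq_coeffs_quad(2)[OF wf c sp i z])
  then have "w \<bullet> (quadA sp i *\<^sub>v w) - 2 * (center sp i \<bullet> (quadA sp i *\<^sub>v w)) + r_const sp i
    = w \<bullet> (quadA sp i *\<^sub>v w) + 2 * (p_coeff sys sp i c \<bullet> \<zeta>) + q_coeff sys sp i c + r_const sp i" by simp
  also have "w \<bullet> (quadA sp i *\<^sub>v w) = aug \<zeta> \<bullet> ((transpose_mat (Zmat sys c) * quadA sp i * Zmat sys c) *\<^sub>v aug \<zeta>)"
    unfolding w_def by (rule scalar_prod_congruence[OF Ac closed_loop_matrices(1)[OF wf c] aug_carrier[OF z], symmetric])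
  finally show ?thesis unfolding w_def .
qed

section \<open>Robust constraints and their certificates\<close>

lemma supp_T_bdd:
  assumes "ellitope_wf nz el"
  shows "bdd_above ((\<lambda>t. inner l t) ` ell_T el)"
proof -
  have "compact (ell_T el)" using assms by (simp add: ellitope_wf_def)
  then have "compact ((\<lambda>t. inner l t) ` ell_T el)" by (intro compact_continuous_image continuous_intros)
  then show ?thesis by (intro bounded_imp_bdd_above compact_imp_bounded)
qed

lemma supp_T_upper: "ellitope_wf nz el \<Longrightarrow> t \<in> ell_T el \<Longrightarrow> inner l t \<le> supp_T el l"
  unfolding supp_T_def by (rule cSUP_upper[OF _ supp_T_bdd])

lemma supp_T_least:
  assumes "ellitope_wf nz el" "\<And>t. t \<in> ell_T el \<Longrightarrow> inner l t \<le> u"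
  shows "supp_T el l \<le> u"
proof -
  have "ell_T el \<noteq> {}" using ellitope_positive_point[OF assms(1)] by blast
  then show ?thesis unfolding supp_T_def by (rule cSUP_least) (rule assms(2))
qed

text \<open>
  The maximum in \<open>Qbar\<close> is a value of the support function, so that only the latter has to be
  studied.
\<close>

lemma supp_T_axis: "(SUP t\<in>ell_T el. t $h k) = supp_T el (axis k 1)"
  unfolding supp_T_def by (simp add: inner_axis')

lemma weighted_S_sym:
  assumes "ellitope_wf nz el"
  shows "weighted_S el l \<in> sym_mats (ell_dim el)"
proof (rule sym_matsI)
  show "weighted_S el l \<in> carrier_mat (ell_dim el) (ell_dim el)" by (simp add: weighted_S_def)
  fix i j assume ij: "i < ell_dim el" "j < ell_dim el"
  have "ell_S el k $$ (i, j) = ell_S el k $$ (j, i)" for k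
    using assms ij by (intro sym_mats_entry[of _ "ell_dim el"]) (auto simp: ellitope_wf_def psd_def)
  then show "weighted_S el l $$ (i, j) = weighted_S el l $$ (j, i)" using ij by (simp add: weighted_S_def)
qed

lemma ell_setE:
  assumes el: "ellitope_wf nz el" and z: "\<zeta> \<in> ell_set el s"
  obtains f t where "t \<in> ell_T el" "\<zeta> = ell_P el *\<^sub>v vec (ell_dim el) f"
    "\<And>k. qform (ell_dim el) (ell_S el k) f \<le> s * t $h k"
proof -
  obtain y t where y: "y \<in> carrier_vec (ell_dim el)" "t \<in> ell_T el" "\<zeta> = ell_P el *\<^sub>v y"
    "\<And>k. y \<bullet> (ell_S el k *\<^sub>v y) \<le> s * t $h k"
    using z by (auto simp: ell_set_def)
  have "vec (ell_dim el) (($) y) = y" using y(1) by (intro eq_vecI) auto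
  moreover have "qform (ell_dim el) (ell_S el k) (($) y) \<le> s * t $h k" for k
  proof -
    have "ell_S el k \<in> carrier_mat (ell_dim el) (ell_dim el)" using el by (auto simp: ellitope_wf_def intro: psd_carrier)
    then show ?thesis using y(4)[of k] bilin_eq_scalar_prod[OF _ y(1) y(1)] by simp
  qed
  ultimately show ?thesis using that[of t "($) y"] y by simp
qed

lemma ell_setI:
  assumes el: "ellitope_wf nz el" and t: "t \<in> ell_T el" and f: "\<And>k. qform (ell_dim el) (ell_S el k) f \<le> s * t $h k"
  shows "ell_P el *\<^sub>v vec (ell_dim el) f \<in> ell_set el s"
proof -
  let ?y = "vec (ell_dim el) f"
  have "?y \<bullet> (ell_S el k *\<^sub>v ?y) \<le> s * t $h k" for k
  proof -
    have S: "ell_S el k \<in> carrier_mat (ell_dim el) (ell_dim el)" using el by (auto simp: ellitope_wf_def intro: psd_carrier)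
    have "?y \<bullet> (ell_S el k *\<^sub>v ?y) = qform (ell_dim el) (ell_S el k) (($) ?y)"
      by (rule bilin_eq_scalar_prod[OF S]) simp_all
    also have "\<dots> = qform (ell_dim el) (ell_S el k) f" by (rule bilin_cong) simp_all
    finally show ?thesis using f[of k] by simp
  qed
  then show ?thesis using t unfolding ell_set_def by (auto intro!: bexI[of _ ?y] bexI[of _ t])
qed

lemma ell_set_carrier:
  assumes "ellitope_wf nz el" "\<zeta> \<in> ell_set el s"
  shows "\<zeta> \<in> carrier_vec nz"
proof -
  obtain f t where "\<zeta> = ell_P el *\<^sub>v vec (ell_dim el) f" using ell_setE[OF assms] by blast
  moreover have "ell_P el \<in> carrier_mat nz (ell_dim el)" using assms(1) by (simp add: ellitope_wf_def)
  ultimately show ?thesis by simp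
qed

lemma ell_set_mono:
  assumes el: "ellitope_wf nz el" and "s \<le> s'"
  shows "ell_set el s \<subseteq> ell_set el s'"
proof
  fix \<zeta> assume "\<zeta> \<in> ell_set el s"
  then obtain f t where ft: "t \<in> ell_T el" "\<zeta> = ell_P el *\<^sub>v vec (ell_dim el) f"
    "\<And>k. qform (ell_dim el) (ell_S el k) f \<le> s * t $h k" using ell_setE[OF el] by blast
  have "0 \<le> t $h k" for k using el ft(1) by (auto simp: ellitope_wf_def)
  then have "s * t $h k \<le> s' * t $h k" for k using assms(2) by (intro mult_right_mono) auto
  then show "\<zeta> \<in> ell_set el s'" unfolding ft(2) using ft(3) by (intro ell_setI[OF el ft(1)]) (rule order_trans)
qed

lemma transpose_mult_vec_carrier:
  "P \<in> carrier_mat m n \<Longrightarrow> v \<in> carrier_vec m \<Longrightarrow> transpose_mat P *\<^sub>v v \<in> carrier_vec n"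
  by (rule mult_mat_vec_carrier) simp

lemma pullback_linear:
  fixes P :: "real mat"
  assumes P: "P \<in> carrier_mat m n" and v: "v \<in> carrier_vec m"
  shows "(\<Sum>i<n. (transpose_mat P *\<^sub>v v) $ i * f i) = v \<bullet> (P *\<^sub>v vec n f)"
proof -
  have "(\<Sum>i<n. (transpose_mat P *\<^sub>v v) $ i * f i) = (transpose_mat P *\<^sub>v v) \<bullet> vec n f"
    by (auto simp: scalar_prod_def atLeast0LessThan simp del: index_mult_mat_vec)
  also have "\<dots> = v \<bullet> (P *\<^sub>v vec n f)" by (rule transpose_vec_mult_scalar[OF P vec_carrier v])
  finally show ?thesis .
qed

lemma pullback_quadratic:
  assumes P: "P \<in> carrier_mat m n" and X: "X \<in> carrier_mat m m"
  shows "qform n (transpose_mat P * X * P) f = (P *\<^sub>v vec n f) \<bullet> (X *\<^sub>v (P *\<^sub>v vec n f))"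
proof -
  have c: "transpose_mat P * X * P \<in> carrier_mat n n" using P X by simp
  have "qform n (transpose_mat P * X * P) f = qform n (transpose_mat P * X * P) (($) (vec n f))"
    by (rule bilin_cong) simp_all
  also have "\<dots> = vec n f \<bullet> ((transpose_mat P * X * P) *\<^sub>v vec n f)"
    by (rule bilin_eq_scalar_prod[OF c, symmetric]) simp_all
  also have "\<dots> = (P *\<^sub>v vec n f) \<bullet> (X *\<^sub>v (P *\<^sub>v vec n f))"
    by (rule scalar_prod_congruence[OF X P]) simp
  finally show ?thesis .
qed

lemma certificate_sound:
  fixes l :: "real ^ 'k::finite"
  assumes el: "ellitope_wf nz el" and s: "0 < s" and l: "\<And>k. 0 \<le> l $h k" and t: "t \<in> ell_T el"
    and f: "\<And>k. qform (ell_dim el) (ell_S el k) f \<le> s * t $h k"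
  shows "qform (ell_dim el) (weighted_S el l) f \<le> s * supp_T el l"
proof -
  have "qform (ell_dim el) (weighted_S el l) f \<le> (\<Sum>k\<in>UNIV. l $h k * (s * t $h k))"
    unfolding bilin_weighted_S by (intro sum_mono mult_left_mono f l)
  also have "\<dots> = s * inner l t" by (simp add: inner_vec_def sum_distrib_left mult_ac)
  also have "\<dots> \<le> s * supp_T el l" using s supp_T_upper[OF el t] by simp
  finally show ?thesis .
qed

lemma sup_component_pos:
  assumes "ellitope_wf nz el"
  shows "0 < supp_T el (axis k 1)"
proof -
  obtain t where t: "t \<in> ell_T el" "\<And>k. 0 < t $h k" using ellitope_positive_point[OF assms] by blast
  have "0 < t $h k" by (rule t(2))
  also have "\<dots> = inner (axis k 1) t" by (simp add: inner_axis')
  also have "\<dots> \<le> supp_T el (axis k 1)" by (rule supp_T_upper[OF assms t(1)])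
  finally show ?thesis .
qed

text \<open>
  The certificate is evaluated at \<open>(f, 1)\<close> or, for \<open>K = 1\<close>, at \<open>(f, -1)\<close>, because the two forms of
  the constraint carry the linear term with opposite signs.
\<close>

lemma S_quad_constraint_sound:
  fixes el :: "('k::finite) ellitope"
  assumes el: "ellitope_wf nz el" and s: "0 < s"
    and X: "sol_X v i \<in> sym_mats nz" and x: "sol_x v i \<in> carrier_vec nz"
    and p: "p_coeff sys sp i (sol_law v) \<in> carrier_vec nz"
    and S: "S_quad_constraint sys el sp s v i" and z: "\<zeta> \<in> ell_set el s"
  shows "\<zeta> \<bullet> (sol_X v i *\<^sub>v \<zeta>) + 2 * ((sol_x v i + p_coeff sys sp i (sol_law v)) \<bullet> \<zeta>)
    \<le> sol_delta v i - q_coeff sys sp i (sol_law v)"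
proof -
  define n where "n = ell_dim el"
  define P where "P = ell_P el"
  define B where "B = transpose_mat P * sol_X v i * P"
  define b where "b = transpose_mat P *\<^sub>v (sol_x v i + p_coeff sys sp i (sol_law v))"
  define \<xi> where "\<xi> = sol_delta v i - q_coeff sys sp i (sol_law v)"
  define l where "l = sol_lam v i"
  have P: "P \<in> carrier_mat nz n" using el by (simp add: ellitope_wf_def P_def n_def)
  have Xc: "sol_X v i \<in> carrier_mat nz nz" using X by (rule sym_mats_carrier)
  have B: "B \<in> carrier_mat n n" using P Xc by (simp add: B_def)
  have xp: "sol_x v i + p_coeff sys sp i (sol_law v) \<in> carrier_vec nz" using x p by simp
  have b: "b \<in> carrier_vec n" unfolding b_def by (rule transpose_mult_vec_carrier[OF P xp])
  obtain f t where t: "t \<in> ell_T el" and zf: "\<zeta> = P *\<^sub>v vec n f"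
    and f: "\<And>k. qform n (ell_S el k) f \<le> s * t $h k"
    using ell_setE[OF el z] unfolding P_def n_def by blast
  have val: "\<zeta> \<bullet> (sol_X v i *\<^sub>v \<zeta>) + 2 * ((sol_x v i + p_coeff sys sp i (sol_law v)) \<bullet> \<zeta>)
      = qform n B f + 2 * (\<Sum>i<n. b $ i * f i)"
    unfolding zf B_def b_def pullback_quadratic[OF P Xc] pullback_linear[OF P xp] ..
  note S' = S[unfolded S_quad_constraint_def Let_def, folded P_def n_def, folded B_def b_def \<xi>_def l_def]
  have l0: "0 \<le> l $h k" for k using S' by blast
  have W: "weighted_S el l \<in> carrier_mat n n" by (simp add: weighted_S_def n_def)
  have "qform n B f + 2 * (\<Sum>i<n. b $ i * f i) \<le> \<xi>"
  proof (cases "CARD('k) > 1")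
    case True
    then have c: "psd (n + 1) (bordered_last (weighted_S el l - B) (- b) (sol_tau v i))"
      and le: "s * supp_T el l + sol_tau v i \<le> \<xi>" using S' by auto
    have "0 \<le> qform n (weighted_S el l - B) f + 2 * 1 * (\<Sum>i<n. (- b) $ i * f i) + sol_tau v i * 1\<^sup>2"
      by (rule psd_bordered_lastD[OF c minus_carrier_mat[OF B]]) (use b in simp)
    also have "(\<Sum>i<n. (- b) $ i * f i) = - (\<Sum>i<n. b $ i * f i)" using b by (simp add: sum_negf)
    finally have "qform n B f + 2 * (\<Sum>i<n. b $ i * f i) \<le> qform n (weighted_S el l) f + sol_tau v i"
      using bilin_diff_mat[OF W B] by simp
    then show ?thesis using certificate_sound[OF el s l0 t, of f] f le unfolding n_def by simp
  next
    case False
    define k :: 'k where "k = undefined"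
    define T where "T = supp_T el (axis k 1)"
    have T: "0 < T" unfolding T_def by (rule sup_component_pos[OF el])
    have Sk: "ell_S el k \<in> carrier_mat n n" using el by (auto simp: ellitope_wf_def n_def intro: psd_carrier)
    have Q: "Qbar el s k = (1 / (s * T)) \<cdot>\<^sub>m ell_S el k" by (simp add: Qbar_def T_def supp_T_axis)
    have Qc: "l $h k \<cdot>\<^sub>m Qbar el s k \<in> carrier_mat n n" using Sk by (simp add: Q)
    have c: "psd (n + 1) (bordered_last (l $h k \<cdot>\<^sub>m Qbar el s k - B) b (\<xi> - l $h k))"
      using S' False by auto
    have "0 \<le> qform n (l $h k \<cdot>\<^sub>m Qbar el s k - B) f + 2 * (- 1) * (\<Sum>i<n. b $ i * f i) + (\<xi> - l $h k) * (- 1)\<^sup>2"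
      by (rule psd_bordered_lastD[OF c minus_carrier_mat[OF B] b])
    then have le: "qform n B f + 2 * (\<Sum>i<n. b $ i * f i) \<le> l $h k * (qform n (ell_S el k) f / (s * T)) + (\<xi> - l $h k)"
      using bilin_diff_mat[OF Qc B] Sk by (simp add: Q bilin_smult_mat)
    have "t $h k \<le> T" using supp_T_upper[OF el t, of "axis k 1"] by (simp add: T_def inner_axis')
    then have "s * t $h k \<le> s * T" using s by simp
    then have "qform n (ell_S el k) f \<le> s * T" using f[of k] by linarith
    then have "qform n (ell_S el k) f / (s * T) \<le> 1" using s T by simp
    then have "l $h k * (qform n (ell_S el k) f / (s * T)) \<le> l $h k * 1" by (rule mult_left_mono) (rule l0)
    then show ?thesis using le by simp
  qed
  then show ?thesis unfolding val \<xi>_def .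
qed

lemma robust_certificate:
  fixes el :: "('k::finite) ellitope"
  assumes el: "ellitope_wf nz el" and s: "0 < s"
    and s': "s' = (if CARD('k) = 1 then s else 3 * ln (6 * real CARD('k)) * s)"
    and X: "X \<in> sym_mats nz" and v: "v \<in> carrier_vec nz"
    and bound: "\<And>\<zeta>. \<zeta> \<in> ell_set el s' \<Longrightarrow> \<zeta> \<bullet> (X *\<^sub>v \<zeta>) + 2 * (v \<bullet> \<zeta>) \<le> \<xi>"
  obtains l :: "real ^ 'k" and \<tau> where "\<And>k. 0 \<le> l $h k" and "s * supp_T el l + \<tau> \<le> \<xi>"
    and "\<And>f \<sigma>. qform (ell_dim el) (transpose_mat (ell_P el) * X * ell_P el) f
        + 2 * \<sigma> * (\<Sum>i<ell_dim el. (transpose_mat (ell_P el) *\<^sub>v v) $ i * f i)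
      \<le> qform (ell_dim el) (weighted_S el l) f + \<tau> * \<sigma>\<^sup>2"
proof -
  define n where "n = ell_dim el"
  define P where "P = ell_P el"
  have P: "P \<in> carrier_mat nz n" using el by (simp add: ellitope_wf_def P_def n_def)
  have Xc: "X \<in> carrier_mat nz nz" using X by (rule sym_mats_carrier)
  have B: "transpose_mat P * X * P \<in> sym_mats n" by (rule sym_mats_congruence[OF X P])
  have "hom_quad n (transpose_mat P * X * P) (($) (transpose_mat P *\<^sub>v v)) (f, 1) \<le> \<xi>"
    if "t \<in> ell_T el" "\<And>k. qform n (ell_S el k) f \<le> s' * t $h k" for f t
  proof -
    have "P *\<^sub>v vec n f \<in> ell_set el s'" unfolding P_def n_def by (rule ell_setI[OF el that(1)]) (use that(2) in \<open>simp add: n_def\<close>)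
    from bound[OF this] show ?thesis
      unfolding hom_quad_def fst_conv snd_conv pullback_quadratic[OF P Xc] pullback_linear[OF P v] by simp
  qed
  then obtain l :: "real ^ 'k" and \<tau> where l: "\<And>k. 0 \<le> l $h k"
    "\<And>t. t \<in> ell_T el \<Longrightarrow> s * inner l t + \<tau> \<le> \<xi>"
    "\<And>p. hom_quad n (transpose_mat P * X * P) (($) (transpose_mat P *\<^sub>v v)) p
      \<le> qform n (weighted_S el l) (fst p) + \<tau> * (snd p)\<^sup>2"
    using ellitope_certificate[OF el _ s s', of "transpose_mat P * X * P" "($) (transpose_mat P *\<^sub>v v)" \<xi>] B
    unfolding n_def by blast
  have "supp_T el l \<le> (\<xi> - \<tau>) / s"
  proof (rule supp_T_least[OF el])
    fix t assume "t \<in> ell_T el"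
    then show "inner l t \<le> (\<xi> - \<tau>) / s" using l(2)[of t] s by (simp add: pos_le_divide_eq mult.commute)
  qed
  then have "s * supp_T el l + \<tau> \<le> \<xi>" using s by (simp add: pos_le_divide_eq mult.commute)
  moreover have "qform n (transpose_mat P * X * P) f + 2 * \<sigma> * (\<Sum>i<n. (transpose_mat P *\<^sub>v v) $ i * f i)
      \<le> qform n (weighted_S el l) f + \<tau> * \<sigma>\<^sup>2" for f \<sigma>
    using l(3)[of "(f, \<sigma>)"] by (simp add: hom_quad_def)
  ultimately show ?thesis using that[of l \<tau>] l(1) unfolding n_def P_def by blast
qed

text \<open>
  For \<open>K = 1\<close> the scalar variable of the system is \<open>l s (max t)\<close>: the rescaling by \<open>Qbar\<close> undoes
  the factor, and the lower right entry, at least \<open>\<tau>\<close>, absorbs the rest.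
\<close>

lemma S_quad_constraint_complete:
  fixes el :: "('k::finite) ellitope"
  assumes el: "ellitope_wf nz el" and s: "0 < s"
    and s': "s' = (if CARD('k) = 1 then s else 3 * ln (6 * real CARD('k)) * s)"
    and X: "X \<in> sym_mats nz" and x: "x \<in> carrier_vec nz" and p: "p_coeff sys sp i c \<in> carrier_vec nz"
    and bound: "\<And>\<zeta>. \<zeta> \<in> ell_set el s' \<Longrightarrow>
      \<zeta> \<bullet> (X *\<^sub>v \<zeta>) + 2 * ((x + p_coeff sys sp i c) \<bullet> \<zeta>) \<le> \<delta> - q_coeff sys sp i c"
  shows "\<exists>(l :: real ^ 'k) \<tau>. \<forall>v. sol_law v = c \<and> sol_X v i = X \<and> sol_x v i = x \<and> sol_delta v i = \<delta> \<and>
    sol_lam v i = l \<and> sol_tau v i = \<tau> \<longrightarrow> S_quad_constraint sys el sp s v i"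
proof -
  define n where "n = ell_dim el"
  define P where "P = ell_P el"
  define B where "B = transpose_mat P * X * P"
  define b where "b = transpose_mat P *\<^sub>v (x + p_coeff sys sp i c)"
  define \<xi> where "\<xi> = \<delta> - q_coeff sys sp i c"
  have P: "P \<in> carrier_mat nz n" using el by (simp add: ellitope_wf_def P_def n_def)
  have Bs: "B \<in> sym_mats n" unfolding B_def by (rule sym_mats_congruence[OF X P])
  then have B: "B \<in> carrier_mat n n" by (rule sym_mats_carrier)
  have xp: "x + p_coeff sys sp i c \<in> carrier_vec nz" using x p by simp
  have b: "b \<in> carrier_vec n" unfolding b_def by (rule transpose_mult_vec_carrier[OF P xp])
  obtain l :: "real ^ 'k" and \<tau> where l: "\<And>k. 0 \<le> l $h k" "s * supp_T el l + \<tau> \<le> \<xi>"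
    and cert: "\<And>f \<sigma>. qform n B f + 2 * \<sigma> * (\<Sum>i<n. b $ i * f i) \<le> qform n (weighted_S el l) f + \<tau> * \<sigma>\<^sup>2"
    using robust_certificate[OF el s s' X xp bound] unfolding n_def B_def b_def P_def \<xi>_def by blast
  have Ws: "weighted_S el l \<in> sym_mats n" unfolding n_def by (rule weighted_S_sym[OF el])
  then have W: "weighted_S el l \<in> carrier_mat n n" by (rule sym_mats_carrier)
  show ?thesis
  proof (cases "CARD('k) > 1")
    case True
    have "psd (n + 1) (bordered_last (weighted_S el l - B) (- b) \<tau>)"
    proof (rule psd_bordered_lastI[OF sym_mats_diff[OF Ws Bs]])
      fix f \<sigma>
      have "(\<Sum>i<n. (- b) $ i * f i) = - (\<Sum>i<n. b $ i * f i)" using b by (simp add: sum_negf)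
      then show "0 \<le> qform n (weighted_S el l - B) f + 2 * \<sigma> * (\<Sum>i<n. (- b) $ i * f i) + \<tau> * \<sigma>\<^sup>2"
        using cert[of f \<sigma>] by (simp add: bilin_diff_mat[OF W B])
    qed (use b in simp)
    then show ?thesis
      using True l unfolding S_quad_constraint_def Let_def
      by (intro exI[of _ l] exI[of _ \<tau>]) (simp add: n_def B_def b_def P_def \<xi>_def)
  next
    case False
    then have card: "CARD('k) = 1" using zero_less_card_finite[where 'a = 'k] by linarith
    define k :: 'k where "k = undefined"
    have univ: "UNIV = {k}" by (rule UNIV_eq_singleton[OF card])
    define T where "T = supp_T el (axis k 1)"
    have T: "0 < T" unfolding T_def by (rule sup_component_pos[OF el])
    have Ss: "ell_S el k \<in> sym_mats n" using el by (auto simp: ellitope_wf_def n_def psd_def)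
    then have Sk: "ell_S el k \<in> carrier_mat n n" by (rule sym_mats_carrier)
    have Q: "Qbar el s k = (1 / (s * T)) \<cdot>\<^sub>m ell_S el k" by (simp add: Qbar_def T_def supp_T_axis)
    have inner1: "inner l t = l $h k * t $h k" for t by (simp add: inner_vec_def univ)
    have lT: "l $h k * T \<le> supp_T el l"
    proof (cases "l $h k = 0")
      case True
      obtain t where t: "t \<in> ell_T el" using ellitope_positive_point[OF el] by blast
      show ?thesis using supp_T_upper[OF el t, of l] True by (simp add: inner1)
    next
      case False
      then have lk: "0 < l $h k" using l(1)[of k] by simp
      have "T \<le> supp_T el l / l $h k"
        unfolding T_def
      proof (rule supp_T_least[OF el])
        fix t assume t: "t \<in> ell_T el"
        show "inner (axis k 1) t \<le> supp_T el l / l $h k"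
          using supp_T_upper[OF el t, of l] lk by (simp add: inner1 inner_axis' pos_le_divide_eq mult.commute)
      qed
      then show ?thesis using lk by (simp add: pos_le_divide_eq mult.commute)
    qed
    define \<Lambda> where "\<Lambda> = l $h k * (s * T)"
    have \<Lambda>0: "0 \<le> \<Lambda>" using l(1)[of k] s T by (simp add: \<Lambda>_def)
    have "\<Lambda> \<le> s * supp_T el l" using mult_left_mono[OF lT, of s] s by (simp add: \<Lambda>_def mult_ac)
    then have tau: "\<tau> \<le> \<xi> - \<Lambda>" using l(2) by simp
    have LQ: "\<Lambda> \<cdot>\<^sub>m Qbar el s k = l $h k \<cdot>\<^sub>m ell_S el k"
      using s T by (intro eq_matI) (auto simp: Q \<Lambda>_def)
    have lSs: "l $h k \<cdot>\<^sub>m ell_S el k \<in> sym_mats n" 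
      using Sk sym_mats_entry[OF Ss] by (intro sym_matsI) auto
    then have lSc: "l $h k \<cdot>\<^sub>m ell_S el k \<in> carrier_mat n n" by (rule sym_mats_carrier)
    have "psd (n + 1) (bordered_last (\<Lambda> \<cdot>\<^sub>m Qbar el s k - B) b (\<xi> - \<Lambda>))"
      unfolding LQ
    proof (rule psd_bordered_lastI[OF sym_mats_diff[OF lSs Bs] b])
      fix f \<sigma>
      have W1: "qform n (weighted_S el l) f = l $h k * qform n (ell_S el k) f"
        unfolding n_def bilin_weighted_S by (simp add: univ)
      have "\<tau> * \<sigma>\<^sup>2 \<le> (\<xi> - \<Lambda>) * \<sigma>\<^sup>2" using tau by (rule mult_right_mono) simp
      then show "0 \<le> qform n (l $h k \<cdot>\<^sub>m ell_S el k - B) f + 2 * \<sigma> * (\<Sum>i<n. b $ i * f i) + (\<xi> - \<Lambda>) * \<sigma>\<^sup>2"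
        using cert[of f "- \<sigma>"] unfolding W1 bilin_diff_mat[OF lSc B] bilin_smult_mat[OF Sk] by simp
    qed
    moreover have "j = k" for j using univ by blast
    ultimately have "psd (n + 1) (bordered_last (\<Lambda> \<cdot>\<^sub>m Qbar el s j - B) b (\<xi> - \<Lambda>))" for j
      by metis
    then show ?thesis
      using False \<Lambda>0 unfolding S_quad_constraint_def Let_def
      by (intro exI[of _ "vec_lambda (\<lambda>_. \<Lambda>)"] exI[of _ \<tau>]) (simp add: n_def B_def b_def P_def \<xi>_def)
  qed
qed

lemma lin_constraint_sound:
  fixes l :: "real ^ 'k::finite"
  assumes el: "ellitope_wf nz el" and s: "0 < s" and p: "p \<in> carrier_vec nz" and l: "\<And>k. 0 \<le> l $h k"
    and c: "psd (ell_dim el + 1) (bordered_first a (- (transpose_mat (ell_P el) *\<^sub>v p)) (weighted_S el l))"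
    and z: "\<zeta> \<in> ell_set el s"
  shows "2 * (p \<bullet> \<zeta>) \<le> a + s * supp_T el l"
proof -
  define n where "n = ell_dim el"
  define P where "P = ell_P el"
  define b where "b = transpose_mat P *\<^sub>v p"
  have P: "P \<in> carrier_mat nz n" using el by (simp add: ellitope_wf_def P_def n_def)
  have b: "b \<in> carrier_vec n" unfolding b_def by (rule transpose_mult_vec_carrier[OF P p])
  have W: "weighted_S el l \<in> carrier_mat n n" by (simp add: weighted_S_def n_def)
  obtain f t where t: "t \<in> ell_T el" and zf: "\<zeta> = P *\<^sub>v vec n f"
    and f: "\<And>k. qform n (ell_S el k) f \<le> s * t $h k"
    using ell_setE[OF el z] unfolding P_def n_def by blast
  have "0 \<le> qform n (weighted_S el l) f + 2 * 1 * (\<Sum>i<n. (- b) $ i * f i) + a * 1\<^sup>2"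
    by (rule psd_bordered_firstD[OF c[folded n_def P_def, folded b_def] W]) (use b in simp)
  also have "(\<Sum>i<n. (- b) $ i * f i) = - (\<Sum>i<n. b $ i * f i)" using b by (simp add: sum_negf)
  also have "(\<Sum>i<n. b $ i * f i) = p \<bullet> \<zeta>" unfolding b_def zf by (rule pullback_linear[OF P p])
  finally show ?thesis using certificate_sound[OF el s l t, of f] f unfolding n_def by simp
qed

text \<open>
  A linear constraint is a quadratic one with matrix zero.
\<close>

lemma lin_constraint_complete:
  fixes el :: "('k::finite) ellitope"
  assumes el: "ellitope_wf nz el" and s: "0 < s"
    and s': "s' = (if CARD('k) = 1 then s else 3 * ln (6 * real CARD('k)) * s)"
    and p: "p \<in> carrier_vec nz" and bound: "\<And>\<zeta>. \<zeta> \<in> ell_set el s' \<Longrightarrow> 2 * (p \<bullet> \<zeta>) \<le> \<xi>"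
  shows "\<exists>(l :: real ^ 'k) a. (\<forall>k. 0 \<le> l $h k) \<and>
    psd (ell_dim el + 1) (bordered_first a (- (transpose_mat (ell_P el) *\<^sub>v p)) (weighted_S el l)) \<and>
    a + s * supp_T el l \<le> \<xi>"
proof -
  define n where "n = ell_dim el"
  define P where "P = ell_P el"
  define b where "b = transpose_mat P *\<^sub>v p"
  have P: "P \<in> carrier_mat nz n" using el by (simp add: ellitope_wf_def P_def n_def)
  have b: "b \<in> carrier_vec n" unfolding b_def by (rule transpose_mult_vec_carrier[OF P p])
  have Z: "0\<^sub>m nz nz \<in> sym_mats nz" by (simp add: sym_mats_def)
  have Zq: "y \<bullet> (0\<^sub>m nz nz *\<^sub>v y) = 0" if "y \<in> carrier_vec nz" for y :: "real vec"
    unfolding bilin_eq_scalar_prod[OF zero_carrier_mat that that] by (simp add: bilin_def)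
  have bound0: "\<zeta> \<bullet> (0\<^sub>m nz nz *\<^sub>v \<zeta>) + 2 * (p \<bullet> \<zeta>) \<le> \<xi>" if "\<zeta> \<in> ell_set el s'" for \<zeta>
    using bound[OF that] Zq[OF ell_set_carrier[OF el that]] by simp
  have P0: "qform n (transpose_mat P * 0\<^sub>m nz nz * P) f = 0" for f
    unfolding pullback_quadratic[OF P zero_carrier_mat] using P by (intro Zq) simp
  obtain l :: "real ^ 'k" and \<tau> where l: "\<And>k. 0 \<le> l $h k" "s * supp_T el l + \<tau> \<le> \<xi>"
    and cert': "\<And>f \<sigma>. qform n (transpose_mat P * 0\<^sub>m nz nz * P) f + 2 * \<sigma> * (\<Sum>i<n. b $ i * f i)
        \<le> qform n (weighted_S el l) f + \<tau> * \<sigma>\<^sup>2"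
    using robust_certificate[OF el s s' Z p bound0] unfolding n_def b_def P_def by blast
  have cert: "2 * \<sigma> * (\<Sum>i<n. b $ i * f i) \<le> qform n (weighted_S el l) f + \<tau> * \<sigma>\<^sup>2" for f \<sigma>
    using cert'[of f \<sigma>] unfolding P0 by simp
  have "psd (n + 1) (bordered_first \<tau> (- b) (weighted_S el l))"
  proof (rule psd_bordered_firstI)
    show "weighted_S el l \<in> sym_mats n" unfolding n_def by (rule weighted_S_sym[OF el])
    fix f \<sigma>
    have "(\<Sum>i<n. (- b) $ i * f i) = - (\<Sum>i<n. b $ i * f i)" using b by (simp add: sum_negf)
    then show "0 \<le> qform n (weighted_S el l) f + 2 * \<sigma> * (\<Sum>i<n. (- b) $ i * f i) + \<tau> * \<sigma>\<^sup>2"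
      using cert[of \<sigma> f] by simp
  qed (use b in simp)
  then show ?thesis using l unfolding n_def b_def P_def by (intro exI[of _ l] exI[of _ \<tau>]) (simp add: add.commute)
qed

lemma aug_bordered_quadratic:
  assumes X: "X \<in> carrier_mat n n" and x: "x \<in> carrier_vec n" and z: "\<zeta> \<in> carrier_vec n"
  shows "aug \<zeta> \<bullet> (bordered_last X x a *\<^sub>v aug \<zeta>) = \<zeta> \<bullet> (X *\<^sub>v \<zeta>) + 2 * (x \<bullet> \<zeta>) + a"
proof -
  have "aug \<zeta> \<bullet> (bordered_last X x a *\<^sub>v aug \<zeta>) = qform (Suc n) (bordered_last X x a) (($) (aug \<zeta>))"
    by (rule bilin_eq_scalar_prod[OF bordered_last_carrier[OF X x] aug_carrier[OF z] aug_carrier[OF z]])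
  also have "\<dots> = qform n X (($) (aug \<zeta>)) + 2 * (\<Sum>i<n. x $ i * \<zeta> $ i) + a"
    unfolding bilin_bordered_last[OF X x] by (simp add: aug_index[OF z])
  also have "qform n X (($) (aug \<zeta>)) = qform n X (($) \<zeta>)"
    by (rule bilin_cong) (simp_all add: aug_index[OF z])
  also have "\<dots> = \<zeta> \<bullet> (X *\<^sub>v \<zeta>)" by (rule bilin_eq_scalar_prod[OF X z z, symmetric])
  finally show ?thesis using z by (simp add: scalar_prod_def atLeast0LessThan)
qed

lemma covariance_constraint_iff:
  assumes Q: "Q \<in> carrier_mat m d" and E: "E \<in> carrier_mat d n" and Cov: "psd n Cov" and Sig: "Sig \<in> sym_mats m"
  shows "psd (m + n) (four_block_mat Sig (Q * E * psd_sqrt n Cov)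
       (transpose_mat (psd_sqrt n Cov) * transpose_mat E * transpose_mat Q) (1\<^sub>m n))
    \<longleftrightarrow> loewner_le m (Q * (E * Cov * transpose_mat E) * transpose_mat Q) Sig"
proof -
  define R where "R = psd_sqrt n Cov"
  have R: "psd n R" "R * R = Cov" unfolding R_def by (rule psd_sqrt_correct[OF Cov])+
  have Rc: "R \<in> carrier_mat n n" and Rt: "transpose_mat R = R" using R(1) by (auto intro: psd_carrier psd_transpose)
  define G where "G = Q * E * R"
  have QE: "Q * E \<in> carrier_mat m n" using Q E by simp
  have G: "G \<in> carrier_mat m n" using QE Rc by (simp add: G_def)
  have Et: "transpose_mat E \<in> carrier_mat n d" and Qt: "transpose_mat Q \<in> carrier_mat d m" using E Q by auto
  have Gt: "transpose_mat G = transpose_mat R * transpose_mat E * transpose_mat Q"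
  proof -
    have "transpose_mat G = transpose_mat R * (transpose_mat E * transpose_mat Q)"
      unfolding G_def transpose_mult[OF QE Rc] transpose_mult[OF Q E] ..
    then show ?thesis using Rc Et Qt by (simp add: Rt)
  qed
  have "G * transpose_mat G = Q * E * R * (R * (transpose_mat E * transpose_mat Q))"
    unfolding G_def transpose_mult[OF QE Rc] transpose_mult[OF Q E] Rt ..
  also have "\<dots> = Q * (E * ((R * R) * (transpose_mat E * transpose_mat Q)))"
    using Q E Rc Et Qt by (simp add: assoc_mult_mat[of _ m d _ n _ m] assoc_mult_mat[of _ n n _ n _ m] assoc_mult_mat[of _ m n _ n _ m] assoc_mult_mat[of _ d n _ n _ m])
  also have "\<dots> = Q * (E * Cov * transpose_mat E) * transpose_mat Q"
    unfolding R(2) using Q E psd_carrier[OF Cov] Et Qt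
    by (simp add: assoc_mult_mat[of _ m d _ d _ m] assoc_mult_mat[of _ d n _ n _ d] assoc_mult_mat[of _ d n _ d _ m] assoc_mult_mat[of _ n n _ d _ m])
  finally have GG: "G * transpose_mat G = Q * (E * Cov * transpose_mat E) * transpose_mat Q" .
  show ?thesis
    using schur_complement[OF Sig G] unfolding GG unfolding Gt unfolding loewner_le_def G_def R_def .
qed

section \<open>The convex system and the problem of interest\<close>

lemma S_feasible_robust_value:
  fixes el :: "('k::finite) ellitope"
  assumes wf: "plant_wf sys" and el: "ellitope_wf (n_zeta sys) el" and sp: "specs_wf (n_w sys) sp" and s: "0 < s"
    and S: "S_feasible Cov sys el sp g s v" and i: "i \<in> I1 sp \<union> I3 sp" and z: "\<zeta> \<in> ell_set el s"
  defines "w \<equiv> Zmat sys (sol_law v) *\<^sub>v aug \<zeta>"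
  shows "(quadA sp i *\<^sub>v (w - center sp i)) \<bullet> (w - center sp i) \<le> sol_alpha v i + sol_delta v i + r_const sp i"
proof -
  define c nz where "c = sol_law v" and "nz = n_zeta sys"
  define M where "M = transpose_mat (Zmat sys c) * quadA sp i * Zmat sys c"
  have c: "c \<in> pob_laws sys" and X: "sol_X v i \<in> sym_mats nz" and x: "sol_x v i \<in> carrier_vec nz"
    and lo: "loewner_le (nz + 1) M (bordered_last (sol_X v i) (sol_x v i) (sol_alpha v i))"
    and con: "S_quad_constraint sys el sp s v i"
    using S i unfolding S_feasible_def Let_def c_def nz_def M_def by auto
  have A: "psd (n_w sys) (quadA sp i)" using sp i by (auto simp: specs_wf_def)
  have zc: "\<zeta> \<in> carrier_vec nz" unfolding nz_def by (rule ell_set_carrier[OF el z])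
  have p: "p_coeff sys sp i c \<in> carrier_vec nz" unfolding nz_def by (rule pq_coeffs_quad(1)[OF wf c sp i])
  have Xc: "sol_X v i \<in> carrier_mat nz nz" using X by (rule sym_mats_carrier)
  have M: "M \<in> carrier_mat (Suc nz) (Suc nz)"
    using psd_congruence[OF A closed_loop_matrices(1)[OF wf c]] unfolding M_def nz_def by (rule psd_carrier)
  have aug: "aug \<zeta> \<in> carrier_vec (Suc nz)" by (rule aug_carrier[OF zc])
  define N where "N = bordered_last (sol_X v i) (sol_x v i) (sol_alpha v i)"
  have N: "N \<in> carrier_mat (Suc nz) (Suc nz)" unfolding N_def by (rule bordered_last_carrier[OF Xc x])
  have "0 \<le> aug \<zeta> \<bullet> ((N - M) *\<^sub>v aug \<zeta>)" using lo aug unfolding loewner_le_def psd_def N_def by simp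
  also have "\<dots> = aug \<zeta> \<bullet> (N *\<^sub>v aug \<zeta>) - aug \<zeta> \<bullet> (M *\<^sub>v aug \<zeta>)"
    using N M aug by (simp add: minus_mult_distrib_mat_vec scalar_prod_minus_distrib)
  also have "aug \<zeta> \<bullet> (N *\<^sub>v aug \<zeta>) = \<zeta> \<bullet> (sol_X v i *\<^sub>v \<zeta>) + 2 * (sol_x v i \<bullet> \<zeta>) + sol_alpha v i"
    unfolding N_def by (rule aug_bordered_quadratic[OF Xc x zc])
  finally have 1: "aug \<zeta> \<bullet> (M *\<^sub>v aug \<zeta>) \<le> \<zeta> \<bullet> (sol_X v i *\<^sub>v \<zeta>) + 2 * (sol_x v i \<bullet> \<zeta>) + sol_alpha v i" by simp
  have 2: "\<zeta> \<bullet> (sol_X v i *\<^sub>v \<zeta>) + 2 * ((sol_x v i + p_coeff sys sp i c) \<bullet> \<zeta>) \<le> sol_delta v i - q_coeff sys sp i c"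
    using S_quad_constraint_sound[OF el s X[unfolded nz_def] x[unfolded nz_def] _ con z] p unfolding c_def nz_def by simp
  have 3: "(sol_x v i + p_coeff sys sp i c) \<bullet> \<zeta> = sol_x v i \<bullet> \<zeta> + p_coeff sys sp i c \<bullet> \<zeta>"
    by (rule add_scalar_prod_distrib[OF x p zc])
  show ?thesis
    using quad_value[OF wf c sp i zc[unfolded nz_def]] 1 2 3 unfolding w_def c_def M_def by linarith
qed

text \<open>
  The matrices on the right-hand side are merely symmetric here, since in the optimization
  problems they are decision variables.
\<close>

lemma S_feasible_imp_poi_feasible:
  fixes el :: "('k::finite) ellitope"
  assumes wf: "plant_wf sys" and pr: "prob_space M" and zm: "zero_mean_with_cov M eps (n_eps sys) Cov"
    and el: "ellitope_wf (n_zeta sys) el" and sp: "specs_wf (n_w sys) sp"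
    and Sig: "\<And>i. i \<in> I4 sp \<Longrightarrow> snd g i \<in> sym_mats (m_dim sp i)" and s: "0 < s"
    and S: "S_feasible Cov sys el sp g s v"
  shows "poi_feasible M eps Cov sys el sp g s (sol_law v)"
proof -
  define c where "c = sol_law v"
  have c: "c \<in> pob_laws sys" using S unfolding S_feasible_def Let_def c_def by blast
  note zc = ell_set_carrier[OF el]
  show ?thesis
    unfolding poi_feasible_def c_def[symmetric]
  proof (intro conjI ballI c)
    fix i \<zeta> assume i: "i \<in> I1 sp" and z: "\<zeta> \<in> ell_set el s"
    have A: "psd (n_w sys) (quadA sp i)" and b: "center sp i \<in> carrier_vec (n_w sys)" using sp i by (auto simp: specs_wf_def)
    have "sol_alpha v i + sol_delta v i
        + (frob_norm (psd_sqrt (n_w sys) (quadA sp i) * Emat sys c * psd_sqrt (n_eps sys) Cov))\<^sup>2 + r_const sp i \<le> fst g i"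
      using S i unfolding S_feasible_def Let_def c_def by blast
    then show "(\<integral>\<omega>. (quadA sp i *\<^sub>v (traj sys c \<zeta> (eps \<omega>) - center sp i))
              \<bullet> (traj sys c \<zeta> (eps \<omega>) - center sp i) \<partial>M) \<le> fst g i"
      using S_feasible_robust_value[OF wf el sp s S _ z, of i] i
      unfolding expected_quad_traj[OF wf c pr zm zc[OF z] A b] unfolding c_def by simp
  next
    fix i \<zeta> assume i: "i \<in> I2 sp" and z: "\<zeta> \<in> ell_set el s"
    have l: "\<And>k. 0 \<le> sol_lam v i $h k"
      and psd: "psd (ell_dim el + 1) (bordered_first (sol_alpha v i)
                 (- (transpose_mat (ell_P el) *\<^sub>v p_coeff sys sp i c)) (weighted_S el (sol_lam v i)))"
      and le: "sol_alpha v i + s * supp_T el (sol_lam v i) + q_coeff sys sp i c \<le> fst g i"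
      using S i unfolding S_feasible_def Let_def c_def by auto
    note pq = pq_coeffs_lin[OF wf c sp i]
    show "lin_a sp i \<bullet> mean_traj M eps sys c \<zeta> \<le> fst g i"
      unfolding mean_traj_eq[OF wf c pr zm zc[OF z]] pq(2)[OF zc[OF z]]
      using lin_constraint_sound[OF el s pq(1) l psd z] le by simp
  next
    fix i \<zeta> assume i: "i \<in> I3 sp" and z: "\<zeta> \<in> ell_set el s"
    have "sol_alpha v i + sol_delta v i + r_const sp i \<le> fst g i"
      using S i unfolding S_feasible_def Let_def by blast
    then show "(quadA sp i *\<^sub>v (mean_traj M eps sys c \<zeta> - center sp i)) \<bullet> (mean_traj M eps sys c \<zeta> - center sp i) \<le> fst g i"
      using S_feasible_robust_value[OF wf el sp s S _ z, of i] i
      unfolding mean_traj_eq[OF wf c pr zm zc[OF z]] unfolding c_def by simp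
  next
    fix i assume i: "i \<in> I4 sp"
    have Q: "covQ sp i \<in> carrier_mat (m_dim sp i) (n_w sys)" using sp i by (auto simp: specs_wf_def)
    have "psd (m_dim sp i + n_eps sys)
              (four_block_mat (snd g i) (covQ sp i * Emat sys c * psd_sqrt (n_eps sys) Cov)
                 (transpose_mat (psd_sqrt (n_eps sys) Cov) * transpose_mat (Emat sys c) * transpose_mat (covQ sp i)) (1\<^sub>m (n_eps sys)))"
      using S i unfolding S_feasible_def Let_def c_def by blast
    then show "loewner_le (m_dim sp i) (covQ sp i * cov_traj Cov sys c * transpose_mat (covQ sp i)) (snd g i)"
      unfolding cov_traj_def covariance_constraint_iff[OF Q closed_loop_matrices(2)[OF wf c] covariance_psd[OF zm] Sig[OF i]] .
  qed
qed

text \<open>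
  The first matrix inequality of the system is satisfied with equality, by the blocks of
  \<open>Z\<^sup>T A Z\<close>, and \<open>\<delta>\<close> takes all the slack that remains. The robust bound for the remaining quadratic
  inequality in \<open>\<zeta>\<close> is then precisely the constraint of the problem of interest, and the
  multipliers come from the certificate.
\<close>

lemma poi_feasible_imp_S_feasible:
  fixes el :: "('k::finite) ellitope" and sp :: "'i specs"
  assumes wf: "plant_wf sys" and pr: "prob_space M" and zm: "zero_mean_with_cov M eps (n_eps sys) Cov"
    and el: "ellitope_wf (n_zeta sys) el" and sp: "specs_wf (n_w sys) sp"
    and Sig: "\<And>i. i \<in> I4 sp \<Longrightarrow> snd g i \<in> sym_mats (m_dim sp i)" and s: "0 < s"
    and s': "s' = (if CARD('k) = 1 then s else 3 * ln (6 * real CARD('k)) * s)"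
    and F: "poi_feasible M eps Cov sys el sp g s' c"
  shows "\<exists>v :: ('k, 'i) sol. S_feasible Cov sys el sp g s v \<and> sol_law v = c"
proof -
  have c: "c \<in> pob_laws sys" using F unfolding poi_feasible_def by blast
  define nz where "nz = n_zeta sys"
  note zc = ell_set_carrier[OF el, folded nz_def]
  define fro where "fro i = (if i \<in> I1 sp
    then (frob_norm (psd_sqrt (n_w sys) (quadA sp i) * Emat sys c * psd_sqrt (n_eps sys) Cov))\<^sup>2 else 0)" for i
  define Mt where "Mt i = transpose_mat (Zmat sys c) * quadA sp i * Zmat sys c" for i
  define X where "X i = mat nz nz (($$) (Mt i))" for i
  define x where "x i = vec nz (\<lambda>j. Mt i $$ (j, nz))" for i
  define \<alpha> where "\<alpha> i = Mt i $$ (nz, nz)" for i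
  define \<delta> where "\<delta> i = fst g i - \<alpha> i - fro i - r_const sp i" for i
  have Msym: "Mt i \<in> sym_mats (nz + 1)" if i: "i \<in> I1 sp \<union> I3 sp" for i
  proof -
    have A: "psd (n_w sys) (quadA sp i)" using sp i by (auto simp: specs_wf_def)
    have "psd (Suc nz) (Mt i)" unfolding Mt_def nz_def by (rule psd_congruence[OF A closed_loop_matrices(1)[OF wf c]])
    then show ?thesis by (simp add: psd_def)
  qed
  have border: "bordered_last (X i) (x i) (\<alpha> i) = Mt i" if i: "i \<in> I1 sp \<union> I3 sp" for i
    unfolding X_def x_def \<alpha>_def by (rule bordered_last_of_sym_mat[OF Msym[OF i]])
  have Xs: "X i \<in> sym_mats nz" if i: "i \<in> I1 sp \<union> I3 sp" for i
    unfolding X_def using sym_mats_entry[OF Msym[OF i]] by (intro sym_matsI) auto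
  have xc: "x i \<in> carrier_vec nz" for i by (simp add: x_def)
  have quad: "\<exists>(l :: real ^ 'k) \<tau>. \<forall>v. sol_law v = c \<and> sol_X v i = X i \<and> sol_x v i = x i \<and> sol_delta v i = \<delta> i \<and>
      sol_lam v i = l \<and> sol_tau v i = \<tau> \<longrightarrow> S_quad_constraint sys el sp s v i" if i: "i \<in> I1 sp \<union> I3 sp" for i
  proof (rule S_quad_constraint_complete[OF el[folded nz_def] s s' Xs[OF i] xc])
    show p: "p_coeff sys sp i c \<in> carrier_vec nz" unfolding nz_def by (rule pq_coeffs_quad(1)[OF wf c sp i])
    fix \<zeta> assume z: "\<zeta> \<in> ell_set el s'"
    have A: "psd (n_w sys) (quadA sp i)" and b: "center sp i \<in> carrier_vec (n_w sys)" using sp i by (auto simp: specs_wf_def)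
    have zn: "\<zeta> \<in> carrier_vec (n_zeta sys)" using zc[OF z] by (simp add: nz_def)
    have bound: "(quadA sp i *\<^sub>v (Zmat sys c *\<^sub>v aug \<zeta> - center sp i)) \<bullet> (Zmat sys c *\<^sub>v aug \<zeta> - center sp i) + fro i \<le> fst g i"
    proof (cases "i \<in> I1 sp")
      case True
      then have "(\<integral>\<omega>. (quadA sp i *\<^sub>v (traj sys c \<zeta> (eps \<omega>) - center sp i))
              \<bullet> (traj sys c \<zeta> (eps \<omega>) - center sp i) \<partial>M) \<le> fst g i"
        using F z unfolding poi_feasible_def by blast
      then show ?thesis unfolding expected_quad_traj[OF wf c pr zm zn A b] using True by (simp add: fro_def)
    next
      case False
      then have "i \<in> I3 sp" using i by blast
      then have "(quadA sp i *\<^sub>v (mean_traj M eps sys c \<zeta> - center sp i))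
          \<bullet> (mean_traj M eps sys c \<zeta> - center sp i) \<le> fst g i"
        using F z unfolding poi_feasible_def by blast
      then show ?thesis unfolding mean_traj_eq[OF wf c pr zm zn] using False by (simp add: fro_def)
    qed
    have "aug \<zeta> \<bullet> (Mt i *\<^sub>v aug \<zeta>) = \<zeta> \<bullet> (X i *\<^sub>v \<zeta>) + 2 * (x i \<bullet> \<zeta>) + \<alpha> i"
      unfolding border[OF i, symmetric] by (rule aug_bordered_quadratic[OF sym_mats_carrier[OF Xs[OF i]] xc zc[OF z]])
    moreover have "(x i + p_coeff sys sp i c) \<bullet> \<zeta> = x i \<bullet> \<zeta> + p_coeff sys sp i c \<bullet> \<zeta>"
      by (rule add_scalar_prod_distrib[OF xc p zc[OF z]])
    ultimately show "\<zeta> \<bullet> (X i *\<^sub>v \<zeta>) + 2 * ((x i + p_coeff sys sp i c) \<bullet> \<zeta>) \<le> \<delta> i - q_coeff sys sp i c"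
      using bound quad_value[OF wf c sp i zn] unfolding Mt_def[symmetric] \<delta>_def by simp
  qed
  have lin: "\<exists>(l :: real ^ 'k) a. (\<forall>k. 0 \<le> l $h k) \<and>
    psd (ell_dim el + 1) (bordered_first a (- (transpose_mat (ell_P el) *\<^sub>v p_coeff sys sp i c)) (weighted_S el l)) \<and>
    a + s * supp_T el l \<le> fst g i - q_coeff sys sp i c" if i: "i \<in> I2 sp" for i
  proof (rule lin_constraint_complete[OF el s s' pq_coeffs_lin(1)[OF wf c sp i]])
    fix \<zeta> assume z: "\<zeta> \<in> ell_set el s'"
    have zn: "\<zeta> \<in> carrier_vec (n_zeta sys)" using zc[OF z] by (simp add: nz_def)
    have "lin_a sp i \<bullet> mean_traj M eps sys c \<zeta> \<le> fst g i" using F i z unfolding poi_feasible_def by blast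
    then show "2 * (p_coeff sys sp i c \<bullet> \<zeta>) \<le> fst g i - q_coeff sys sp i c"
      unfolding mean_traj_eq[OF wf c pr zm zn] pq_coeffs_lin(2)[OF wf c sp i zn] by simp
  qed
  define good1 where "good1 i l \<tau> \<longleftrightarrow> (\<forall>v. sol_law v = c \<and> sol_X v i = X i \<and> sol_x v i = x i \<and> sol_delta v i = \<delta> i \<and>
      sol_lam v i = l \<and> sol_tau v i = \<tau> \<longrightarrow> S_quad_constraint sys el sp s v i)" for i and l :: "real ^ 'k" and \<tau>
  define good2 where "good2 i l a \<longleftrightarrow> (\<forall>k. 0 \<le> l $h k) \<and>
    psd (ell_dim el + 1) (bordered_first a (- (transpose_mat (ell_P el) *\<^sub>v p_coeff sys sp i c)) (weighted_S el l)) \<and>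
    a + s * supp_T el l \<le> fst g i - q_coeff sys sp i c" for i and l :: "real ^ 'k" and a
  have "\<exists>l \<tau>. (i \<in> I1 sp \<union> I3 sp \<longrightarrow> good1 i l \<tau>)" for i using quad[of i] unfolding good1_def by blast
  then obtain l1 \<tau> where l1: "\<And>i. i \<in> I1 sp \<union> I3 sp \<Longrightarrow> good1 i (l1 i) (\<tau> i)" by metis
  have "\<exists>l a. (i \<in> I2 sp \<longrightarrow> good2 i l a)" for i using lin[of i] unfolding good2_def by blast
  then obtain l2 a where l2: "\<And>i. i \<in> I2 sp \<Longrightarrow> good2 i (l2 i) (a i)" by metis
  define v :: "('k, 'i) sol" where "v = \<lparr>sol_law = c, sol_X = X, sol_x = x,
    sol_alpha = (\<lambda>i. if i \<in> I2 sp then a i else \<alpha> i), sol_delta = \<delta>,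
    sol_lam = (\<lambda>i. if i \<in> I2 sp then l2 i else l1 i), sol_tau = \<tau>\<rparr>"
  have law: "sol_law v = c" by (simp add: v_def)
  have not2: "i \<notin> I2 sp" if "i \<in> I1 sp \<union> I3 sp" for i using sp that by (auto simp: specs_wf_def)
  have "S_feasible Cov sys el sp g s v"
    unfolding S_feasible_def Let_def law
  proof (intro conjI ballI c)
    fix i assume i: "i \<in> I1 sp \<union> I3 sp"
    show "sol_X v i \<in> sym_mats (n_zeta sys)" using Xs[OF i] by (simp add: v_def nz_def)
    show "sol_x v i \<in> carrier_vec (n_zeta sys)" using xc by (simp add: v_def nz_def)
    have "psd (nz + 1) (Mt i - Mt i)" by (rule psd_zero_diff[OF sym_mats_carrier[OF Msym[OF i]]])
    moreover have "bordered_last (sol_X v i) (sol_x v i) (sol_alpha v i) = Mt i"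
      using border[OF i] not2[OF i] by (simp add: v_def)
    ultimately show "loewner_le (n_zeta sys + 1) (transpose_mat (Zmat sys c) * quadA sp i * Zmat sys c)
              (bordered_last (sol_X v i) (sol_x v i) (sol_alpha v i))"
      unfolding loewner_le_def by (simp add: Mt_def nz_def)
    show "S_quad_constraint sys el sp s v i"
      using l1[OF i] not2[OF i] unfolding good1_def by (simp add: v_def)
  next
    fix i assume i: "i \<in> I1 sp"
    then show "sol_alpha v i + sol_delta v i
        + (frob_norm (psd_sqrt (n_w sys) (quadA sp i) * Emat sys c * psd_sqrt (n_eps sys) Cov))\<^sup>2 + r_const sp i \<le> fst g i"
      using not2[of i] by (simp add: v_def \<delta>_def fro_def)
  next
    fix i assume i: "i \<in> I3 sp"
    then have "i \<notin> I1 sp" using sp by (auto simp: specs_wf_def)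
    then show "sol_alpha v i + sol_delta v i + r_const sp i \<le> fst g i"
      using i not2[of i] by (simp add: v_def \<delta>_def fro_def)
  next
    fix i assume i: "i \<in> I2 sp"
    show "\<forall>k. 0 \<le> sol_lam v i $h k" using l2[OF i] i by (simp add: v_def good2_def)
  next
    fix i assume i: "i \<in> I2 sp"
    show "psd (ell_dim el + 1) (bordered_first (sol_alpha v i)
                 (- (transpose_mat (ell_P el) *\<^sub>v p_coeff sys sp i c)) (weighted_S el (sol_lam v i)))"
      and "sol_alpha v i + s * supp_T el (sol_lam v i) + q_coeff sys sp i c \<le> fst g i"
      using l2[OF i] i by (simp_all add: v_def good2_def)
  next
    fix i assume i: "i \<in> I4 sp"
    have Q: "covQ sp i \<in> carrier_mat (m_dim sp i) (n_w sys)" using sp i by (auto simp: specs_wf_def)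
    have "loewner_le (m_dim sp i) (covQ sp i * cov_traj Cov sys c * transpose_mat (covQ sp i)) (snd g i)"
      using F i unfolding poi_feasible_def by blast
    then show "psd (m_dim sp i + n_eps sys)
              (four_block_mat (snd g i) (covQ sp i * Emat sys c * psd_sqrt (n_eps sys) Cov)
                 (transpose_mat (psd_sqrt (n_eps sys) Cov) * transpose_mat (Emat sys c) * transpose_mat (covQ sp i)) (1\<^sub>m (n_eps sys)))"
      unfolding cov_traj_def covariance_constraint_iff[OF Q closed_loop_matrices(2)[OF wf c] covariance_psd[OF zm] Sig[OF i]] .
  qed
  then show ?thesis using law by blast
qed

lemma poi_feasible_mono:
  assumes "ellitope_wf nz el" "s \<le> s'" "poi_feasible M eps Cov sys el sp g s' c"
  shows "poi_feasible M eps Cov sys el sp g s c"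
  using assms(3) ell_set_mono[OF assms(1,2)] unfolding poi_feasible_def by blast

theorem mainTheorem4:
  fixes sys :: plant
    and el :: "('k::finite) ellitope"
    and sp :: "'i specs"
    and M :: "'w measure" and eps :: "'w \<Rightarrow> real vec" and Cov :: "real mat"
    and \<gamma> :: "'i \<Rightarrow> real" and Sig :: "'i \<Rightarrow> real mat"
    and \<rho> \<kappa> :: real
  assumes "plant_wf sys"
    and "prob_space M"
    and "zero_mean_with_cov M eps (n_eps sys) Cov"
    and "ellitope_wf (n_zeta sys) el"
    and "specs_wf (n_w sys) sp"
    and "\<And>i. i \<in> I4 sp \<Longrightarrow> posdef (m_dim sp i) (Sig i)"
    and "\<rho> > 0"
    and "\<kappa> = 3 * ln (6 * real CARD('k))"
  shows
    "(\<forall>v. S_feasible Cov sys el sp (\<gamma>, Sig) \<rho> v \<longrightarrow>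
          poi_feasible M eps Cov sys el sp (\<gamma>, Sig) \<rho> (sol_law v))
     \<and>
     (CARD('k) = 1 \<longrightarrow>
        (\<forall>c. poi_feasible M eps Cov sys el sp (\<gamma>, Sig) \<rho> c \<longrightarrow>
             (\<exists>v. S_feasible Cov sys el sp (\<gamma>, Sig) \<rho> v \<and> sol_law v = c)) \<and>
        ((\<nexists>v. S_feasible Cov sys el sp (\<gamma>, Sig) \<rho> v) \<longleftrightarrow>
         (\<nexists>c. poi_feasible M eps Cov sys el sp (\<gamma>, Sig) \<rho> c)))
     \<and>
     (CARD('k) > 1 \<and> (\<nexists>v. S_feasible Cov sys el sp (\<gamma>, Sig) \<rho> v) \<longrightarrow>
        (\<nexists>c. poi_feasible M eps Cov sys el sp (\<gamma>, Sig) (\<kappa> * \<rho>) c))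
     \<and>
     (\<forall>f \<A>. convex_objective sys sp f \<and> (\<forall>G \<in> \<A>. convex_constraint sys sp G) \<longrightarrow>
        (\<forall>v g. (v, g) \<in> Pplus_feas Cov sys el sp \<A> \<rho> \<longrightarrow>
             (sol_law v, g) \<in> P_feas M eps Cov sys el sp \<A> \<rho> \<and>
             f (sol_law v, g) = Pplus_obj f (v, g)) \<and>
        (\<forall>s>0. Opt f (P_feas M eps Cov sys el sp \<A> s)
                 \<le> Opt (Pplus_obj f) (Pplus_feas Cov sys el sp \<A> s) \<and>
               Opt (Pplus_obj f) (Pplus_feas Cov sys el sp \<A> s)
                 \<le> Opt f (P_feas M eps Cov sys el sp \<A> (\<kappa> * s))))"
proof -
  note base = assms(1-5)
  have Sig: "i \<in> I4 sp \<Longrightarrow> snd (\<gamma>, Sig) i \<in> sym_mats (m_dim sp i)" for i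
    using assms(6) by (simp add: posdef_def)
  have Sig_g: "i \<in> I4 sp \<Longrightarrow> snd g i \<in> sym_mats (m_dim sp i)" if "g \<in> rhs_space sp" for g i
    using that by (auto simp: rhs_space_def)
  note sound = S_feasible_imp_poi_feasible[OF base]
  note complete = poi_feasible_imp_S_feasible[OF base]
  have kappa: "1 \<le> \<kappa>"
  proof -
    have "exp 1 \<le> 6 * real CARD('k)"
    proof -
      have "1 \<le> real CARD('k)" by (simp add: Suc_le_eq)
      then show ?thesis using exp_le by linarith
    qed
    then have "ln (exp 1) \<le> ln (6 * real CARD('k))" by (subst ln_le_cancel_iff) simp_all
    then show ?thesis using assms(8) by simp
  qed
  \<comment> \<open>For \<open>K = 1\<close> the system is complete at level \<open>s\<close>, where less is required than at \<open>\<kappa> * s\<close>.\<close>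
  have complete_kappa: "\<exists>v. S_feasible Cov sys el sp g s v \<and> sol_law v = c"
    if g: "\<And>i. i \<in> I4 sp \<Longrightarrow> snd g i \<in> sym_mats (m_dim sp i)" and s: "0 < s"
      and F: "poi_feasible M eps Cov sys el sp g (\<kappa> * s) c" for g s c
  proof (cases "CARD('k) = 1")
    case True
    have "s \<le> \<kappa> * s" using kappa s by simp
    then have "poi_feasible M eps Cov sys el sp g s c" using F by (rule poi_feasible_mono[OF assms(4)])
    then show ?thesis using True by (intro complete[OF g s, of s]) auto
  next
    case False
    then show ?thesis using F assms(8) by (intro complete[OF g s, of "\<kappa> * s"]) auto
  qed
  have part1: "poi_feasible M eps Cov sys el sp (\<gamma>, Sig) \<rho> (sol_law v)"
    if "S_feasible Cov sys el sp (\<gamma>, Sig) \<rho> v" for v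
    by (rule sound[OF Sig assms(7) that])
  have part2: "\<exists>v. S_feasible Cov sys el sp (\<gamma>, Sig) \<rho> v \<and> sol_law v = c"
    if "CARD('k) = 1" "poi_feasible M eps Cov sys el sp (\<gamma>, Sig) \<rho> c" for c
    using complete[OF Sig assms(7), of \<rho> c] that by simp
  have part4: "(sol_law v, g) \<in> P_feas M eps Cov sys el sp \<A> s"
    if "(v, g) \<in> Pplus_feas Cov sys el sp \<A> s" "0 < s" for v g \<A> s
    using that sound[OF Sig_g, of g s v] unfolding Pplus_feas_def P_feas_def by blast
  have lower: "Opt f (P_feas M eps Cov sys el sp \<A> s) \<le> Opt (Pplus_obj f) (Pplus_feas Cov sys el sp \<A> s)"
    if "0 < s" for f \<A> s
    unfolding Opt_def
  proof (rule INF_greatest)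
    fix a assume a: "a \<in> Pplus_feas Cov sys el sp \<A> s"
    obtain v g where vg: "a = (v, g)" by (rule prod.exhaust)
    show "(INF b\<in>P_feas M eps Cov sys el sp \<A> s. f b) \<le> Pplus_obj f a"
      using part4[OF a[unfolded vg] that] unfolding vg Pplus_obj_def prod.case by (rule INF_lower)
  qed
  have upper: "Opt (Pplus_obj f) (Pplus_feas Cov sys el sp \<A> s) \<le> Opt f (P_feas M eps Cov sys el sp \<A> (\<kappa> * s))"
    if s: "0 < s" for f \<A> s
    unfolding Opt_def
  proof (rule INF_greatest)
    fix a assume a: "a \<in> P_feas M eps Cov sys el sp \<A> (\<kappa> * s)"
    obtain c g where cg: "a = (c, g)" by (rule prod.exhaust)
    have g: "g \<in> rhs_space sp" and F: "poi_feasible M eps Cov sys el sp g (\<kappa> * s) c" and cons: "\<forall>G \<in> \<A>. (c, g) \<in> G"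
      using a unfolding cg P_feas_def by auto
    obtain v where v: "S_feasible Cov sys el sp g s v" "sol_law v = c"
      using complete_kappa[OF Sig_g[OF g] s F] by blast
    have "(v, g) \<in> Pplus_feas Cov sys el sp \<A> s" using g v cons unfolding Pplus_feas_def by simp
    then have "(INF b\<in>Pplus_feas Cov sys el sp \<A> s. Pplus_obj f b) \<le> Pplus_obj f (v, g)" by (rule INF_lower)
    then show "(INF b\<in>Pplus_feas Cov sys el sp \<A> s. Pplus_obj f b) \<le> f a"
      using v(2) by (simp add: Pplus_obj_def cg)
  qed
  show ?thesis
  proof (intro conjI impI allI)
    show "poi_feasible M eps Cov sys el sp (\<gamma>, Sig) \<rho> (sol_law v)"
      if "S_feasible Cov sys el sp (\<gamma>, Sig) \<rho> v" for v by (rule part1[OF that])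
    show "\<exists>v. S_feasible Cov sys el sp (\<gamma>, Sig) \<rho> v \<and> sol_law v = c"
      if "CARD('k) = 1" "poi_feasible M eps Cov sys el sp (\<gamma>, Sig) \<rho> c" for c by (rule part2[OF that])
    show "(\<nexists>v. S_feasible Cov sys el sp (\<gamma>, Sig) \<rho> v) \<longleftrightarrow> (\<nexists>c. poi_feasible M eps Cov sys el sp (\<gamma>, Sig) \<rho> c)"
      if "CARD('k) = 1" using part1 part2[OF that] by blast
    show "\<nexists>c. poi_feasible M eps Cov sys el sp (\<gamma>, Sig) (\<kappa> * \<rho>) c"
      if "CARD('k) > 1 \<and> (\<nexists>v. S_feasible Cov sys el sp (\<gamma>, Sig) \<rho> v)"
      using that complete_kappa[OF Sig assms(7)] by blast
    show "(sol_law v, g) \<in> P_feas M eps Cov sys el sp \<A> \<rho>"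
      if "(v, g) \<in> Pplus_feas Cov sys el sp \<A> \<rho>" for \<A> v g by (rule part4[OF that assms(7)])
    show "f (sol_law v, g) = Pplus_obj f (v, g)" for f v g by (simp add: Pplus_obj_def)
    show "Opt f (P_feas M eps Cov sys el sp \<A> s) \<le> Opt (Pplus_obj f) (Pplus_feas Cov sys el sp \<A> s)"
      if "0 < s" for f \<A> s by (rule lower[OF that])
    show "Opt (Pplus_obj f) (Pplus_feas Cov sys el sp \<A> s) \<le> Opt f (P_feas M eps Cov sys el sp \<A> (\<kappa> * s))"
      if "0 < s" for f \<A> s by (rule upper[OF that])
  qed
qed

end
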